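(* Suppose that the sparsity pattern $I_{\mathcal{S}}$ is block-diagonal with square blocks and that $R$ has the same sparsity pattern as $I_{\mathcal{S}}$. Then all points in $K^\dagger(\alpha)$ converge to the zero matrix as $\alpha\to\infty$; that is, for every $\varepsilon>0$ there is $\alpha_0$ such that $\|K\|<\varepsilon$ for all $\alpha\ge\alpha_0$ and all $K\in K^\dagger(\alpha)$. Furthermore, $J(K,\alpha)\to0$ as $\alpha\to\infty$ for all $K\in K^\dagger(\alpha)$; that is, for every $\varepsilon>0$ there is $\alpha_0$ such that $J(K,\alpha)<\varepsilon$ for all $\alpha\ge\alpha_0$ and all $K\in K^\dagger(\alpha)$.
   Context: Setting. Let $A\in\mathbb{R}^{n\times n}$, $B\in\mathbb{R}^{n\times m}$, $Q\in\mathbb{R}^{n\times n}$ symmetric positive semidefinite, $R\in\mathbb{R}^{m\times m}$ symmetric positive definite, and $D_0\in\mathbb{R}^{n\times n}$ symmetric positive definite. A real square matrix is stable if all its eigenvalues lie in the open left half plane. Let $\mathcal{S}\subseteq\mathbb{R}^{m\times n}$ be a linear subspace specified by fixing certain entries of the matrix to zero; its indicator matrix $I_{\mathcal{S}}\in\{0,1\}^{m\times n}$ has $(i,j)$ entry $1$ if $K_{ij}$ is free and $0$ if $K_{ij}$ is required to be $0$. "$I_{\mathcal{S}}$ is block-diagonal with square blocks" means that $m=n$ and, for some partition of $\{1,\dots,n\}$ into consecutive intervals, $[I_{\mathcal{S}}]_{ij}=1$ exactly when $i,j$ lie in the same interval. "$R$ has the same sparsity pattern as $I_{\mathcal{S}}$"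 means $R_{ij}=0$ whenever $[I_{\mathcal{S}}]_{ij}=0$. For a damping parameter $\alpha$ and $K\in\mathbb{R}^{m\times n}$ such that $A-\alpha I+BK$ is stable, define $$J(K,\alpha)=\mathbb{E}\int_0^\infty\left[x(t)^\top Qx(t)+u(t)^\top Ru(t)\right]dt,\quad \dot x(t)=(A-\alpha I)x(t)+Bu(t),\ u(t)=Kx(t),$$ where $x(0)=x_0$ is a random vector with zero mean and $\mathbb{E}[x_0x_0^\top]=D_0$. Equivalently, $J(K,\alpha)=\mathrm{tr}(D_0P)$ where $P$ is the unique solution of $(A-\alpha I+BK)^\top P+P(A-\alpha I+BK)+K^\top RK+Q=0$. $K^\dagger(\alpha)$ denotes the set of locally optimal solutions (local minimizers) of the problem: minimize $J(K,\alpha)$ over $K\in\mathcal{S}$ such that $A-\alpha I+BK$ is stable. $\|\cdot\|$ is the operator norm. *)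

theory Defs
  imports "HOL-Probability.Probability"
begin

definition positive_semidefinite :: "real^'n^'n \<Rightarrow> bool" where
  "positive_semidefinite M \<longleftrightarrow> transpose M = M \<and> (\<forall>x. 0 \<le> x \<bullet> (M *v x))"

definition positive_definite :: "real^'n^'n \<Rightarrow> bool" where
  "positive_definite M \<longleftrightarrow> transpose M = M \<and> (\<forall>x. x \<noteq> 0 \<longrightarrow> 0 < x \<bullet> (M *v x))"

definition complex_eigenvalue :: "real^'n^'n \<Rightarrow> complex \<Rightarrow> bool" where
  "complex_eigenvalue M \<mu> \<longleftrightarrow>
     (\<exists>v :: complex^'n. v \<noteq> 0 \<and> map_matrix complex_of_real M *v v = \<mu> *s v)"

definition stable :: "real^'n^'n \<Rightarrow> bool" where
  "stable M \<longleftrightarrow> (\<forall>\<mu>. complex_eigenvalue M \<mu> \<longrightarrow> Re \<mu> < 0)"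

definition entry_subspace :: "(real^'n^'m) set \<Rightarrow> bool" where
  "entry_subspace S \<longleftrightarrow> (\<exists>Z. S = {K. \<forall>(i, j) \<in> Z. K $ i $ j = 0})"

definition indicator_matrix :: "(real^'n^'m) set \<Rightarrow> real^'n^'m" where
  "indicator_matrix S = (\<chi> i j. if \<forall>K\<in>S. K $ i $ j = 0 then 0 else 1)"

text \<open>The linear order on the index type plays the role of the usual order on the row and column
  numbers; on a finite linear order the consecutive intervals are the sets \<open>{a..b}\<close>.\<close>

definition block_diagonal_square :: "real^('n::{finite,linorder})^('n::{finite,linorder}) \<Rightarrow> bool" where
  "block_diagonal_square I \<longleftrightarrow>
     (\<exists>P. partition_on UNIV P \<and> (\<forall>X\<in>P. \<exists>a b. X = {a..b}) \<and>
          (\<forall>i j. I $ i $ j = 1 \<longleftrightarrow> (\<exists>X\<in>P. i \<in> X \<and> j \<in> X)))"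

definition has_sparsity_pattern :: "real^'n^'m \<Rightarrow> real^'n^'m \<Rightarrow> bool" where
  "has_sparsity_pattern M I \<longleftrightarrow> (\<forall>i j. I $ i $ j = 0 \<longrightarrow> M $ i $ j = 0)"

definition closed_loop :: "real^'n^'n \<Rightarrow> real^'m^'n \<Rightarrow> real \<Rightarrow> real^'n^'m \<Rightarrow> real^'n^'n" where
  "closed_loop A B \<alpha> K = A - mat \<alpha> + B ** K"

definition is_trajectory ::
    "real^'n^'n \<Rightarrow> real^'m^'n \<Rightarrow> real \<Rightarrow> real^'n^'m \<Rightarrow> real^'n \<Rightarrow> (real \<Rightarrow> real^'n) \<Rightarrow> bool" where
  "is_trajectory A B \<alpha> K \<xi> x \<longleftrightarrow> x 0 = \<xi> \<and>
     (\<forall>t\<ge>0. (x has_vector_derivative (A - mat \<alpha>) *v x t + B *v (K *v x t)) (at t within {0..}))"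

text \<open>A linear initial value problem has exactly one solution on \<open>{0..}\<close>, and only the values
  there enter the cost, so the choice of the trajectory is immaterial.\<close>

definition trajectory ::
    "real^'n^'n \<Rightarrow> real^'m^'n \<Rightarrow> real \<Rightarrow> real^'n^'m \<Rightarrow> real^'n \<Rightarrow> real \<Rightarrow> real^'n" where
  "trajectory A B \<alpha> K \<xi> = (SOME x. is_trajectory A B \<alpha> K \<xi> x)"

definition random_initial_state :: "'w measure \<Rightarrow> ('w \<Rightarrow> real^'n) \<Rightarrow> real^'n^'n \<Rightarrow> bool" where
  "random_initial_state M x0 D \<longleftrightarrow> prob_space M \<and> x0 \<in> borel_measurable M \<and>
     (\<forall>i. integrable M (\<lambda>\<omega>. x0 \<omega> $ i) \<and> (\<integral>\<omega>. x0 \<omega> $ i \<partial>M) = 0) \<and>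
     (\<forall>i j. integrable M (\<lambda>\<omega>. x0 \<omega> $ i * x0 \<omega> $ j) \<and> (\<integral>\<omega>. x0 \<omega> $ i * x0 \<omega> $ j \<partial>M) = D $ i $ j)"

text \<open>Bochner integrals are \<open>0\<close> for non-integrable functions, so this is the intended cost
  only when the closed loop is stable, which makes the state decay exponentially.\<close>

definition cost ::
    "real^'n^'n \<Rightarrow> real^'m^'n \<Rightarrow> real^'n^'n \<Rightarrow> real^'m^'m \<Rightarrow> 'w measure \<Rightarrow> ('w \<Rightarrow> real^'n) \<Rightarrow>
     real^'n^'m \<Rightarrow> real \<Rightarrow> real" where
  "cost A B Q R M x0 K \<alpha> =
     (\<integral>\<omega>. (LINT t:{0..}|lborel.
         (let x = trajectory A B \<alpha> K (x0 \<omega>) t; u = K *v x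
          in x \<bullet> (Q *v x) + u \<bullet> (R *v u))) \<partial>M)"

definition local_minimizers :: "('a::metric_space \<Rightarrow> real) \<Rightarrow> 'a set \<Rightarrow> 'a set" where
  "local_minimizers f X = {x \<in> X. \<exists>\<delta>>0. \<forall>y\<in>X. dist y x < \<delta> \<longrightarrow> f x \<le> f y}"

definition locally_optimal_gains ::
    "real^'n^'n \<Rightarrow> real^'m^'n \<Rightarrow> real^'n^'n \<Rightarrow> real^'m^'m \<Rightarrow> 'w measure \<Rightarrow> ('w \<Rightarrow> real^'n) \<Rightarrow>
     (real^'n^'m) set \<Rightarrow> real \<Rightarrow> (real^'n^'m) set" where
  "locally_optimal_gains A B Q R M x0 S \<alpha> =
     local_minimizers (\<lambda>K. cost A B Q R M x0 K \<alpha>) {K \<in> S. stable (closed_loop A B \<alpha> K)}"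

end

theory Submission
  imports Defs "HOL-Computational_Algebra.Fundamental_Theorem_Algebra"
begin

text \<open>Write \<open>J = tr (D\<^sub>0 P)\<close>, where \<open>P\<close> and \<open>L\<close> solve the Lyapunov equations of the closed loop
  and of its transpose. The gradient of \<open>J\<close> in \<open>K\<close> is \<open>2 (B\<^sup>T P + R K) L\<close>, and \<open>\<partial>J / \<partial>\<alpha> = - 2 tr
  (P L) < 0\<close>. Along a differentiable curve of critical points parametrized by \<open>\<alpha>\<close>, \<open>J\<close> is
  therefore decreasing, hence bounded. To reach arbitrary critical points one uses that the
  problem is algebraic. Were \<open>J\<close> unbounded on critical points with \<open>\<alpha> \<rightarrow> \<infinity>\<close>, a sequence of such
  points would be a point over an ultrapower of the reals. Derivations of the ultrapower that
  vanish at \<open>\<alpha>\<close> also vanish at \<open>J\<close>, because the point is critical, so \<open>J\<close> is algebraic over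
  \<open>\<real>(\<alpha>)\<close>; the derivation with \<open>D \<alpha> = 1\<close> shows that the resulting real plane curve has negative
  slope at the points \<open>(\<alpha>\<^sub>n, J\<^sub>n)\<close>. Following its branches to the left contradicts \<open>J\<^sub>n \<rightarrow> \<infinity>\<close>. Once
  \<open>J\<close> is bounded, the stationarity condition in the direction \<open>K\<close> gives \<open>K = O(1 / \<alpha>)\<close> and \<open>J =
  O(1 / \<alpha>)\<close>.\<close>

section \<open>Matrices and quadratic forms\<close>

text \<open>A local minimizer need not cost less than \<open>K = 0\<close>, so nothing bounds its
  cost at the outset: \<open>B ** K\<close> might be as large as \<alpha> and offset the damping.
  Following a critical point in \<alpha> by the implicit function theorem breaks down where the
  Hessian degenerates. The algebraic route needs no nondegeneracy: in characteristic 0, an element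
  transcendental over a subring has a derivation that kills the subring but not the element, and
  stationarity enters only as the product of the differentiated gain with the gradient, which
  vanishes entry by entry. The relation between \<alpha> and \<open>J\<close> is taken of least
  degree in \<open>J\<close>, hence coprime to its slope polynomial; beyond some value of \<alpha>
  the curve has neither poles nor horizontal or vertical tangents. A decreasing branch continued to
  the left can then only climb until it reaches a fixed parameter value, where finitely many roots
  bound its height.\<close>

lemma matrix_add_rdistrib: "(A + B) ** C = A ** C + B ** (C :: 'a::semiring_1^'p^'n)"
  by (vector matrix_matrix_mult_def sum.distrib[symmetric] distrib_right)

lemma matrix_diff_ldistrib: "A ** (B - C) = A ** B - A ** (C :: 'a::ring_1^'p^'n)"
  by (vector matrix_matrix_mult_def sum_subtractf[symmetric] right_diff_distrib)

lemma matrix_diff_rdistrib: "(A - B) ** C = A ** C - B ** (C :: 'a::ring_1^'p^'n)"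
  by (vector matrix_matrix_mult_def sum_subtractf[symmetric] left_diff_distrib)

lemma matrix_minus_left: "(- A) ** C = - (A ** (C :: 'a::ring_1^'p^'n))"
  using matrix_diff_rdistrib[of 0 A C] by simp

lemma matrix_minus_right: "A ** (- C) = - (A ** (C :: 'a::ring_1^'p^'n))"
  using matrix_diff_ldistrib[of A 0 C] by simp

lemma transpose_add: "transpose (A + B) = transpose A + transpose B"
  and transpose_diff: "transpose (A - B) = transpose A - transpose (B :: 'a::group_add^'n^'m)"
  by (simp_all add: transpose_def vec_eq_iff)

lemma trace_transpose: "trace (transpose A) = trace A"
  by (simp add: trace_def transpose_def)

lemma matrix_mat_right: "X ** mat c = mat c ** (X :: 'a::comm_semiring_1^'n^'n)"
  by (simp add: vec_eq_iff matrix_matrix_mult_def mat_def if_distrib if_distribR mult.commute cong: if_cong)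

lemma mat_mult_nth: "(mat c ** (X :: 'a::semiring_1^'p^'n)) $ i $ j = c * X $ i $ j"
  by (simp add: matrix_matrix_mult_def mat_def if_distrib if_distribR cong: if_cong)

lemma mat_mult_vec: "mat c *v x = c *\<^sub>R (x :: real^'n)"
  by (simp add: vec_eq_iff matrix_vector_mult_def mat_def if_distrib if_distribR cong: if_cong)

lemma trace_mat_mult: "trace (mat c ** (X :: 'a::semiring_1^'n^'n)) = c * trace X"
  by (simp add: trace_def mat_mult_nth sum_distrib_left)

lemma inner_transpose_mult: "x \<bullet> (transpose M *v y) = (M *v x) \<bullet> (y :: real^'m)"
  using dot_lmul_matrix[of y M x] by (simp add: inner_commute)

lemma inner_symmetric_mult:
  fixes M :: "real^'n^'n"
  assumes "transpose M = M"
  shows "x \<bullet> (M *v y) = y \<bullet> (M *v x)"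
  using inner_transpose_mult[of x M y] assms by (simp add: inner_commute del: transpose_matrix_vector)

lemma inner_axis_mult: "axis i 1 \<bullet> (M *v axis j 1) = (M :: real^'n^'m) $ i $ j"
  by (simp add: inner_axis' matrix_vector_mul_component inner_axis)

section \<open>Semidefinite matrices and their traces\<close>

lemma psd_transpose: "positive_semidefinite M \<Longrightarrow> transpose M = M"
  and psd_nonneg: "positive_semidefinite M \<Longrightarrow> 0 \<le> x \<bullet> (M *v x)"
  by (simp_all add: positive_semidefinite_def)

lemma positive_definite_imp_psd: "positive_definite M \<Longrightarrow> positive_semidefinite M"
  unfolding positive_definite_def positive_semidefinite_def
  by (metis inner_zero_left less_eq_real_def)

text \<open>The form is nonnegative at \<open>y\<close>, the remainder of \<open>x\<close> after the
  projection on \<open>e\<close> that is orthogonal for the form of \<open>M\<close>.\<close>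

lemma psd_Cauchy_Schwarz:
  assumes M: "positive_semidefinite M" and pos: "0 < e \<bullet> (M *v e)"
  shows "(x \<bullet> (M *v e))\<^sup>2 / (e \<bullet> (M *v e)) \<le> x \<bullet> (M *v x)"
proof -
  define b c where "b = x \<bullet> (M *v e)" and "c = e \<bullet> (M *v e)"
  define y where "y = x - (b / c) *\<^sub>R e"
  have "e \<bullet> (M *v x) = b"
    unfolding b_def using psd_transpose[OF M] by (rule inner_symmetric_mult)
  then have "y \<bullet> (M *v y) = x \<bullet> (M *v x) - 2 * (b / c) * b + (b / c)\<^sup>2 * c"
    unfolding y_def by (simp add: algebra_simps inner_diff_left inner_diff_right power2_eq_square flip:
        b_def c_def)
  also have "\<dots> = x \<bullet> (M *v x) - b\<^sup>2 / c"
    using pos by (simp add: field_simps power2_eq_square flip: c_def)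
  finally show ?thesis using psd_nonneg[OF M, of y] by (simp add: b_def c_def)
qed

text \<open>Along the line through \<open>x = M *v e\<close> in direction \<open>e\<close> the form
  is affine in the parameter, with slope twice the squared norm of \<open>x\<close>; unless
  \<open>x\<close> vanishes, the parameter used at the end gives the value -1.\<close>

lemma psd_kernel:
  assumes M: "positive_semidefinite M" and zero: "e \<bullet> (M *v e) = 0"
  shows "M *v e = 0"
proof (rule ccontr)
  assume nz: "M *v e \<noteq> 0"
  define x where "x = M *v e"
  define a b where "a = x \<bullet> (M *v x)" and "b = x \<bullet> x"
  have "b > 0" using nz by (simp add: b_def x_def)
  have "e \<bullet> (M *v x) = b"
    using inner_symmetric_mult[OF psd_transpose[OF M], of e x] by (simp add: b_def x_def)
  then have expand: "(x + t *\<^sub>R e) \<bullet> (M *v (x + t *\<^sub>R e)) = a + 2 * t * b" for t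
    using zero by (simp add: algebra_simps inner_add_left inner_add_right a_def b_def flip: x_def)
  have "0 \<le> a + 2 * (- (a + 1) / (2 * b)) * b"
    using psd_nonneg[OF M] unfolding expand[symmetric] .
  with \<open>b > 0\<close> show False by (simp add: field_simps)
qed

lemma psd_diag_nonneg: "positive_semidefinite M \<Longrightarrow> 0 \<le> M $ i $ i"
  using psd_nonneg[of M "axis i 1"] by (simp add: inner_axis_mult)

lemma trace_mult_rank_one:
  fixes P :: "real^'n^'n"
  shows "trace (P ** (\<chi> i j. u $ i * v $ j)) = v \<bullet> (P *v u)"
  by (simp add: trace_def matrix_matrix_mult_def inner_vec_def matrix_vector_mult_def sum_distrib_left
      mult_ac)

text \<open>Subtracting a rank-one matrix clears a row of \<open>M\<close> (Cholesky); in the end \<open>M\<close> is a sum of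
  matrices \<open>v v\<^sup>T\<close>, each of which contributes \<open>v \<bullet> P v\<close> to the trace.\<close>

lemma trace_mult_psd_nonneg:
  assumes P: "positive_semidefinite P" and "positive_semidefinite M"
  shows "0 \<le> trace (P ** M)"
  using assms(2)
proof (induction "card {i. M $ i \<noteq> 0}" arbitrary: M rule: less_induct)
  case less
  note M = less.prems
  show ?case
  proof (cases "\<exists>i. M $ i $ i \<noteq> 0")
    case False
    have "column j M = 0" for j
      using psd_kernel[OF M, of "axis j 1"] False
      by (simp add: inner_axis_mult matrix_vector_mul_component column_def vec_eq_iff inner_axis)
    then have "M = 0" by (simp add: vec_eq_iff column_def)
    then show ?thesis by (simp add: trace_def)
  next
    case True
    then obtain i where i: "M $ i $ i > 0" using psd_diag_nonneg[OF M] by (metis less_eq_real_def)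
    define u where "u = M *v axis i 1"
    define c where "c = M $ i $ i"
    define N where "N = (\<chi> k l. u $ k * (u $ l / c))"
    have sym: "M $ k $ l = M $ l $ k" for k l
      using psd_transpose[OF M] by (metis transpose_def vec_lambda_beta)
    have u: "u $ k = M $ k $ i" for k
      by (simp add: u_def matrix_vector_mul_component inner_axis)
    have Nx: "N *v x = ((u \<bullet> x) / c) *\<^sub>R u" for x
      by (simp add: N_def matrix_vector_mult_def vec_eq_iff inner_vec_def sum_distrib_left
          sum_divide_distrib mult_ac)
    have psd: "positive_semidefinite (M - N)"
      unfolding positive_semidefinite_def
    proof (intro conjI allI)
      have "transpose N = N" by (simp add: N_def transpose_def vec_eq_iff mult_ac)
      then show "transpose (M - N) = M - N" using psd_transpose[OF M] by (simp add: transpose_diff)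
      fix x
      have "x \<bullet> (N *v x) = (x \<bullet> u)\<^sup>2 / c"
        by (simp add: Nx inner_commute power2_eq_square)
      then show "0 \<le> x \<bullet> ((M - N) *v x)"
        using psd_Cauchy_Schwarz[OF M, of "axis i 1" x] i
        by (simp add: inner_axis_mult algebra_simps inner_diff_right u_def c_def)
    qed
    have "(M - N) $ i $ l = 0" for l using i sym[of i l] by (simp add: N_def u c_def)
    then have "(M - N) $ i = 0" by (simp add: vec_eq_iff)
    moreover have "(M - N) $ k = 0" if "M $ k = 0" for k
      using that by (simp add: N_def u vec_eq_iff)
    ultimately have "{k. (M - N) $ k \<noteq> 0} \<subseteq> {k. M $ k \<noteq> 0} - {i}" by blast
    moreover have "i \<in> {k. M $ k \<noteq> 0}"
    proof -
      have "M $ i \<noteq> 0" using i by (metis less_irrefl zero_index)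
      then show ?thesis by simp
    qed
    ultimately have "{k. (M - N) $ k \<noteq> 0} \<subset> {k. M $ k \<noteq> 0}" by blast
    then have "card {k. (M - N) $ k \<noteq> 0} < card {k. M $ k \<noteq> 0}" by (intro psubset_card_mono) auto
    then have "0 \<le> trace (P ** (M - N))" using psd by (rule less.hyps)
    moreover have "trace (P ** N) = (u \<bullet> (P *v u)) / c"
      using trace_mult_rank_one[of P u "(1 / c) *\<^sub>R u"] by (simp add: N_def)
    moreover have "0 \<le> (u \<bullet> (P *v u)) / c" using i psd_nonneg[OF P] by (simp add: c_def)
    ultimately show ?thesis by (simp add: matrix_diff_ldistrib trace_sub)
  qed
qed

lemma psd_mat: "0 \<le> c \<Longrightarrow> positive_semidefinite (mat c)"
  by (simp add: positive_semidefinite_def mat_mult_vec)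

lemma psd_trace_nonneg: "positive_semidefinite P \<Longrightarrow> 0 \<le> trace P"
  by (simp add: trace_def sum_nonneg psd_diag_nonneg)

text \<open>Testing the form on the sum and the difference of two axis vectors bounds twice the
  entry by two diagonal entries, each of them at most the trace.\<close>

lemma psd_entry_le_trace:
  assumes P: "positive_semidefinite P"
  shows "\<bar>P $ i $ j\<bar> \<le> trace P"
proof -
  have diag: "P $ k $ k \<le> trace P" for k
    unfolding trace_def using psd_diag_nonneg[OF P] by (intro member_le_sum) auto
  have sym: "P $ j $ i = P $ i $ j"
    using psd_transpose[OF P] by (metis transpose_def vec_lambda_beta)
  have "0 \<le> P $ i $ i + P $ j $ j + 2 * P $ i $ j" "0 \<le> P $ i $ i + P $ j $ j - 2 * P $ i $ j"
    using psd_nonneg[OF P, of "axis i 1 + axis j 1"] psd_nonneg[OF P, of "axis i 1 - axis j 1"] sym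
    by (simp_all add: algebra_simps inner_add_left inner_add_right inner_diff_left inner_diff_right
        inner_axis_mult)
  with diag[of i] diag[of j] show ?thesis by linarith
qed

lemma quadratic_form_bound:
  fixes M :: "real^'n^'n"
  shows "\<exists>c>0. \<forall>x. \<bar>x \<bullet> (M *v x)\<bar> \<le> c * (x \<bullet> x)"
proof -
  obtain B where B: "B > 0" "\<And>x. norm (M *v x) \<le> B * norm x"
    using linear_bounded_pos[OF matrix_vector_mul_linear[of M]] by blast
  have "\<bar>x \<bullet> (M *v x)\<bar> \<le> B * (x \<bullet> x)" for x
  proof -
    have "\<bar>x \<bullet> (M *v x)\<bar> \<le> norm x * norm (M *v x)" by (rule Cauchy_Schwarz_ineq2)
    also have "\<dots> \<le> norm x * (B * norm x)" by (intro mult_left_mono B) simp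
    finally show ?thesis by (simp add: power2_norm_eq_inner[symmetric] power2_eq_square mult_ac)
  qed
  with B(1) show ?thesis by blast
qed

text \<open>The form attains a positive minimum on the compact unit sphere; homogeneity does the
  rest.\<close>

lemma quadratic_form_pos_lower_bound:
  fixes M :: "real^'n^'n"
  assumes pos: "\<And>x. x \<noteq> 0 \<Longrightarrow> 0 < x \<bullet> (M *v x)"
  shows "\<exists>c>0. \<forall>x. c * (x \<bullet> x) \<le> x \<bullet> (M *v x)"
proof -
  have cont: "continuous_on (sphere 0 1) (\<lambda>x. x \<bullet> (M *v x))"
    by (intro continuous_intros linear_continuous_on_compose[OF continuous_on_id matrix_vector_mul_linear])
  have "(SOME b::real^'n. b \<in> Basis) \<in> sphere 0 1" by (simp add: SOME_Basis)
  then obtain v where v: "norm v = 1" "\<And>x. norm x = 1 \<Longrightarrow> v \<bullet> (M *v v) \<le> x \<bullet> (M *v x)"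
    using continuous_attains_inf[OF compact_sphere _ cont] by auto
  define c where "c = v \<bullet> (M *v v)"
  have "v \<noteq> 0" using v(1) by auto
  then have "c > 0" using pos[of v] by (simp add: c_def)
  moreover have "c * (x \<bullet> x) \<le> x \<bullet> (M *v x)" for x
  proof (cases "x = 0")
    case False
    define y where "y = (1 / norm x) *\<^sub>R x"
    have "norm y = 1" using False by (simp add: y_def)
    then have "c \<le> y \<bullet> (M *v y)" unfolding c_def by (rule v)
    also have "y \<bullet> (M *v y) = (x \<bullet> (M *v x)) / (x \<bullet> x)"
      by (simp add: y_def algebra_simps power2_norm_eq_inner[symmetric] power2_eq_square)
    finally show ?thesis using False by (simp add: pos_le_divide_eq)
  qed simp
  ultimately show ?thesis by blast
qed

lemma positive_definite_lower_bound:
  assumes "positive_definite M"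
  shows "\<exists>c>0. positive_semidefinite (M - mat c)"
proof -
  obtain c where c: "c > 0" "\<And>x. c * (x \<bullet> x) \<le> x \<bullet> (M *v x)"
    using quadratic_form_pos_lower_bound[of M] assms unfolding positive_definite_def by blast
  then have "positive_semidefinite (M - mat c)"
    using assms by (simp add: positive_semidefinite_def positive_definite_def transpose_diff
        algebra_simps mat_mult_vec inner_diff_right)
  with c(1) show ?thesis by blast
qed

text \<open>Turns a bound on the cost \<open>trace (D ** P)\<close> into one on
  \<open>trace P\<close>, and with it on all entries of \<open>P\<close>.\<close>

lemma trace_mult_psd_lower_bound:
  assumes "positive_semidefinite (M - mat c)" "positive_semidefinite P"
  shows "c * trace P \<le> trace (P ** M)"
  using trace_mult_psd_nonneg[OF assms(2,1)]
  by (simp add: matrix_diff_ldistrib trace_sub matrix_mat_right trace_mat_mult)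

lemma psd_congruence:
  fixes K :: "real^'n^'m"
  assumes "positive_semidefinite R"
  shows "positive_semidefinite (transpose K ** R ** K)"
  using assms unfolding positive_semidefinite_def
  by (auto simp: matrix_transpose_mul matrix_mul_assoc simp flip: matrix_vector_mul_assoc
      simp del: transpose_matrix_vector simp add: inner_transpose_mult)

lemma psd_add: "positive_semidefinite M \<Longrightarrow> positive_semidefinite N \<Longrightarrow> positive_semidefinite (M + N)"
  by (simp add: positive_semidefinite_def transpose_add matrix_vector_mult_add_rdistrib inner_add_right)

section \<open>Lyapunov equations\<close>

lemma matrix_sum_right: "G ** (\<Sum>k\<in>I. f k) = (\<Sum>k\<in>I. G ** (f k :: 'a::comm_ring_1^'p^'n))"
  by (induction I rule: infinite_finite_induct) (simp_all add: matrix_add_ldistrib)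

lemma mat_diff: "mat (a - b) = mat a - (mat b :: 'a::comm_ring_1^'n^'n)"
  by (simp add: mat_def vec_eq_iff)

lemma mat_mult: "mat (a * b) = mat a ** (mat b :: 'a::comm_ring_1^'n^'n)"
  by (simp add: vec_eq_iff mat_mult_nth) (simp add: mat_def)

text \<open>This is p(G) Z. Complex scalars act through \<open>mat c\<close>, because
  \<open>scaleR\<close> on complex matrices admits only real scalars.\<close>

definition matrix_poly_apply :: "complex^'n^'n \<Rightarrow> complex poly \<Rightarrow> complex^'p^'n \<Rightarrow> complex^'p^'n" where
  "matrix_poly_apply G p Z = (\<Sum>k\<le>degree p. mat (coeff p k) ** (((**) G ^^ k) Z))"

lemma matrix_poly_apply_eq_sum:
  "degree p \<le> N \<Longrightarrow> matrix_poly_apply G p Z = (\<Sum>k\<le>N. mat (coeff p k) ** (((**) G ^^ k) Z))"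
  unfolding matrix_poly_apply_def by (rule sum.mono_neutral_left) (auto simp: coeff_eq_0)

lemma matrix_poly_apply_pCons:
  "matrix_poly_apply G (pCons c p) Z = mat c ** Z + G ** matrix_poly_apply G p Z"
proof -
  have "matrix_poly_apply G (pCons c p) Z =
      (\<Sum>k\<le>Suc (degree p). mat (coeff (pCons c p) k) ** (((**) G ^^ k) Z))"
    by (rule matrix_poly_apply_eq_sum) (rule degree_pCons_le)
  also have "\<dots> = mat c ** Z + (\<Sum>k\<le>degree p. G ** (mat (coeff p k) ** (((**) G ^^ k) Z)))"
    by (subst sum.atMost_Suc_shift) (simp add: matrix_mul_assoc matrix_mat_right)
  finally show ?thesis by (simp add: matrix_poly_apply_def matrix_sum_right)
qed

lemma matrix_poly_apply_diff:
  "matrix_poly_apply G (p - q) Z = matrix_poly_apply G p Z - matrix_poly_apply G q Z"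
proof -
  let ?N = "max (degree p) (degree q)"
  show ?thesis
    by (subst (1 2 3) matrix_poly_apply_eq_sum[where N = ?N])
      (auto intro: degree_diff_le simp: sum_subtractf mat_diff matrix_diff_rdistrib)
qed

lemma matrix_poly_apply_smult: "matrix_poly_apply G (smult c p) Z = mat c ** matrix_poly_apply G p Z"
  by (subst (1 2) matrix_poly_apply_eq_sum[where N = "degree p"])
    (auto simp: degree_smult_le mat_mult matrix_sum_right matrix_mul_assoc)

text \<open>One more iterate than the real dimension forces a linear dependence, even with real
  coefficients. Dependence is a property of sets, so coinciding iterates are treated separately:
  their difference is the relation.\<close>

lemma matrix_powers_dependent:
  fixes G :: "complex^'n^'n" and Y :: "complex^'p^'n"
  shows "\<exists>p. p \<noteq> 0 \<and> matrix_poly_apply G p Y = 0"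
proof -
  define f where "f = (\<lambda>k. ((**) G ^^ k) Y)"
  have "\<exists>c N. (\<exists>k\<le>N. c k \<noteq> 0) \<and> (\<Sum>k\<le>N. mat (c k) ** f k) = 0"
  proof (cases "inj_on f {..DIM(complex^'p^'n)}")
    case True
    then have "dependent (f ` {..DIM(complex^'p^'n)})"
      by (intro dependent_biggerset) (simp add: card_image)
    then obtain u where u: "\<exists>v\<in>f ` {..DIM(complex^'p^'n)}. u v \<noteq> 0"
        "(\<Sum>v\<in>f ` {..DIM(complex^'p^'n)}. u v *\<^sub>R v) = 0"
      by (subst (asm) real_vector.dependent_finite) auto
    have "(\<Sum>k\<le>DIM(complex^'p^'n). mat (complex_of_real (u (f k))) ** f k) = 0"
    proof -
      have "mat (complex_of_real r) ** Z = r *\<^sub>R Z" for r and Z :: "complex^'p^'n"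
        by (simp add: vec_eq_iff mat_mult_nth flip: scaleR_conv_of_real)
      then show ?thesis using u(2) True by (simp add: sum.reindex)
    qed
    then show ?thesis using u(1)
      by (intro exI[of _ "\<lambda>k. complex_of_real (u (f k))"] exI[of _ "DIM(complex^'p^'n)"]) auto
  next
    case False
    then obtain a b where ab: "a \<noteq> b" "f a = f b" unfolding inj_on_def by blast
    define c where "c = (\<lambda>k. (if k = a then 1 else 0) - (if k = b then 1 else 0 :: complex))"
    have single: "(\<Sum>k\<le>max a b. mat (if k = l then 1 else 0) ** f k) = f l" if "l \<le> max a b" for l
    proof -
      have "mat (if k = l then 1 else 0) ** f k = (if k = l then f k else 0)" for k by simp
      then show ?thesis using that by simp
    qed
    have "(\<Sum>k\<le>max a b. mat (c k) ** f k) = f a - f b"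
      unfolding c_def mat_diff matrix_diff_rdistrib sum_subtractf by (simp add: single)
    with ab show ?thesis by (intro exI[of _ c] exI[of _ "max a b"]) (auto simp: c_def)
  qed
  then obtain c N j where c: "j \<le> N" "c j \<noteq> 0" "(\<Sum>k\<le>N. mat (c k) ** f k) = 0" by blast
  define p where "p = (\<Sum>k\<le>N. monom (c k) k)"
  have coeff: "coeff p k = (if k \<le> N then c k else 0)" for k
    by (simp add: p_def coeff_sum)
  have "degree p \<le> N" by (rule degree_le) (simp add: coeff)
  then have "matrix_poly_apply G p Y = (\<Sum>k\<le>N. mat (c k) ** f k)"
    by (simp add: matrix_poly_apply_eq_sum coeff f_def)
  moreover have "p \<noteq> 0" using coeff[of j] c by auto
  ultimately show ?thesis using c(3) by auto
qed

text \<open>From an annihilating polynomial of \<open>Y\<close> of least degree a linear factor is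
  split off at a root \<mu>. The cofactor applied to \<open>Y\<close> is nonzero by minimality, is
  an eigenvector for \<mu>, and stays in \<open>V\<close> by the closure properties.\<close>

lemma matrix_invariant_eigenvector:
  fixes G :: "complex^'n^'n" and V :: "(complex^'p^'n) set"
  assumes Y: "Y \<in> V" "Y \<noteq> 0" and mult: "\<And>Z. Z \<in> V \<Longrightarrow> G ** Z \<in> V"
    and add: "\<And>Z W. Z \<in> V \<Longrightarrow> W \<in> V \<Longrightarrow> Z + W \<in> V" and scale: "\<And>c Z. Z \<in> V \<Longrightarrow> mat c ** Z \<in> V"
  shows "\<exists>\<mu> Z. Z \<in> V \<and> Z \<noteq> 0 \<and> G ** Z = mat \<mu> ** Z"
proof -
  define ann where "ann = (\<lambda>p. p \<noteq> 0 \<and> matrix_poly_apply G p Y = 0)"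
  define p where "p = arg_min degree ann"
  obtain p0 where "ann p0" using matrix_powers_dependent[of G Y] by (auto simp: ann_def)
  then have p: "ann p" and min: "\<And>q. ann q \<Longrightarrow> degree p \<le> degree q"
    unfolding p_def using arg_min_nat_lemma[of ann p0 degree] by auto
  have deg: "degree p \<noteq> 0"
  proof
    assume "degree p = 0"
    then obtain c where c: "p = [:c:]" by (rule degree_eq_zeroE)
    then have "mat c ** Y = 0" "c \<noteq> 0"
      using p by (auto simp: ann_def matrix_poly_apply_def)
    with Y(2) show False by (simp add: vec_eq_iff mat_mult_nth)
  qed
  then obtain \<mu> where "poly p \<mu> = 0"
    using fundamental_theorem_of_algebra[of p] by (auto simp: constant_degree)
  then obtain q where q: "p = [:- \<mu>, 1:] * q" by (auto simp: poly_eq_0_iff_dvd)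
  have "q \<noteq> 0" using p q by (auto simp: ann_def)
  have "degree p = degree [:- \<mu>, 1:] + degree q"
    unfolding q using \<open>q \<noteq> 0\<close> by (intro degree_mult_eq) simp_all
  then have "degree q < degree p" by simp
  with min[of q] \<open>q \<noteq> 0\<close> have nz: "matrix_poly_apply G q Y \<noteq> 0" by (auto simp: ann_def)
  have "p = pCons 0 q - smult \<mu> q" by (simp add: q)
  then have "matrix_poly_apply G p Y = G ** matrix_poly_apply G q Y - mat \<mu> ** matrix_poly_apply G q Y"
    by (simp add: matrix_poly_apply_diff matrix_poly_apply_pCons matrix_poly_apply_smult)
  then have "G ** matrix_poly_apply G q Y = mat \<mu> ** matrix_poly_apply G q Y"
    using p by (simp add: ann_def)
  moreover have "matrix_poly_apply G q Y \<in> V"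
  proof (induction q)
    case 0
    show ?case using scale[OF Y(1), of 0] by (simp add: matrix_poly_apply_def)
  next
    case (pCons c q)
    then show ?case unfolding matrix_poly_apply_pCons by (intro add mult scale Y)
  qed
  ultimately show ?thesis using nz by blast
qed

section \<open>The kernel of the Lyapunov operator\<close>

abbreviation complex_matrix :: "real^'n^'m \<Rightarrow> complex^'n^'m" where
  "complex_matrix \<equiv> map_matrix complex_of_real"

lemma complex_matrix_mult: "complex_matrix (X ** Y) = complex_matrix X ** complex_matrix Y"
  by (simp add: vec_eq_iff matrix_matrix_mult_def)

lemma complex_matrix_transpose: "complex_matrix (transpose X) = transpose (complex_matrix X)"
  by (simp add: vec_eq_iff transpose_def)

text \<open>Both sides say that the matrix minus \<mu> is singular, and transposition preserves
  invertibility.\<close>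

lemma complex_eigenvalue_transpose: "complex_eigenvalue (transpose M) \<mu> \<longleftrightarrow> complex_eigenvalue M \<mu>"
proof -
  have mat: "mat \<mu> *v v = \<mu> *s v" for v :: "complex^'n"
    by (simp add: vec_eq_iff matrix_vector_mult_def mat_def if_distrib if_distribR cong: if_cong)
  have *: "complex_eigenvalue N \<mu> \<longleftrightarrow> \<not> invertible (complex_matrix N - mat \<mu>)" for N :: "real^'n^'n"
    unfolding complex_eigenvalue_def invertible_left_inverse matrix_left_invertible_ker
    by (auto simp: matrix_vector_mult_diff_rdistrib mat)
  have "transpose (complex_matrix M - mat \<mu>) = complex_matrix (transpose M) - mat \<mu>"
    by (simp add: transpose_diff complex_matrix_transpose)
  moreover have "invertible (transpose N)" if "invertible N" for N :: "complex^'n^'n"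
    using that unfolding invertible_def by (metis matrix_transpose_mul transpose_mat)
  ultimately show ?thesis unfolding * by (metis transpose_transpose)
qed

lemma stable_transpose: "stable (transpose M) \<longleftrightarrow> stable M"
  by (simp add: stable_def complex_eigenvalue_transpose)

text \<open>The kernel of the Lyapunov operator is invariant under \<open>X \<mapsto> F\<^sup>T X\<close>; an eigenvector \<open>Z\<close> of
  this map makes both \<open>\<mu>\<close> (by columns) and \<open>- \<mu>\<close> (by rows) eigenvalues of \<open>F\<close>.\<close>

lemma lyapunov_kernel_trivial:
  assumes F: "stable F" and X: "transpose F ** X + X ** F = 0"
  shows "X = 0"
proof (rule ccontr)
  assume "X \<noteq> 0"
  define G where "G = complex_matrix (transpose F)"
  define V where "V = {Z. G ** Z + Z ** complex_matrix F = 0}"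
  have "\<exists>\<mu> Z. Z \<in> V \<and> Z \<noteq> 0 \<and> G ** Z = mat \<mu> ** Z"
  proof (rule matrix_invariant_eigenvector)
    have "complex_matrix (transpose F ** X) + complex_matrix (X ** F) =
        complex_matrix (transpose F ** X + X ** F)"
      by (simp add: vec_eq_iff)
    also have "\<dots> = 0" unfolding X by (simp add: vec_eq_iff)
    finally show "complex_matrix X \<in> V" by (simp add: V_def G_def complex_matrix_mult)
    show "complex_matrix X \<noteq> 0" using \<open>X \<noteq> 0\<close> by (simp add: vec_eq_iff)
    show "Z + W \<in> V" if "Z \<in> V" "W \<in> V" for Z W
    proof -
      have "G ** (Z + W) + (Z + W) ** complex_matrix F =
          (G ** Z + Z ** complex_matrix F) + (G ** W + W ** complex_matrix F)"
        by (simp add: matrix_add_ldistrib matrix_add_rdistrib)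
      with that show ?thesis by (simp add: V_def)
    qed
    fix Z assume Z: "Z \<in> V"
    have "G ** (G ** Z) + G ** Z ** complex_matrix F = G ** (G ** Z + Z ** complex_matrix F)"
      by (simp add: matrix_add_ldistrib matrix_mul_assoc)
    with Z show "G ** Z \<in> V" by (simp add: V_def)
    fix c
    have "G ** (mat c ** Z) + mat c ** Z ** complex_matrix F = mat c ** (G ** Z + Z ** complex_matrix F)"
      by (simp add: matrix_add_ldistrib matrix_mul_assoc matrix_mat_right)
    with Z show "mat c ** Z \<in> V" by (simp add: V_def)
  qed
  then obtain \<mu> Z where Z: "Z \<in> V" "Z \<noteq> 0" "G ** Z = mat \<mu> ** Z" by blast
  then obtain i j where ij: "Z $ i $ j \<noteq> 0" by (auto simp: vec_eq_iff)
  have "column j Z \<noteq> 0" "row i Z \<noteq> 0" using ij by (auto simp: vec_eq_iff column_def row_def)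
  have "G *v column j Z = \<mu> *s column j Z"
  proof -
    have "(G *v column j Z) $ k = (G ** Z) $ k $ j" for k
      by (simp add: matrix_vector_mult_def matrix_matrix_mult_def column_def)
    then show ?thesis unfolding Z(3) by (simp add: vec_eq_iff mat_mult_nth column_def)
  qed
  with \<open>column j Z \<noteq> 0\<close> have "complex_eigenvalue (transpose F) \<mu>"
    unfolding complex_eigenvalue_def G_def by blast
  then have "Re \<mu> < 0" using F by (simp add: stable_def complex_eigenvalue_transpose)
  have "G *v row i Z = (- \<mu>) *s row i Z"
  proof -
    have "(G *v row i Z) $ k = (Z ** complex_matrix F) $ i $ k" for k
      by (simp add: matrix_vector_mult_def matrix_matrix_mult_def row_def G_def transpose_def mult.commute)
    moreover have "Z ** complex_matrix F = - (mat \<mu> ** Z)"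
      using Z(1,3) by (simp add: V_def eq_neg_iff_add_eq_0 add.commute)
    ultimately show ?thesis by (simp add: vec_eq_iff mat_mult_nth row_def)
  qed
  with \<open>row i Z \<noteq> 0\<close> have "complex_eigenvalue (transpose F) (- \<mu>)"
    unfolding complex_eigenvalue_def G_def by blast
  then have "Re (- \<mu>) < 0" using F unfolding stable_def complex_eigenvalue_transpose by blast
  with \<open>Re \<mu> < 0\<close> show False by simp
qed

section \<open>The Lyapunov operator and the definiteness of solutions\<close>

definition lyapunov_op :: "real^'n^'n \<Rightarrow> real^'n^'n \<Rightarrow> real^'n^'n" where
  "lyapunov_op F X = transpose F ** X + X ** F"

lemma lyapunov_op_linear: "linear (lyapunov_op F)"
  by (rule linearI) (simp_all add: lyapunov_op_def matrix_add_ldistrib matrix_add_rdistrib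
      scalar_matrix_assoc matrix_scalar_ac scaleR_add_right)

lemma lyapunov_op_shift: "lyapunov_op (F - mat s) X = lyapunov_op F X - (2 * s) *\<^sub>R X"
proof -
  have "mat s ** X = s *\<^sub>R X" by (simp add: vec_eq_iff mat_mult_nth)
  then show ?thesis
    by (simp add: lyapunov_op_def transpose_diff matrix_diff_ldistrib matrix_diff_rdistrib
        matrix_mat_right scaleR_2 flip: scaleR_scaleR)
qed

lemma lyapunov_op_inj: "stable F \<Longrightarrow> inj (lyapunov_op F)"
  unfolding linear_inj_iff_eq_0[OF lyapunov_op_linear] lyapunov_op_def
  using lyapunov_kernel_trivial by blast

lemma lyapunov_op_solvable: "stable F \<Longrightarrow> \<exists>X. lyapunov_op F X = C"
  using linear_injective_imp_surjective[OF lyapunov_op_linear lyapunov_op_inj] by (metis surjD)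

lemma lyapunov_op_transpose: "lyapunov_op F (transpose X) = transpose (lyapunov_op F X)"
  by (simp add: lyapunov_op_def transpose_add matrix_transpose_mul add.commute)

text \<open>The transpose of a solution solves the same equation, and the solution is
  unique.\<close>

lemma lyapunov_solution_symmetric:
  assumes "stable F" "lyapunov_op F X = C" "transpose C = C"
  shows "transpose X = X"
  using assms lyapunov_op_inj[OF assms(1)] by (metis injD lyapunov_op_transpose)

lemma lyapunov_op_quadratic:
  assumes "transpose X = X"
  shows "x \<bullet> (lyapunov_op F X *v x) = 2 * (x \<bullet> (X *v (F *v x)))"
proof -
  have "x \<bullet> (transpose F *v (X *v x)) = x \<bullet> (X *v (F *v x))"
    unfolding inner_transpose_mult using assms by (rule inner_symmetric_mult)
  then show ?thesis
    by (simp add: lyapunov_op_def matrix_vector_mult_add_rdistrib inner_add_right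
        flip: matrix_vector_mul_assoc del: transpose_matrix_vector)
qed

text \<open>The form of \<open>W\<close> is a quadratic Lyapunov function: it decreases strictly
  along the flow of \<open>F\<close>. Strict inequalities make this a form of stability that visibly
  survives small perturbations.\<close>

definition lyapunov_matrix :: "real^'n^'n \<Rightarrow> real^'n^'n \<Rightarrow> bool" where
  "lyapunov_matrix F W \<longleftrightarrow> positive_definite W \<and> (\<forall>x. x \<noteq> 0 \<longrightarrow> x \<bullet> (W *v (F *v x)) < 0)"

text \<open>At a minimizer \<open>v\<close> of the quotient of the quadratic forms of \<open>X\<close> and \<open>W\<close>, with minimum \<open>\<mu>\<close>,
  we have \<open>X v = \<mu> W v\<close>, and the equation for \<open>X\<close> determines the sign of \<open>\<mu>\<close>.\<close>

lemma lyapunov_solution_psd: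
  assumes W: "lyapunov_matrix F W" and sym: "transpose X = X"
    and X: "lyapunov_op F X = - M" and M: "positive_semidefinite M"
  shows "positive_semidefinite X"
proof -
  have Wpos: "0 < x \<bullet> (W *v x)" if "x \<noteq> 0" for x
    using W that by (simp add: lyapunov_matrix_def positive_definite_def)
  have Wsym: "transpose W = W" using W by (simp add: lyapunov_matrix_def positive_definite_def)
  define q where "q = (\<lambda>x. (x \<bullet> (X *v x)) / (x \<bullet> (W *v x)))"
  have "continuous_on (sphere 0 1) q"
  proof -
    have "x \<bullet> (W *v x) \<noteq> 0" if "x \<in> sphere 0 1" for x using Wpos[of x] that by force
    then show ?thesis unfolding q_def
      by (intro continuous_intros linear_continuous_on_compose[OF continuous_on_id
          matrix_vector_mul_linear]) auto
  qed
  moreover have "(SOME b::real^'n. b \<in> Basis) \<in> sphere 0 1" by (simp add: SOME_Basis)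
  ultimately obtain v where v: "norm v = 1" "\<And>x. norm x = 1 \<Longrightarrow> q v \<le> q x"
    using continuous_attains_inf[OF compact_sphere _ ] by (metis empty_iff mem_sphere_0)
  define \<mu> where "\<mu> = q v"
  have "v \<noteq> 0" using v by auto
  define N where "N = X - \<mu> *\<^sub>R W"
  have form: "x \<bullet> (N *v y) = x \<bullet> (X *v y) - \<mu> * (x \<bullet> (W *v y))" for x y
    by (simp add: N_def matrix_vector_mult_diff_rdistrib inner_diff_right
        scaleR_matrix_vector_assoc[symmetric])
  have N: "positive_semidefinite N"
    unfolding positive_semidefinite_def
  proof (intro conjI allI)
    show "transpose N = N" by (simp add: N_def transpose_diff transpose_scalar sym Wsym)
    fix x
    show "0 \<le> x \<bullet> (N *v x)"
    proof (cases "x = 0")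
      case False
      have "\<mu> \<le> q ((1 / norm x) *\<^sub>R x)" unfolding \<mu>_def using False by (intro v) simp
      also have "\<dots> = q x" using False by (simp add: q_def algebra_simps)
      finally show ?thesis using Wpos[OF False] unfolding form q_def by (simp add: pos_le_divide_eq)
    qed simp
  qed
  have "v \<bullet> (N *v v) = 0"
    using Wpos[OF \<open>v \<noteq> 0\<close>] by (simp add: form \<mu>_def q_def)
  then have "N *v v = 0" by (rule psd_kernel[OF N])
  then have "v \<bullet> (N *v (F *v v)) = 0"
    using inner_symmetric_mult[OF psd_transpose[OF N], of v "F *v v"] by simp
  then have "v \<bullet> (X *v (F *v v)) = \<mu> * (v \<bullet> (W *v (F *v v)))" by (simp add: form)
  moreover have "2 * (v \<bullet> (X *v (F *v v))) \<le> 0"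
    using lyapunov_op_quadratic[OF sym, of v F] psd_nonneg[OF M, of v]
        matrix_vector_mult_diff_rdistrib[of 0 M v]
    unfolding X by simp
  moreover have "v \<bullet> (W *v (F *v v)) < 0"
    using W \<open>v \<noteq> 0\<close> by (simp add: lyapunov_matrix_def)
  ultimately have "\<mu> \<ge> 0" by (simp add: mult_le_0_iff)
  show ?thesis
    unfolding positive_semidefinite_def
  proof (intro conjI allI sym)
    fix x
    have "0 \<le> x \<bullet> (W *v x)" using Wpos[of x] by (cases "x = 0") auto
    with \<open>\<mu> \<ge> 0\<close> have "0 \<le> \<mu> * (x \<bullet> (W *v x))" by simp
    with psd_nonneg[OF N, of x] show "0 \<le> x \<bullet> (X *v x)" unfolding form by linarith
  qed
qed

text \<open>The equation makes \<open>x \<bullet> (X *v (F *v x))\<close> strictly negative, whereas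
  a vector with zero form lies in the kernel of \<open>X\<close>, where this quantity
  vanishes.\<close>

lemma lyapunov_solution_pd:
  assumes X: "positive_semidefinite X" "lyapunov_op F X = - M" and M: "positive_definite M"
  shows "lyapunov_matrix F X"
proof -
  have neg: "x \<bullet> (X *v (F *v x)) < 0" if "x \<noteq> 0" for x
    using lyapunov_op_quadratic[OF psd_transpose[OF X(1)], of x F] that M
        matrix_vector_mult_diff_rdistrib[of 0 M x]
    unfolding X(2) positive_definite_def by fastforce
  have "0 < x \<bullet> (X *v x)" if "x \<noteq> 0" for x
  proof -
    have "X *v x \<noteq> 0"
      using neg[OF that] inner_symmetric_mult[OF psd_transpose[OF X(1)], of x "F *v x"] by auto
    then have "x \<bullet> (X *v x) \<noteq> 0" using psd_kernel[OF X(1)] by blast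
    with psd_nonneg[OF X(1)] show ?thesis by (metis less_eq_real_def)
  qed
  with neg psd_transpose[OF X(1)] show ?thesis by (simp add: lyapunov_matrix_def positive_definite_def)
qed

section \<open>Stability\<close>

lemma transpose_minus: "transpose (- A) = - transpose (A :: 'a::group_add^'n^'m)"
  by (simp add: transpose_def vec_eq_iff)

text \<open>Let \<open>a\<close> and \<open>b\<close> be the real and imaginary part of an
  eigenvector. In the sum of \<open>x \<bullet> (W *v (F *v x))\<close> over \<open>x = a\<close>
  and \<open>x = b\<close> the contributions of \<open>Im \<mu>\<close> cancel by symmetry of
  \<open>W\<close>, leaving \<open>Re \<mu>\<close> times a positive number.\<close>

lemma lyapunov_matrix_imp_stable:
  fixes F :: "real^'n^'n"
  assumes W: "lyapunov_matrix F W"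
  shows "stable F"
  unfolding stable_def complex_eigenvalue_def
proof (intro allI impI, elim exE conjE)
  fix \<mu> and v :: "complex^'n"
  assume v: "v \<noteq> 0" "complex_matrix F *v v = \<mu> *s v"
  define a b where "a = (\<chi> i. Re (v $ i))" and "b = (\<chi> i. Im (v $ i))"
  have "(F *v a) $ i = Re ((complex_matrix F *v v) $ i)"
      "(F *v b) $ i = Im ((complex_matrix F *v v) $ i)" for i
    by (simp_all add: matrix_vector_mult_def a_def b_def)
  then have Fa: "F *v a = Re \<mu> *\<^sub>R a - Im \<mu> *\<^sub>R b" and Fb: "F *v b = Re \<mu> *\<^sub>R b + Im \<mu> *\<^sub>R a"
    unfolding v(2) by (simp_all add: vec_eq_iff a_def b_def)
  have sym: "transpose W = W" and pos: "\<And>x. x \<noteq> 0 \<Longrightarrow> 0 < x \<bullet> (W *v x)"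
    and neg: "\<And>x. x \<noteq> 0 \<Longrightarrow> x \<bullet> (W *v (F *v x)) < 0"
    using W by (auto simp: lyapunov_matrix_def positive_definite_def)
  have "a \<noteq> 0 \<or> b \<noteq> 0" using v(1) by (auto simp: a_def b_def vec_eq_iff complex_eq_iff)
  then have "a \<bullet> (W *v a) + b \<bullet> (W *v b) > 0" "a \<bullet> (W *v (F *v a)) + b \<bullet> (W *v (F *v b)) < 0"
    using pos[of a] pos[of b] neg[of a] neg[of b] by (cases "a = 0"; cases "b = 0"; force)+
  moreover have "a \<bullet> (W *v (F *v a)) + b \<bullet> (W *v (F *v b)) = Re \<mu> * (a \<bullet> (W *v a) + b \<bullet> (W *v b))"
    unfolding Fa Fb using inner_symmetric_mult[OF sym, of a b]
    by (simp add: algebra_simps inner_add_right inner_diff_right)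
  ultimately show "Re \<mu> < 0" by (simp add: mult_less_0_iff)
qed

lemma stable_shift:
  fixes F :: "real^'n^'n"
  assumes F: "stable F" and s: "0 \<le> s"
  shows "stable (F - mat s)"
  unfolding stable_def complex_eigenvalue_def
proof (intro allI impI, elim exE conjE)
  fix \<mu> and v :: "complex^'n"
  assume v: "v \<noteq> 0" "complex_matrix (F - mat s) *v v = \<mu> *s v"
  have "complex_matrix (F - mat s) *v v = complex_matrix F *v v - of_real s *s v"
  proof -
    have "complex_matrix (F - mat s) = complex_matrix F - mat (of_real s)"
      by (simp add: vec_eq_iff mat_def)
    moreover have "mat c *v v = c *s v" for c
      by (simp add: vec_eq_iff matrix_vector_mult_def mat_def if_distrib if_distribR cong: if_cong)
    ultimately show ?thesis by (simp add: matrix_vector_mult_diff_rdistrib)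
  qed
  with v(2) have "complex_matrix F *v v = (\<mu> + of_real s) *s v"
    by (simp add: vec_eq_iff algebra_simps)
  with v(1) F have "Re (\<mu> + of_real s) < 0" unfolding stable_def complex_eigenvalue_def by blast
  with s show "Re \<mu> < 0" by simp
qed

lemma lyapunov_matrix_decay_rate:
  assumes W: "lyapunov_matrix F W"
  shows "\<exists>c>0. \<forall>x. c * (x \<bullet> x) \<le> - (x \<bullet> (W *v (F *v x)))"
proof -
  have form: "x \<bullet> (- (W ** F) *v x) = - (x \<bullet> (W *v (F *v x)))" for x
    using matrix_vector_mult_diff_rdistrib[of 0 "W ** F" x] by (simp add: matrix_vector_mul_assoc)
  show ?thesis
    using quadratic_form_pos_lower_bound[of "- (W ** F)"] W unfolding form lyapunov_matrix_def by fastforce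
qed

text \<open>The same \<open>W\<close> serves: compactness gives the margin
  \<open>c * (x \<bullet> x)\<close>, and the perturbation costs at most
  \<open>\<bar>t\<bar> * b * (x \<bullet> x)\<close>.\<close>

lemma lyapunov_matrix_perturb:
  assumes W: "lyapunov_matrix F W"
  shows "\<exists>\<delta>>0. \<forall>t. \<bar>t\<bar> < \<delta> \<longrightarrow> lyapunov_matrix (F + t *\<^sub>R E) W"
proof -
  obtain c where c: "c > 0" "\<And>x. c * (x \<bullet> x) \<le> - (x \<bullet> (W *v (F *v x)))"
    using lyapunov_matrix_decay_rate[OF W] by blast
  obtain b where b: "b > 0" "\<And>x. \<bar>x \<bullet> ((W ** E) *v x)\<bar> \<le> b * (x \<bullet> x)"
    using quadratic_form_bound[of "W ** E"] by blast
  have "x \<bullet> (W *v ((F + t *\<^sub>R E) *v x)) < 0" if t: "\<bar>t\<bar> < c / b" and x: "x \<noteq> 0" for t x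
  proof -
    have "t * (x \<bullet> ((W ** E) *v x)) \<le> \<bar>t\<bar> * \<bar>x \<bullet> ((W ** E) *v x)\<bar>"
      by (metis abs_ge_self abs_mult)
    also have "\<dots> \<le> \<bar>t\<bar> * (b * (x \<bullet> x))" using b(2) by (intro mult_left_mono) auto
    also have "\<dots> < c * (x \<bullet> x)" using t b(1) x by (simp add: pos_less_divide_eq)
    finally show ?thesis using c(2)[of x]
      by (simp add: algebra_simps inner_add_right matrix_vector_mul_assoc flip: scaleR_matrix_vector_assoc)
  qed
  then show ?thesis using W b(1) c(1)
    by (intro exI[of _ "c / b"]) (auto simp: lyapunov_matrix_def)
qed

lemma closed_psd_forms: "closed {X :: real^'n^'n. \<forall>x. 0 \<le> x \<bullet> (X *v x)}"
proof -
  have "linear (\<lambda>X :: real^'n^'n. x \<bullet> (X *v x))" for x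
    by (rule linearI) (simp_all add: matrix_vector_mult_add_rdistrib inner_add_right flip:
        scaleR_matrix_vector_assoc)
  then have "closed {X :: real^'n^'n. 0 \<le> x \<bullet> (X *v x)}" for x
    by (intro closed_Collect_le continuous_on_const linear_continuous_on) (simp add:
        linear_conv_bounded_linear)
  then show ?thesis by (intro closed_Collect_all)
qed

text \<open>The least \<open>s \<ge> 0\<close> such that \<open>F - s I\<close> has a Lyapunov matrix is \<open>0\<close>, since the solutions of
  the Lyapunov equations depend continuously on \<open>s\<close>.\<close>

lemma stable_imp_lyapunov_matrix:
  fixes F :: "real^'n^'n"
  assumes F: "stable F"
  shows "\<exists>W. lyapunov_matrix F W"
proof -
  define S where "S = {s. 0 \<le> s \<and> (\<exists>W. lyapunov_matrix (F - mat s) W)}"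
  have pd1: "positive_definite (mat 1 :: real^'n^'n)" by (simp add: positive_definite_def)
  obtain B where B: "B > 0" "\<And>x. \<bar>x \<bullet> (F *v x)\<bar> \<le> B * (x \<bullet> x)"
    using quadratic_form_bound[of F] by blast
  have "x \<bullet> ((F - mat (B + 1)) *v x) < 0" if "x \<noteq> 0" for x
  proof -
    have "x \<bullet> ((F - mat (B + 1)) *v x) = x \<bullet> (F *v x) - (B + 1) * (x \<bullet> x)"
      by (simp add: matrix_vector_mult_diff_rdistrib inner_diff_right mat_mult_vec)
    moreover have "0 < x \<bullet> x" using that by simp
    moreover have "x \<bullet> (F *v x) \<le> B * (x \<bullet> x)" using B(2)[of x] by (rule abs_le_D1)
    ultimately show ?thesis unfolding distrib_right by linarith
  qed
  \<comment> \<open>A shift beyond the bound \<open>B\<close> on the form of \<open>F\<close> makes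
    the identity a Lyapunov matrix, so \<open>S\<close> is nonempty.\<close>
  then have "lyapunov_matrix (F - mat (B + 1)) (mat 1)"
    using pd1 by (simp add: lyapunov_matrix_def)
  then have "B + 1 \<in> S" using B(1) by (auto simp: S_def)
  define s0 where "s0 = Inf S"
  have bdd: "bdd_below S" by (intro bdd_belowI[of _ 0]) (auto simp: S_def)
  have s0: "s0 \<ge> 0" unfolding s0_def using \<open>B + 1 \<in> S\<close> by (intro cInf_greatest) (auto simp: S_def)
  have st: "stable (F - mat s)" if "s \<ge> 0" for s using stable_shift[OF F that] .
  obtain X0 where X0: "lyapunov_op (F - mat s0) X0 = - mat 1"
    using lyapunov_op_solvable[OF st[OF s0]] by blast
  obtain c where c: "c > 0" "\<And>X. c * norm X \<le> norm (lyapunov_op (F - mat s0) X)"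
    using linear_inj_bounded_below_pos[OF lyapunov_op_linear lyapunov_op_inj[OF st[OF s0]]] by blast
  have "X0 \<in> closure {X. \<forall>x. 0 \<le> x \<bullet> (X *v x)}"
    unfolding closure_approachable
  proof (intro allI impI)
    fix e :: real assume e: "e > 0"
    \<comment> \<open>The first term lets \<open>c / 2 * norm (X - X0)\<close> be absorbed on the
      left; the second pushes what remains below \<open>e * c\<close>.\<close>
    define \<eta> where "\<eta> = min (c / 4) (e * c / (4 * (norm X0 + 1)))"
    have "\<eta> > 0" using c e by (simp add: \<eta>_def add_nonneg_pos)
    then obtain s where s: "s \<in> S" "s < s0 + \<eta>"
      using cInf_lessD[of S "s0 + \<eta>"] \<open>B + 1 \<in> S\<close> by (auto simp: s0_def)
    have "s \<ge> s0" unfolding s0_def using s(1) bdd by (rule cInf_lower)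
    obtain W where W: "lyapunov_matrix (F - mat s) W" and "s \<ge> 0" using s(1) by (auto simp: S_def)
    obtain X where X: "lyapunov_op (F - mat s) X = - mat 1"
      using lyapunov_op_solvable[OF st[OF \<open>s \<ge> 0\<close>]] by blast
    have sym: "transpose X = X"
      by (rule lyapunov_solution_symmetric[OF st[OF \<open>s \<ge> 0\<close>] X])
        (simp add: transpose_minus)
    have psd: "positive_semidefinite X"
      by (rule lyapunov_solution_psd[OF W sym X psd_mat]) simp
    have "lyapunov_op (F - mat s0) (X - X0) = (2 * (s - s0)) *\<^sub>R X"
    proof -
      have eqs: "lyapunov_op F X = (2 * s) *\<^sub>R X - mat 1" "lyapunov_op F X0 = (2 * s0) *\<^sub>R X0 - mat 1"
        using X X0 unfolding lyapunov_op_shift by (simp_all add: algebra_simps)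
      show ?thesis
        unfolding lyapunov_op_shift linear_diff[OF lyapunov_op_linear] eqs
        by (simp add: algebra_simps)
    qed
    then have "c * norm (X - X0) \<le> 2 * (s - s0) * norm X"
      using c(2)[of "X - X0"] \<open>s \<ge> s0\<close> by simp
    also have "\<dots> \<le> 2 * \<eta> * (norm (X - X0) + norm X0)"
      using s(2) \<open>s \<ge> s0\<close> \<open>\<eta> > 0\<close> norm_triangle_sub[of X X0] by (intro mult_mono) auto
    also have "\<dots> = 2 * \<eta> * norm (X - X0) + 2 * \<eta> * norm X0" by (simp add: algebra_simps)
    also have "\<dots> \<le> c / 2 * norm (X - X0) + 2 * \<eta> * norm X0"
      by (intro add_right_mono mult_right_mono) (auto simp: \<eta>_def)
    finally have "c * norm (X - X0) \<le> 4 * \<eta> * norm X0" by simp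
    also have "\<dots> < 4 * \<eta> * (norm X0 + 1)" using \<open>\<eta> > 0\<close> by simp
    also have "\<dots> \<le> e * c"
    proof -
      have "\<eta> \<le> e * c / (4 * (norm X0 + 1))" by (simp add: \<eta>_def)
      moreover have "4 * (norm X0 + 1) > 0" by (simp add: add_nonneg_pos)
      ultimately show ?thesis by (simp add: pos_le_divide_eq mult_ac)
    qed
    finally have "dist X X0 < e" using c(1) by (simp add: dist_norm mult.commute)
    with psd show "\<exists>Y\<in>{X. \<forall>x. 0 \<le> x \<bullet> (X *v x)}. dist Y X0 < e"
      unfolding positive_semidefinite_def by blast
  qed
  then have "\<forall>x. 0 \<le> x \<bullet> (X0 *v x)" using closure_closed[OF closed_psd_forms] by auto
  moreover have "transpose X0 = X0"
    by (rule lyapunov_solution_symmetric[OF st[OF s0] X0])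
      (simp add: transpose_minus)
  ultimately have "lyapunov_matrix (F - mat s0) X0"
    using lyapunov_solution_pd[OF _ X0 pd1] by (simp add: positive_semidefinite_def)
  \<comment> \<open>The infimum is attained, with Lyapunov matrix \<open>X0\<close>; its strict
    inequalities would permit a smaller shift if \<open>s0\<close> were positive.\<close>
  moreover have "s0 = 0"
  proof (rule ccontr)
    assume "s0 \<noteq> 0"
    obtain \<delta> where \<delta>: "\<delta> > 0" "\<And>t. \<bar>t\<bar> < \<delta> \<Longrightarrow> lyapunov_matrix (F - mat s0 + t *\<^sub>R mat 1) X0"
      using lyapunov_matrix_perturb[OF calculation] by blast
    define t where "t = min s0 (\<delta> / 2)"
    have t: "0 < t" "t \<le> s0" "\<bar>t\<bar> < \<delta>" using \<delta>(1) s0 \<open>s0 \<noteq> 0\<close> by (auto simp: t_def min_def)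
    have "F - mat s0 + t *\<^sub>R mat 1 = F - mat (s0 - t)" by (simp add: vec_eq_iff mat_def)
    with \<delta>(2)[OF t(3)] have "lyapunov_matrix (F - mat (s0 - t)) X0" by metis
    then have "s0 - t \<in> S" using t by (auto simp: S_def)
    then have "s0 \<le> s0 - t" unfolding s0_def using bdd by (intro cInf_lower)
    with t(1) show False by simp
  qed
  ultimately show ?thesis by auto
qed

lemma stable_iff_lyapunov_matrix: "stable F \<longleftrightarrow> (\<exists>W. lyapunov_matrix F W)"
  using stable_imp_lyapunov_matrix lyapunov_matrix_imp_stable by blast

lemma stable_perturb: "stable F \<Longrightarrow> \<exists>\<delta>>0. \<forall>t. \<bar>t\<bar> < \<delta> \<longrightarrow> stable (F + t *\<^sub>R E)"
  unfolding stable_iff_lyapunov_matrix using lyapunov_matrix_perturb by blast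

lemma lyapunov_solution_exists:
  assumes F: "stable F" and M: "positive_semidefinite M"
  shows "\<exists>X. positive_semidefinite X \<and> lyapunov_op F X = - M"
proof -
  obtain X where X: "lyapunov_op F X = - M" using lyapunov_op_solvable[OF F] by blast
  have "transpose X = X"
    by (rule lyapunov_solution_symmetric[OF F X]) (simp add: transpose_minus psd_transpose[OF M])
  moreover obtain W where "lyapunov_matrix F W" using stable_imp_lyapunov_matrix[OF F] by blast
  ultimately show ?thesis using lyapunov_solution_psd[OF _ _ X M] X by blast
qed

section \<open>The cost as a trace\<close>

text \<open>The components of the matrix exponential applied to \<xi> are written as power series;
  the bound \<open>B ^ n\<close> on the iterates makes them converge everywhere, and termwise
  differentiation gives the equation.\<close>

lemma linear_ode_solution_exists:
  fixes F :: "real^'n^'n"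
  shows "\<exists>x. x 0 = \<xi> \<and> (\<forall>t. (x has_vector_derivative F *v x t) (at t))"
proof -
  define v where "v = (\<lambda>n. ((*v) F ^^ n) \<xi>)"
  define c where "c = (\<lambda>i n. v n $ i / fact n)"
  define x where "x = (\<lambda>t. \<chi> i. \<Sum>n. c i n * t ^ n)"
  have v_Suc: "v (Suc n) = F *v v n" for n by (simp add: v_def)
  obtain B where B: "B > 0" "\<And>y. norm (F *v y) \<le> B * norm y"
    using linear_bounded_pos[OF matrix_vector_mul_linear[of F]] by blast
  have v_bound: "norm (v n) \<le> B ^ n * norm \<xi>" for n
  proof (induction n)
    case (Suc n)
    have "norm (v (Suc n)) \<le> B * norm (v n)" unfolding v_Suc by (rule B)
    also have "\<dots> \<le> B * (B ^ n * norm \<xi>)" using Suc B(1) by (intro mult_left_mono) auto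
    finally show ?case by (simp add: mult_ac)
  qed (simp add: v_def)
  have summable: "summable (\<lambda>n. c i n * t ^ n)" for i and t :: real
  proof (rule summable_comparison_test')
    show "summable (\<lambda>n. norm \<xi> * ((B * \<bar>t\<bar>) ^ n /\<^sub>R fact n))"
      by (intro summable_mult summable_exp_generic)
    fix n :: nat
    have "\<bar>v n $ i\<bar> \<le> B ^ n * norm \<xi>" using v_bound[of n] component_le_norm_cart[of "v n" i] by linarith
    then have "\<bar>v n $ i\<bar> * \<bar>t\<bar> ^ n / fact n \<le> (B ^ n * norm \<xi>) * \<bar>t\<bar> ^ n / fact n"
      by (intro divide_right_mono mult_right_mono) auto
    then show "norm (c i n * t ^ n) \<le> norm \<xi> * ((B * \<bar>t\<bar>) ^ n /\<^sub>R fact n)"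
      by (simp add: c_def abs_mult power_abs power_mult_distrib divide_inverse mult_ac)
  qed
  have diffs: "diffs (c i) n = (\<Sum>j\<in>UNIV. F $ i $ j * c j n)" for i n
  proof -
    have "diffs (c i) n = v (Suc n) $ i / fact n"
      by (simp add: diffs_def c_def del: of_nat_Suc)
    then show ?thesis by (simp add: v_Suc matrix_vector_mult_def c_def sum_divide_distrib)
  qed
  have deriv: "((\<lambda>t. x t $ i) has_real_derivative (F *v x t) $ i) (at t)" for i t
  proof -
    have "(\<Sum>n. diffs (c i) n * t ^ n) = (\<Sum>n. \<Sum>j\<in>UNIV. F $ i $ j * (c j n * t ^ n))"
      by (simp add: diffs sum_distrib_right mult.assoc)
    also have "\<dots> = (\<Sum>j\<in>UNIV. \<Sum>n. F $ i $ j * (c j n * t ^ n))"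
      by (intro suminf_sum summable_mult summable)
    also have "\<dots> = (F *v x t) $ i"
      by (simp add: matrix_vector_mult_def x_def suminf_mult[OF summable])
    finally show ?thesis
      using termdiffs_strong_converges_everywhere[of "c i" t, OF summable] by (simp add: x_def)
  qed
  have "(x has_vector_derivative F *v x t) (at t)" for t
    unfolding has_vector_derivative_def
    by (subst has_derivative_componentwise_within)
      (use deriv in \<open>auto simp: Basis_vec_def inner_axis has_field_derivative_def mult_commute_abs\<close>)
  moreover have "x 0 = \<xi>"
  proof -
    have "x 0 $ i = \<xi> $ i" for i
      using powser_zero[of "c i"] by (simp add: x_def c_def v_def)
    then show ?thesis by (simp add: vec_eq_iff)
  qed
  ultimately show ?thesis by blast
qed

lemma closed_loop_mult_vec:
  "(A - mat \<alpha>) *v x + B *v (K *v x) = closed_loop A B \<alpha> K *v x"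
  by (simp add: closed_loop_def matrix_vector_mult_add_rdistrib matrix_vector_mul_assoc)

lemma trajectory_is_trajectory: "is_trajectory A B \<alpha> K \<xi> (trajectory A B \<alpha> K \<xi>)"
proof -
  obtain x where "x 0 = \<xi>" "\<And>t. (x has_vector_derivative closed_loop A B \<alpha> K *v x t) (at t)"
    using linear_ode_solution_exists by blast
  then have "is_trajectory A B \<alpha> K \<xi> x"
    unfolding is_trajectory_def closed_loop_mult_vec by (auto intro: has_vector_derivative_at_within)
  then show ?thesis unfolding trajectory_def by (rule someI[where P = "is_trajectory A B \<alpha> K \<xi>"])
qed

context
  fixes F :: "real^'n^'n" and y :: "real \<Rightarrow> real^'n"
  assumes y: "\<And>t. t \<ge> 0 \<Longrightarrow> (y has_vector_derivative F *v y t) (at t within {0..})"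
begin

lemma solution_continuous: "continuous_on {0..} y"
  using y has_vector_derivative_continuous continuous_on_eq_continuous_within
  by (metis atLeast_iff)

lemma quadratic_form_continuous: "continuous_on {0..} (\<lambda>t. y t \<bullet> (X *v y t))"
  by (intro continuous_intros solution_continuous
      linear_continuous_on_compose[OF solution_continuous matrix_vector_mul_linear])

lemma quadratic_form_derivative:
  assumes X: "transpose X = X" and t: "t > 0"
  shows "((\<lambda>t. y t \<bullet> (X *v y t)) has_real_derivative y t \<bullet> (lyapunov_op F X *v y t)) (at t)"
proof -
  have "at t within {0..} = at t" using t by (intro at_within_interior) simp
  with y[of t] t have dy: "(y has_derivative (\<lambda>h. h *\<^sub>R (F *v y t))) (at t)"
    by (simp add: has_vector_derivative_def)
  have dXy: "((\<lambda>t. X *v y t) has_derivative (\<lambda>h. X *v (h *\<^sub>R (F *v y t)))) (at t)"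
    using bounded_linear.has_derivative[OF matrix_vector_mul_bounded_linear dy] .
  have "((\<lambda>t. y t \<bullet> (X *v y t)) has_derivative
      (\<lambda>h. y t \<bullet> (X *v (h *\<^sub>R (F *v y t))) + (h *\<^sub>R (F *v y t)) \<bullet> (X *v y t))) (at t)"
    by (rule has_derivative_inner[OF dy dXy])
  moreover have "y t \<bullet> (X *v (h *\<^sub>R (F *v y t))) + (h *\<^sub>R (F *v y t)) \<bullet> (X *v y t) =
      y t \<bullet> (lyapunov_op F X *v y t) * h" for h
    using inner_symmetric_mult[OF X, of "F *v y t" "y t"]
    by (simp add: lyapunov_op_quadratic[OF X] matrix_vector_mult_scaleR)
  ultimately show ?thesis by (simp add: has_field_derivative_def)
qed

lemma quadratic_form_tendsto_0:
  assumes F: "stable F"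
  shows "((\<lambda>t. y t \<bullet> (X *v y t)) \<longlongrightarrow> 0) at_top"
proof -
  obtain W where W: "lyapunov_matrix F W" using stable_imp_lyapunov_matrix[OF F] by blast
  then have Wsym: "transpose W = W" and Wpos: "\<And>x. x \<noteq> 0 \<Longrightarrow> 0 < x \<bullet> (W *v x)"
    by (auto simp: lyapunov_matrix_def positive_definite_def)
  obtain c where c: "c > 0" "\<And>x. c * (x \<bullet> x) \<le> - (x \<bullet> (W *v (F *v x)))"
    using lyapunov_matrix_decay_rate[OF W] by blast
  obtain b where b: "b > 0" "\<And>x. \<bar>x \<bullet> (W *v x)\<bar> \<le> b * (x \<bullet> x)"
    using quadratic_form_bound[of W] by blast
  obtain w where w: "w > 0" "\<And>x. w * (x \<bullet> x) \<le> x \<bullet> (W *v x)"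
    using quadratic_form_pos_lower_bound[of W] Wpos by blast
  obtain d where d: "d > 0" "\<And>x. \<bar>x \<bullet> (X *v x)\<bar> \<le> d * (x \<bullet> x)"
    using quadratic_form_bound[of X] by blast
  \<comment> \<open>\<open>V\<close> decreases at rate at least
    \<open>2 * c * (y \<bullet> y)\<close> and is at most \<open>b * (y \<bullet> y)\<close>, so
    this is a guaranteed exponential rate.\<close>
  define r where "r = 2 * c / b"
  define V where "V = (\<lambda>t. y t \<bullet> (W *v y t))"
  have r: "r > 0" using b c by (simp add: r_def)
  have decay: "exp (r * t) * V t \<le> V 0" if "t \<ge> 0" for t
  proof -
    have "exp (r * t) * V t \<le> exp (r * 0) * V 0"
    proof (rule DERIV_nonpos_imp_decreasing_open[OF that])
      have "continuous_on {0..} V" unfolding V_def by (rule quadratic_form_continuous)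
      then show "continuous_on {0..t} (\<lambda>t. exp (r * t) * V t)"
        by (intro continuous_intros) (auto intro: continuous_on_subset)
      fix s assume s: "0 < s" "s < t"
      have dV: "(V has_real_derivative 2 * (y s \<bullet> (W *v (F *v y s)))) (at s)"
        unfolding V_def using quadratic_form_derivative[OF Wsym s(1)] lyapunov_op_quadratic[OF Wsym, of
            "y s" F] by simp
      have "((\<lambda>t. exp (r * t) * V t) has_real_derivative
          exp (r * s) * (r * V s + 2 * (y s \<bullet> (W *v (F *v y s))))) (at s)"
        by (rule derivative_eq_intros dV refl | simp)+ (simp add: algebra_simps)
      moreover have "r * V s + 2 * (y s \<bullet> (W *v (F *v y s))) \<le> 0"
      proof -
        have "r * V s \<le> r * (b * (y s \<bullet> y s))"
          using b(2)[of "y s"] r by (intro mult_left_mono) (auto simp: V_def)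
        also have "\<dots> = 2 * (c * (y s \<bullet> y s))" using b by (simp add: r_def)
        finally show ?thesis using c(2)[of "y s"] by linarith
      qed
      ultimately show "\<exists>z. ((\<lambda>t. exp (r * t) * V t) has_real_derivative z) (at s) \<and> z \<le> 0"
        by (meson exp_ge_zero mult_nonneg_nonpos)
    qed
    then show ?thesis by simp
  qed
  have bound: "\<bar>y t \<bullet> (X *v y t)\<bar> \<le> d / w * V 0 * exp (- r * t)" if "t \<ge> 0" for t
  proof -
    have "V t \<le> V 0 * exp (- r * t)"
      using decay[OF that] by (simp add: exp_minus field_simps)
    with w(2)[of "y t"] have "w * (y t \<bullet> y t) \<le> V 0 * exp (- r * t)" by (simp add: V_def)
    then have "y t \<bullet> y t \<le> V 0 * exp (- r * t) / w" using w(1) by (simp add: pos_le_divide_eq mult.commute)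
    then have "d * (y t \<bullet> y t) \<le> d * (V 0 * exp (- r * t) / w)" using d(1) by (intro mult_left_mono) auto
    with d(2)[of "y t"] show ?thesis by (simp add: mult_ac)
  qed
  have "filterlim (\<lambda>t. - r * t) at_bot at_top"
    by (rule filterlim_tendsto_neg_mult_at_bot[OF tendsto_const _ filterlim_ident]) (use r in simp)
  then have "((\<lambda>t. exp (- r * t)) \<longlongrightarrow> 0) at_top"
    by (rule filterlim_compose[OF exp_at_bot])
  then have "((\<lambda>t. d / w * V 0 * exp (- r * t)) \<longlongrightarrow> 0) at_top"
    by (rule tendsto_mult_right_zero)
  then show ?thesis
    by (rule Lim_null_comparison[rotated]) (use bound in \<open>auto simp: eventually_at_top_linorder intro!:
        exI[of _ 0]\<close>)
qed

text \<open>By the equation for \<open>P\<close>, the negated form of \<open>P\<close> along the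
  solution is an antiderivative of the integrand, and it tends to 0 at infinity. Nonnegativity of
  the integrand yields integrability together with the value.\<close>

lemma quadratic_cost_integral:
  assumes F: "stable F" and P: "transpose P = P" "lyapunov_op F P = - N" and N: "positive_semidefinite N"
  shows "(LINT t:{0..}|lborel. y t \<bullet> (N *v y t)) = y 0 \<bullet> (P *v y 0)"
proof -
  define f where "f = (\<lambda>t. y t \<bullet> (N *v y t))"
  define g where "g = (\<lambda>t. - (y t \<bullet> (P *v y t)))"
  have minus: "x \<bullet> (- N *v x) = - (x \<bullet> (N *v x))" for x
    using matrix_vector_mult_diff_rdistrib[of 0 N x] by simp
  have deriv: "(g has_real_derivative f t) (at t)" if "t > 0" for t
    using quadratic_form_derivative[OF P(1) that, unfolded P(2) minus]
    unfolding g_def f_def by (auto intro: derivative_eq_intros)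
  have f_cont: "isCont f t" if "t > 0" for t
    using quadratic_form_derivative[OF psd_transpose[OF N] that] unfolding f_def by (rule DERIV_isCont)
  have lim0: "(g \<longlongrightarrow> g 0) (at_right 0)"
  proof -
    have "continuous_on {0..} g"
      unfolding g_def by (intro continuous_on_minus quadratic_form_continuous)
    then have "(g \<longlongrightarrow> g 0) (at 0 within {0..})" by (simp add: continuous_on_def)
    then show ?thesis by (rule tendsto_within_subset) auto
  qed
  have liminf: "(g \<longlongrightarrow> 0) at_top"
    using tendsto_minus[OF quadratic_form_tendsto_0[OF F]] unfolding g_def by simp
  have f_nonneg: "0 \<le> f t" for t unfolding f_def by (rule psd_nonneg[OF N])
  \<comment> \<open>At 0 the solution has only a one-sided derivative, hence the open half-line; the
    closed one differs from it by a null set.\<close>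
  note FTC = interval_integral_FTC_nonneg[where a = "ereal 0" and b = \<infinity> and F = g and f = f
      and A = "g 0" and B = 0]
  have int: "set_integrable lborel (einterval (ereal 0) \<infinity>) f"
    by (rule FTC(1)) (auto simp: deriv f_cont f_nonneg ereal_tendsto_simps lim0 liminf)
  have val: "(LBINT x=ereal 0..\<infinity>. f x) = 0 - g 0"
    by (rule FTC(2)) (auto simp: deriv f_cont f_nonneg ereal_tendsto_simps lim0 liminf)
  have "einterval (ereal 0) \<infinity> = {0<..}" by (auto simp: einterval_def)
  with int have meas: "(\<lambda>x. indicator {0<..} x *\<^sub>R f x) \<in> borel_measurable lborel"
    by (simp add: set_integrable_def borel_measurable_integrable)
  have split: "indicator {0..} x *\<^sub>R f x = indicator {0<..} x *\<^sub>R f x + indicator {0} x *\<^sub>R f 0" for x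
      :: real
    by (auto simp: indicator_def)
  have "(LINT t:{0..}|lborel. f t) = (LINT t:{0<..}|lborel. f t)"
    unfolding set_lebesgue_integral_def
  proof (rule integral_cong_AE)
    show "(\<lambda>x. indicator {0<..} x *\<^sub>R f x) \<in> borel_measurable lborel" by (rule meas)
    show "(\<lambda>x. indicator {0..} x *\<^sub>R f x) \<in> borel_measurable lborel"
      unfolding split by (intro borel_measurable_add meas) simp
    have "AE x in lborel. x \<noteq> (0::real)" by (rule AE_lborel_singleton)
    then show "AE x in lborel. indicator {0..} x *\<^sub>R f x = indicator {0<..} x *\<^sub>R f x"
      by eventually_elim (auto simp: indicator_def)
  qed
  also have "\<dots> = - g 0" using val by (simp add: interval_integral_to_infinity_eq)
  finally show ?thesis by (simp add: f_def g_def)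
qed

end

lemma expectation_quadratic_form:
  assumes "random_initial_state M x0 D"
  shows "(\<integral>\<omega>. x0 \<omega> \<bullet> (P *v x0 \<omega>) \<partial>M) = trace (D ** transpose P)"
proof -
  have int: "integrable M (\<lambda>\<omega>. x0 \<omega> $ i * x0 \<omega> $ j)"
      and val: "(\<integral>\<omega>. x0 \<omega> $ i * x0 \<omega> $ j \<partial>M) = D $ i $ j" for i j
    using assms by (auto simp: random_initial_state_def)
  have "x0 \<omega> \<bullet> (P *v x0 \<omega>) = (\<Sum>i\<in>UNIV. \<Sum>j\<in>UNIV. P $ i $ j * (x0 \<omega> $ i * x0 \<omega> $ j))" for \<omega>
    by (simp add: inner_vec_def matrix_vector_mult_def sum_distrib_left mult_ac)
  then have "(\<integral>\<omega>. x0 \<omega> \<bullet> (P *v x0 \<omega>) \<partial>M) = (\<Sum>i\<in>UNIV. \<Sum>j\<in>UNIV. P $ i $ j * D $ i $ j)"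
    by (simp add: Bochner_Integration.integral_sum int val)
  then show ?thesis by (simp add: trace_def matrix_matrix_mult_def transpose_def mult_ac)
qed

text \<open>Whichever solution \<open>trajectory\<close> selects, the inner integral is the form of
  \<open>P\<close> at the initial state, and the expectation of that form depends only on the second
  moments collected in \<open>D\<close>.\<close>

lemma cost_eq_trace:
  assumes st: "stable (closed_loop A B \<alpha> K)" and x0: "random_initial_state M x0 D"
    and P: "transpose P = P" "lyapunov_op (closed_loop A B \<alpha> K) P = - (Q + transpose K ** R ** K)"
    and Q: "positive_semidefinite Q" and R: "positive_semidefinite R"
  shows "cost A B Q R M x0 K \<alpha> = trace (D ** P)"
proof -
  let ?N = "Q + transpose K ** R ** K"
  have form: "x \<bullet> (Q *v x) + (K *v x) \<bullet> (R *v (K *v x)) = x \<bullet> (?N *v x)" for x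
    by (simp add: matrix_vector_mult_add_rdistrib inner_add_right inner_transpose_mult
        flip: matrix_vector_mul_assoc del: transpose_matrix_vector)
  have "(LINT t:{0..}|lborel. (let x = trajectory A B \<alpha> K \<xi> t; u = K *v x
          in x \<bullet> (Q *v x) + u \<bullet> (R *v u))) = \<xi> \<bullet> (P *v \<xi>)" for \<xi>
  proof -
    let ?y = "trajectory A B \<alpha> K \<xi>"
    have y: "(?y has_vector_derivative closed_loop A B \<alpha> K *v ?y t) (at t within {0..})" if "t \<ge> 0" for t
      using trajectory_is_trajectory[of A B \<alpha> K \<xi>] that
      unfolding is_trajectory_def closed_loop_mult_vec by blast
    have "?y 0 = \<xi>" using trajectory_is_trajectory[of A B \<alpha> K \<xi>] by (simp add: is_trajectory_def)
    then show ?thesis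
      using quadratic_cost_integral[of ?y, OF y st P psd_add[OF Q psd_congruence[OF R]]]
      unfolding Let_def form by simp
  qed
  then show ?thesis
    unfolding cost_def using expectation_quadratic_form[OF x0, of P] P(1) by simp
qed

section \<open>First-order conditions\<close>

lemma matrix_scaleR_left: "(k *\<^sub>R A) ** B = k *\<^sub>R (A ** (B :: real^'p^'n))"
  by (simp only: scalar_matrix_assoc)

lemma matrix_scaleR_right: "A ** (k *\<^sub>R B) = k *\<^sub>R (A ** (B :: real^'p^'n))"
  by (simp only: scalar_matrix_assoc matrix_scalar_ac)

lemma trace_scaleR: "trace (k *\<^sub>R X) = k * trace (X :: real^'n^'n)"
  by (simp add: trace_def sum_distrib_left)

lemma lyapunov_op_perturb:
  "lyapunov_op (F + t *\<^sub>R E) X = lyapunov_op F X + t *\<^sub>R lyapunov_op E X"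
  by (simp add: lyapunov_op_def transpose_add transpose_scalar matrix_add_ldistrib
      matrix_add_rdistrib matrix_scaleR_left matrix_scaleR_right scaleR_add_right)

text \<open>The Lyapunov operators of \<open>F\<close> and of its transpose are adjoint for the
  trace pairing. The generality of commutative rings allows the use over the reals and over the
  ultrapower.\<close>

lemma trace_lyapunov_adjoint:
  fixes F L X :: "'a::comm_ring_1^'n^'n"
  shows "trace ((F ** L + L ** transpose F) ** X) = trace (L ** (transpose F ** X + X ** F))"
proof -
  have "trace (F ** (L ** X)) = trace (L ** X ** F)" by (rule trace_mul_sym)
  then show ?thesis
    by (simp add: matrix_add_ldistrib matrix_add_rdistrib trace_add matrix_mul_assoc)
qed

text \<open>Paired with \<open>L\<close> on the left is the first-order change of the Lyapunov
  equation when \<open>K\<close> moves in direction \<open>E\<close>. Its summands are transposes of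
  each other in pairs and have equal traces against the symmetric \<open>L\<close>, whence the
  factor 2.\<close>

lemma trace_gradient:
  fixes P L R B K E :: "'a::comm_ring_1^'n^'n"
  assumes sym: "transpose P = P" "transpose L = L" "transpose R = R"
  shows "trace (L ** (transpose (B ** E) ** P + P ** (B ** E) + transpose E ** R ** K + transpose K **
      R ** E))
    = 2 * trace (transpose E ** (transpose B ** P + R ** K) ** L)"
proof -
  have flip: "trace (L ** transpose X) = trace (L ** X)" for X
    using trace_transpose[of "X ** L"] trace_mul_sym[of L X] by (simp add: matrix_transpose_mul sym)
  have "transpose (P ** (B ** E)) = transpose (B ** E) ** P"
    "transpose (transpose K ** R ** E) = transpose E ** R ** K"
    by (simp_all add: matrix_transpose_mul sym matrix_mul_assoc)
  then have "trace (L ** (P ** (B ** E))) = trace (L ** (transpose (B ** E) ** P))"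
    "trace (L ** (transpose K ** R ** E)) = trace (L ** (transpose E ** R ** K))"
    using flip[of "P ** (B ** E)"] flip[of "transpose K ** R ** E"] by simp_all
  moreover have "trace (L ** (transpose E ** (transpose B ** P + R ** K))) =
      trace (transpose E ** (transpose B ** P + R ** K) ** L)"
    by (rule trace_mul_sym)
  ultimately show ?thesis
    by (simp add: matrix_add_ldistrib trace_add matrix_transpose_mul matrix_mul_assoc algebra_simps)
qed

text \<open>The formula is exact because \<open>L\<close> belongs to the perturbed loop and
  \<open>P\<close> to the unperturbed one: the adjoint removes the unknown change of
  \<open>P\<close>, and only one explicit quadratic term remains beside the gradient.\<close>

lemma cost_difference:
  fixes F P P' L B K E R :: "real^'n^'n"
  assumes sym: "transpose P = P" "transpose L = L" "transpose R = R"
    and P: "lyapunov_op F P = - (Q + transpose K ** R ** K)"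
    and P': "lyapunov_op (F + t *\<^sub>R (B ** E)) P' =
        - (Q + transpose (K + t *\<^sub>R E) ** R ** (K + t *\<^sub>R E))"
    and L: "lyapunov_op (transpose (F + t *\<^sub>R (B ** E))) L = - D"
  shows "trace (D ** P') - trace (D ** P) =
    t * (2 * trace (transpose E ** (transpose B ** P + R ** K) ** L) + t * trace (L ** (transpose E **
        R ** E)))"
proof -
  let ?F' = "F + t *\<^sub>R (B ** E)"
  have dual: "trace (D ** X) = - trace (L ** lyapunov_op ?F' X)" for X
  proof -
    have "trace (lyapunov_op (transpose ?F') L ** X) = trace (L ** lyapunov_op ?F' X)"
      using trace_lyapunov_adjoint[of ?F' L X] by (simp add: lyapunov_op_def)
    then show ?thesis unfolding L by (simp add: matrix_minus_left trace_def sum_negf)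
  qed
  have shift: "lyapunov_op ?F' P = - (Q + transpose K ** R ** K) + t *\<^sub>R (transpose (B ** E) ** P + P
      ** (B ** E))"
    unfolding P[symmetric] lyapunov_op_perturb by (simp add: lyapunov_op_def)
  have quad: "transpose (K + t *\<^sub>R E) ** R ** (K + t *\<^sub>R E) = transpose K ** R ** K +
      t *\<^sub>R (transpose E ** R ** K + transpose K ** R ** E) + (t * t) *\<^sub>R (transpose E ** R ** E)"
    by (simp add: transpose_add transpose_scalar matrix_add_ldistrib matrix_add_rdistrib
        scaleR_add_right matrix_scaleR_left matrix_scaleR_right)
  have "trace (D ** P') - trace (D ** P) =
      trace (L ** (lyapunov_op ?F' P - lyapunov_op ?F' P'))"
    by (simp add: dual matrix_diff_ldistrib trace_sub)
  also have "lyapunov_op ?F' P - lyapunov_op ?F' P' =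
      t *\<^sub>R (transpose (B ** E) ** P + P ** (B ** E) + transpose E ** R ** K + transpose K ** R ** E)
      + (t * t) *\<^sub>R (transpose E ** R ** E)"
    unfolding shift P' quad by (simp add: algebra_simps)
  also have "trace (L ** \<dots>) = t * (2 * trace (transpose E ** (transpose B ** P + R ** K) ** L))
      + (t * t) * trace (L ** (transpose E ** R ** E))"
    unfolding matrix_add_ldistrib[of L "t *\<^sub>R _"] trace_add matrix_scaleR_right trace_scaleR
        trace_gradient[OF sym] ..
  finally show ?thesis by (simp add: algebra_simps)
qed

section \<open>Continuity of Lyapunov solutions and stationarity\<close>

lemma trace_mult_linear: "linear (\<lambda>X :: real^'n^'n. trace (Y ** X))"
  by (rule linearI) (simp_all add: matrix_add_ldistrib trace_add matrix_scaleR_right trace_scaleR)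

lemma trace_mult_tendsto:
  assumes "(f \<longlongrightarrow> X) G"
  shows "((\<lambda>t. trace (Y ** f t)) \<longlongrightarrow> trace (Y ** (X :: real^'n^'n))) G"
  using bounded_linear.tendsto[OF _ assms] trace_mult_linear[of Y]
  by (simp add: linear_conv_bounded_linear)

text \<open>The operator at \<open>F\<close> is bounded below by \<open>c\<close>. For
  \<open>\<bar>t\<bar> < c / (2 * b)\<close> the perturbation uses up at most half of that bound,
  and the error is of order \<open>t\<close>.\<close>

lemma lyapunov_solution_tendsto:
  fixes L :: "real \<Rightarrow> real^'n^'n"
  assumes F: "stable F" and L0: "lyapunov_op F L0 = C"
    and L: "\<forall>\<^sub>F t in at 0. lyapunov_op (F + t *\<^sub>R E) (L t) = C"
  shows "(L \<longlongrightarrow> L0) (at 0)"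
proof -
  obtain c where c: "c > 0" "\<And>X. c * norm X \<le> norm (lyapunov_op F X)"
    using linear_inj_bounded_below_pos[OF lyapunov_op_linear lyapunov_op_inj[OF F]] by blast
  obtain b where b: "b > 0" "\<And>X. norm (lyapunov_op E X) \<le> b * norm X"
    using linear_bounded_pos[OF lyapunov_op_linear[of E]] by blast
  have bound: "norm (L t - L0) \<le> \<bar>t\<bar> * (2 * b * norm L0 / c)"
    if t: "\<bar>t\<bar> < c / (2 * b)" and Lt: "lyapunov_op (F + t *\<^sub>R E) (L t) = C" for t
  proof -
    have eq: "lyapunov_op F (L t - L0) = - t *\<^sub>R lyapunov_op E (L t)"
      using Lt L0 unfolding lyapunov_op_perturb linear_diff[OF lyapunov_op_linear]
          by (simp add: algebra_simps)
    have "c * norm (L t - L0) \<le> \<bar>t\<bar> * norm (lyapunov_op E (L t))"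
      using c(2)[of "L t - L0"] unfolding eq by simp
    also have "\<dots> \<le> \<bar>t\<bar> * (b * (norm (L t - L0) + norm L0))"
      using b norm_triangle_sub[of "L t" L0]
      by (intro mult_left_mono order.trans[OF b(2)]) auto
    also have "\<dots> = (\<bar>t\<bar> * b) * norm (L t - L0) + \<bar>t\<bar> * b * norm L0" by (simp add: algebra_simps)
    also have "\<dots> \<le> (c / 2) * norm (L t - L0) + \<bar>t\<bar> * b * norm L0"
      using t b(1) by (intro add_right_mono mult_right_mono) (auto simp: field_simps)
    finally show ?thesis using c(1) by (simp add: field_simps)
  qed
  have small: "\<forall>\<^sub>F t in at (0::real). \<bar>t\<bar> < c / (2 * b)"
    unfolding eventually_at using b c by (intro exI[of _ "c / (2 * b)"]) (auto simp: dist_real_def)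
  have "((\<lambda>t. \<bar>t\<bar> * (2 * b * norm L0 / c)) \<longlongrightarrow> \<bar>0\<bar> * (2 * b * norm L0 / c)) (at 0)"
    by (intro tendsto_intros)
  then have "((\<lambda>t. \<bar>t\<bar> * (2 * b * norm L0 / c)) \<longlongrightarrow> 0) (at 0)" by simp
  then have "((\<lambda>t. L t - L0) \<longlongrightarrow> 0) (at 0)"
    by (rule Lim_null_comparison[rotated]) (use small L in eventually_elim, rule bound)
  then show ?thesis by (rule LIM_zero_cancel)
qed

lemma first_order_condition:
  fixes A B Q R D E :: "real^'n^'n" and S :: "(real^'n^'n) set"
  assumes Q: "positive_semidefinite Q" and R: "positive_semidefinite R"
    and D: "positive_semidefinite D" and x0: "random_initial_state M x0 D"
    and K: "K \<in> locally_optimal_gains A B Q R M x0 S \<alpha>" and E: "\<And>t. K + t *\<^sub>R E \<in> S"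
    and F: "F = closed_loop A B \<alpha> K"
    and P: "transpose P = P" "lyapunov_op F P = - (Q + transpose K ** R ** K)"
    and L0: "lyapunov_op (transpose F) L0 = - D"
  shows "trace (transpose E ** (transpose B ** P + R ** K) ** L0) = 0"
proof -
  let ?J = "\<lambda>K. cost A B Q R M x0 K \<alpha>"
  obtain \<delta> where K_st: "stable F" and \<delta>: "\<delta> > 0"
    and min: "\<And>K'. K' \<in> S \<Longrightarrow> stable (closed_loop A B \<alpha> K') \<Longrightarrow> dist K' K < \<delta> \<Longrightarrow> ?J K \<le> ?J K'"
    using K unfolding locally_optimal_gains_def local_minimizers_def F by auto
  have loop: "closed_loop A B \<alpha> (K + t *\<^sub>R E) = F + t *\<^sub>R (B ** E)" for t
    by (simp add: F closed_loop_def matrix_add_ldistrib matrix_scaleR_right)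
  obtain \<delta>1 where \<delta>1: "\<delta>1 > 0" "\<And>t. \<bar>t\<bar> < \<delta>1 \<Longrightarrow> stable (F + t *\<^sub>R (B ** E))"
    using stable_perturb[OF K_st, of "B ** E"] by blast
  \<comment> \<open>The first term keeps the loop stable, the second keeps the gain within \<delta>
    of \<open>K\<close>; adding 1 covers the case \<open>E = 0\<close>.\<close>
  define d where "d = min \<delta>1 (\<delta> / (norm E + 1))"
  have d: "d > 0" using \<delta> \<delta>1 by (simp add: d_def add_nonneg_pos)
  have st: "stable (F + t *\<^sub>R (B ** E))" if "\<bar>t\<bar> < d" for t using that \<delta>1(2) by (simp add: d_def)
  have le: "?J K \<le> ?J (K + t *\<^sub>R E)" if t: "\<bar>t\<bar> < d" for t
  proof (rule min[OF E])
    show "stable (closed_loop A B \<alpha> (K + t *\<^sub>R E))" unfolding loop by (rule st[OF t])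
    have "dist (K + t *\<^sub>R E) K = \<bar>t\<bar> * norm E" by (simp add: dist_norm)
    also have "\<dots> \<le> \<bar>t\<bar> * (norm E + 1)" by (intro mult_left_mono) auto
    also have "\<dots> < \<delta>" using t by (simp add: d_def pos_less_divide_eq add_nonneg_pos)
    finally show "dist (K + t *\<^sub>R E) K < \<delta>" .
  qed
  have "\<exists>X. \<bar>t\<bar> < d \<longrightarrow> positive_semidefinite X \<and> lyapunov_op (transpose (F + t *\<^sub>R (B ** E))) X = - D" for t
    using lyapunov_solution_exists[OF _ D] st[of t] stable_transpose by blast
  then obtain L where L: "\<And>t. \<bar>t\<bar> < d \<Longrightarrow> positive_semidefinite (L t)"
      "\<And>t. \<bar>t\<bar> < d \<Longrightarrow> lyapunov_op (transpose (F + t *\<^sub>R (B ** E))) (L t) = - D"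
    by metis
  define G where "G = transpose E ** (transpose B ** P + R ** K)"
  define h where "h = (\<lambda>t. 2 * trace (G ** L t) + t * trace (transpose E ** R ** E ** L t))"
  \<comment> \<open>The cost difference is \<open>t * h t\<close>. As \<open>h\<close> tends to
    twice the asserted trace, letting \<open>t\<close> tend to 0 from either side shows that the
    limit is both nonnegative and nonpositive.\<close>
  have th: "0 \<le> t * h t" if t: "\<bar>t\<bar> < d" for t
  proof -
    let ?K' = "K + t *\<^sub>R E"
    obtain P' where P': "positive_semidefinite P'"
        "lyapunov_op (F + t *\<^sub>R (B ** E)) P' = - (Q + transpose ?K' ** R ** ?K')"
      using lyapunov_solution_exists[OF st[OF t] psd_add[OF Q psd_congruence[OF R]]] by blast
    have "?J ?K' = trace (D ** P')"
      using cost_eq_trace[OF _ x0 psd_transpose[OF P'(1)] _ Q R, of A B \<alpha> ?K'] st[OF t] P'(2)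
      unfolding loop by simp
    moreover have "?J K = trace (D ** P)"
      using cost_eq_trace[OF _ x0 P(1) _ Q R, of A B \<alpha> K] K_st P(2) unfolding F by simp
    moreover have "trace (D ** P') - trace (D ** P) = t * h t"
      unfolding h_def G_def
      using cost_difference[OF P(1) psd_transpose[OF L(1)[OF t]] psd_transpose[OF R] P(2) P'(2) L(2)[OF t]]
      by (simp only: trace_mul_sym[of "L t" "transpose E ** R ** E"])
    ultimately show ?thesis using le[OF t] by simp
  qed
  have near: "\<forall>\<^sub>F t in at (0::real). \<bar>t\<bar> < d"
    unfolding eventually_at using d by (intro exI[of _ d]) (auto simp: dist_real_def)
  have "(L \<longlongrightarrow> L0) (at 0)"
  proof (rule lyapunov_solution_tendsto[OF _ L0])
    show "stable (transpose F)" using K_st by (simp add: stable_transpose)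
    show "\<forall>\<^sub>F t in at 0. lyapunov_op (transpose F + t *\<^sub>R transpose (B ** E)) (L t) = - D"
      using near by eventually_elim (use L(2) in \<open>simp add: transpose_add transpose_scalar\<close>)
  qed
  then have "(h \<longlongrightarrow> 2 * trace (G ** L0) + 0 * trace (transpose E ** R ** E ** L0)) (at 0)"
    unfolding h_def by (intro tendsto_intros trace_mult_tendsto)
  then have lim: "(h \<longlongrightarrow> 2 * trace (G ** L0)) (at 0)" by simp
  have "\<forall>\<^sub>F t in at_right 0. 0 \<le> h t"
  proof -
    have "\<forall>\<^sub>F t in at_right (0::real). \<bar>t\<bar> < d" using near by (simp add: eventually_at_split)
    then show ?thesis using eventually_at_right_less[of 0]
    proof eventually_elim
      case (elim t)
      with th[of t] show ?case by (simp add: zero_le_mult_iff)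
    qed
  qed
  then have "0 \<le> 2 * trace (G ** L0)"
    using lim by (intro tendsto_lowerbound[of h _ "at_right 0"]) (auto simp: filterlim_at_split)
  moreover have "\<forall>\<^sub>F t in at_left 0. h t \<le> 0"
  proof -
    have "\<forall>\<^sub>F t in at_left (0::real). \<bar>t\<bar> < d" using near by (simp add: eventually_at_split)
    moreover have "\<forall>\<^sub>F t in at_left (0::real). t < 0" by (simp add: eventually_at_filter)
    ultimately show ?thesis
    proof eventually_elim
      case (elim t)
      with th[of t] show ?case by (simp add: zero_le_mult_iff)
    qed
  qed
  then have "2 * trace (G ** L0) \<le> 0"
    using lim by (intro tendsto_upperbound[of h _ "at_left 0"]) (auto simp: filterlim_at_split)
  ultimately show ?thesis by (simp add: G_def)
qed

section \<open>Derivations\<close>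

text \<open>A derivation \<open>D\<close> on a subring is encoded by its graph: the pairs \<open>(x, D x)\<close> form a subring
  of the dual numbers that contains no \<open>(0, a)\<close> with \<open>a \<noteq> 0\<close>.\<close>

definition derivation_graph :: "('a::comm_ring_1 \<times> 'a) set \<Rightarrow> bool" where
  "derivation_graph G \<longleftrightarrow> (1, 0) \<in> G \<and>
     (\<forall>x a y b. (x, a) \<in> G \<longrightarrow> (y, b) \<in> G \<longrightarrow> (x - y, a - b) \<in> G \<and> (x * y, x * b + y * a) \<in> G) \<and>
     (\<forall>a. (0, a) \<in> G \<longrightarrow> a = 0)"

context
  fixes G :: "('a::idom \<times> 'a) set"
  assumes G: "derivation_graph G"
begin

lemma derivation_graph_1: "(1, 0) \<in> G"
  using G by (simp add: derivation_graph_def)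

lemma derivation_graph_diff: "(x, a) \<in> G \<Longrightarrow> (y, b) \<in> G \<Longrightarrow> (x - y, a - b) \<in> G"
  using G by (simp add: derivation_graph_def)

lemma derivation_graph_mult: "(x, a) \<in> G \<Longrightarrow> (y, b) \<in> G \<Longrightarrow> (x * y, x * b + y * a) \<in> G"
  using G by (simp add: derivation_graph_def)

lemma derivation_graph_at_0: "(0, a) \<in> G \<Longrightarrow> a = 0"
  using G by (simp add: derivation_graph_def)

lemma derivation_graph_0: "(0, 0) \<in> G"
  using derivation_graph_diff[OF derivation_graph_1 derivation_graph_1] by simp

lemma derivation_graph_add: "(x, a) \<in> G \<Longrightarrow> (y, b) \<in> G \<Longrightarrow> (x + y, a + b) \<in> G"
  using derivation_graph_diff[OF _ derivation_graph_diff[OF derivation_graph_0]] by force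

lemma derivation_graph_sum:
  "(\<And>i. i \<in> I \<Longrightarrow> (f i, g i) \<in> G) \<Longrightarrow> (sum f I, sum g I) \<in> G"
  by (induction I rule: infinite_finite_induct) (auto intro: derivation_graph_0 derivation_graph_add)

lemma derivation_graph_of_nat: "(of_nat n, 0) \<in> G"
  by (induction n) (use derivation_graph_add[OF derivation_graph_1] derivation_graph_0 in force)+

lemma derivation_graph_unique: "(x, a) \<in> G \<Longrightarrow> (x, b) \<in> G \<Longrightarrow> a = b"
  using derivation_graph_at_0 derivation_graph_diff by fastforce

text \<open>\<open>r\<close> arises from \<open>p\<close> by applying the derivation to each
  coefficient. It is a relation because the derivation is partial and given by its graph.\<close>

definition poly_pair :: "'a poly \<Rightarrow> 'a poly \<Rightarrow> bool" where
  "poly_pair p r \<longleftrightarrow> (\<forall>i. (coeff p i, coeff r i) \<in> G)"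

lemma poly_pair_diff: "poly_pair p r \<Longrightarrow> poly_pair q s \<Longrightarrow> poly_pair (p - q) (r - s)"
  unfolding poly_pair_def using derivation_graph_diff by simp

lemma poly_pair_mult: "poly_pair p r \<Longrightarrow> poly_pair q s \<Longrightarrow> poly_pair (p * q) (p * s + q * r)"
proof -
  assume *: "poly_pair p r" "poly_pair q s"
  have "(coeff (p * q) i, coeff (p * s + q * r) i) \<in> G" for i
  proof -
    have "coeff (q * r) i = (\<Sum>j\<le>i. coeff q (i - j) * coeff r j)"
      unfolding mult.commute[of q r] coeff_mult by (simp only: mult.commute)
    hence "coeff (p * s + q * r) i =
        (\<Sum>j\<le>i. coeff p j * coeff s (i - j) + coeff q (i - j) * coeff r j)"
      by (simp add: coeff_mult sum.distrib)
    thus ?thesis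
      using *
      by (auto simp: poly_pair_def coeff_mult intro!: derivation_graph_sum derivation_graph_mult)
  qed
  thus ?thesis by (simp add: poly_pair_def)
qed

lemma poly_pair_monom: "(x, a) \<in> G \<Longrightarrow> poly_pair (monom x k) (monom a k)"
  unfolding poly_pair_def using derivation_graph_0 by simp

lemma poly_pair_pderiv: "poly_pair p r \<Longrightarrow> \<exists>s. poly_pair (pderiv p) s"
proof
  assume "poly_pair p r"
  then show "poly_pair (pderiv p) (pderiv r)"
    unfolding poly_pair_def coeff_pderiv
    using derivation_graph_mult[OF derivation_graph_of_nat[of "Suc _"]] by (simp del: of_nat_Suc)
qed

end

text \<open>The derivative of \<open>p(w)\<close> if \<open>D w = c\<close> and the coefficients of \<open>r\<close> are the derivatives of
  those of \<open>p\<close>.\<close>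

definition derived_value :: "'a::idom \<Rightarrow> 'a \<Rightarrow> 'a poly \<Rightarrow> 'a poly \<Rightarrow> 'a" where
  "derived_value w c p r = poly r w + poly (pderiv p) w * c"

lemma derived_value_diff: "derived_value w c (p - q) (r - s) = derived_value w c p r - derived_value w
    c q s"
  by (simp add: derived_value_def pderiv_diff algebra_simps)

lemma derived_value_mult:
  "derived_value w c (p * q) (p * s + q * r) =
     poly p w * derived_value w c q s + poly q w * derived_value w c p r"
  by (simp add: derived_value_def pderiv_mult algebra_simps)

text \<open>Once \<open>w\<close> has derivative \<open>c\<close>, the product rule prescribes the
  derivative of every p(w). The hypothesis on relations p(w) = 0 makes that prescription independent
  of \<open>p\<close>.\<close>

lemma derivation_graph_adjoin:
  fixes G :: "('a::idom \<times> 'a) set"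
  assumes G: "derivation_graph G"
    and c: "\<And>p r. poly_pair G p r \<Longrightarrow> poly p w = 0 \<Longrightarrow> derived_value w c p r = 0"
  shows "\<exists>G'. derivation_graph G' \<and> G \<subseteq> G' \<and> (w, c) \<in> G'"
proof -
  define G' where "G' = {(poly p w, derived_value w c p r) | p r. poly_pair G p r}"
  have const: "poly_pair G [:x:] [:a:]" if "(x, a) \<in> G" for x a
    using poly_pair_monom[OF G that, of 0] by (simp add: monom_0)
  have in_G': "(poly p w, derived_value w c p r) \<in> G'" if "poly_pair G p r" for p r
    using that by (auto simp: G'_def)
  have sub: "G \<subseteq> G'"
  proof
    fix z assume z: "z \<in> G"
    obtain x a where [simp]: "z = (x, a)" by force
    show "z \<in> G'"
      using in_G'[OF const[of x a]] z by (simp add: derived_value_def pderiv_pCons)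
  qed
  moreover have "(w, c) \<in> G'"
    using in_G'[OF poly_pair_monom[OF G derivation_graph_1[OF G], of 1]]
    by (simp add: derived_value_def poly_monom pderiv_monom)
  moreover have "derivation_graph G'"
    unfolding derivation_graph_def
  proof (intro conjI allI impI)
    show "(1, 0) \<in> G'" using sub derivation_graph_1[OF G] by blast
    show "a = 0" if "(0, a) \<in> G'" for a
      using that c by (auto simp: G'_def)
    fix x a y b assume "(x, a) \<in> G'" "(y, b) \<in> G'"
    then obtain p r q s where *: "x = poly p w" "a = derived_value w c p r" "poly_pair G p r"
       "y = poly q w" "b = derived_value w c q s" "poly_pair G q s"
      by (auto simp: G'_def)
    show "(x - y, a - b) \<in> G'"
      using in_G'[OF poly_pair_diff[OF G *(3) *(6)]] by (simp add: * derived_value_diff)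
    show "(x * y, x * b + y * a) \<in> G'"
      using in_G'[OF poly_pair_mult[OF G *(3) *(6)]] by (simp add: * derived_value_mult)
  qed
  ultimately show ?thesis by blast
qed

text \<open>Only the zero polynomial vanishes at \<open>w\<close>, so every value \<open>c\<close>
  is compatible.\<close>

lemma derivation_graph_adjoin_transcendental:
  fixes G :: "('a::idom \<times> 'a) set"
  assumes G: "derivation_graph G"
    and w: "\<And>p. (\<forall>i. coeff p i \<in> Domain G) \<Longrightarrow> poly p w = 0 \<Longrightarrow> p = 0"
  shows "\<exists>G'. derivation_graph G' \<and> G \<subseteq> G' \<and> (w, c) \<in> G'"
proof (rule derivation_graph_adjoin[OF G])
  fix p r assume p: "poly_pair G p r" "poly p w = 0"
  hence p0: "p = 0" using w[of p] by (auto simp: poly_pair_def[OF G])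
  have "r = 0"
    using p p0 derivation_graph_at_0[OF G] by (intro poly_eqI) (simp add: poly_pair_def[OF G])
  with p0 show "derived_value w c p r = 0" by (simp add: derived_value_def)
qed

text \<open>For an annihilator \<open>m\<close> of least degree, differentiating m(w) = 0 determines
  \<open>c\<close>. The division is possible: in characteristic 0 the derivative of \<open>m\<close>
  is a nonzero polynomial of smaller degree, so it cannot vanish at \<open>w\<close>. Other
  annihilators are reduced modulo \<open>m\<close>.\<close>

lemma derivation_graph_adjoin_algebraic:
  fixes G :: "('a::field_char_0 \<times> 'a) set"
  assumes G: "derivation_graph G"
    and q: "q \<noteq> 0" "\<forall>i. coeff q i \<in> Domain G" "poly q w = 0"
  shows "\<exists>c G'. derivation_graph G' \<and> G \<subseteq> G' \<and> (w, c) \<in> G'"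
proof -
  define ann where "ann = (\<lambda>p. p \<noteq> 0 \<and> (\<exists>r. poly_pair G p r) \<and> poly p w = 0)"
  have "\<exists>r. poly_pair G q r"
  proof -
    from q have "\<forall>i. \<exists>a. (coeff q i, a) \<in> G" by blast
    then obtain f where f: "\<And>i. (coeff q i, f i) \<in> G" by metis
    have "poly_pair G q (Poly (map f [0..<Suc (degree q)]))"
      unfolding poly_pair_def[OF G]
    proof
      fix i
      show "(coeff q i, coeff (Poly (map f [0..<Suc (degree q)])) i) \<in> G"
        using f[of i] derivation_graph_0[OF G]
        by (cases "i \<le> degree q") (auto simp: nth_default_def coeff_eq_0 simp del: upt_Suc)
    qed
    thus ?thesis ..
  qed
  with q have "ann q" by (auto simp: ann_def)
  define m where "m = arg_min degree ann"
  have m: "ann m" and min: "\<And>p. ann p \<Longrightarrow> degree m \<le> degree p"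
    unfolding m_def using \<open>ann q\<close> arg_min_nat_lemma[of ann q degree] by auto
  then obtain s where s: "poly_pair G m s" and m0: "m \<noteq> 0" "poly m w = 0"
    by (auto simp: ann_def)
  have "degree m \<noteq> 0"
  proof
    assume "degree m = 0"
    then obtain x where "m = [:x:]" by (rule degree_eq_zeroE)
    with m0 show False by simp
  qed
  hence "pderiv m \<noteq> 0" and "degree (pderiv m) < degree m"
    by (auto simp: pderiv_eq_0_iff degree_pderiv)
  hence m': "poly (pderiv m) w \<noteq> 0"
    using min[of "pderiv m"] poly_pair_pderiv[OF G s] by (auto simp: ann_def)
  define c where "c = - poly s w / poly (pderiv m) w"
  have dm: "derived_value w c m s = 0"
    using m' by (simp add: derived_value_def c_def)
  have "derived_value w c p r = 0" if "poly_pair G p r" "poly p w = 0" for p r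
    using that
  proof (induction "degree p" arbitrary: p r rule: less_induct)
    case less
    show ?case
    proof (cases "p = 0")
      case True
      then have "r = 0"
        using less.prems derivation_graph_at_0[OF G] by (intro poly_eqI) (simp add: poly_pair_def[OF G])
      with True show ?thesis by (simp add: derived_value_def)
    next
      case False
      hence deg: "degree m \<le> degree p" using min[of p] less.prems by (auto simp: ann_def)
      define k where "k = degree p - degree m"
      define lm where "lm = monom (lead_coeff m) 0"
      define lm' where "lm' = monom (coeff s (degree m)) 0"
      define lp where "lp = monom (lead_coeff p) k"
      define lp' where "lp' = monom (coeff r (degree p)) k"
      have "(lead_coeff m, coeff s (degree m)) \<in> G" "(lead_coeff p, coeff r (degree p)) \<in> G"
        using s less.prems by (auto simp: poly_pair_def[OF G])
      then have pairs: "poly_pair G lm lm'" "poly_pair G lp lp'"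
        unfolding lm_def lm'_def lp_def lp'_def by (auto intro: poly_pair_monom[OF G])
      \<comment> \<open>One step of pseudo-division, cross-multiplied because the domain of
        \<open>G\<close> is only a ring. Since \<open>p\<close> and \<open>m\<close> vanish at
        \<open>w\<close> and \<open>m\<close> has derived value 0, the derived value is merely
        multiplied by \<open>lead_coeff m\<close>.\<close>
      define p2 where "p2 = lm * p - lp * m"
      define r2 where "r2 = (lm * r + p * lm') - (lp * s + m * lp')"
      have pair2: "poly_pair G p2 r2"
        unfolding p2_def r2_def
        by (intro poly_pair_diff[OF G] poly_pair_mult[OF G] pairs s less.prems)
      have zero2: "poly p2 w = 0" by (simp add: p2_def m0 less.prems)
      have value2: "derived_value w c p2 r2 = lead_coeff m * derived_value w c p r"
        unfolding p2_def r2_def derived_value_diff derived_value_mult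
        by (simp add: m0 less.prems dm lm_def poly_monom)
      have "derived_value w c p2 r2 = 0"
      proof (cases "degree p = 0")
        case True
        then show ?thesis using deg \<open>degree m \<noteq> 0\<close> by simp
      next
        case nz: False
        have top: "coeff p2 (degree p) = 0"
        proof -
          have "coeff (lp * m) (degree p) = lead_coeff p * lead_coeff m"
            using coeff_monom_mult[of "lead_coeff p" k m "degree p"] deg
            by (simp add: lp_def k_def)
          thus ?thesis by (simp add: p2_def lm_def monom_0)
        qed
        have "degree p2 \<le> degree p"
          unfolding p2_def
        proof (rule degree_diff_le)
          show "degree (lm * p) \<le> degree p" by (simp add: lm_def monom_0)
          have "degree (lp * m) \<le> k + degree m"
            unfolding lp_def using degree_mult_le[of "monom (lead_coeff p) k" m] degree_monom_le[of
                "lead_coeff p" k]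
            by linarith
          thus "degree (lp * m) \<le> degree p" using deg by (simp add: k_def)
        qed
        with top nz have "degree p2 < degree p"
          by (metis degree_0 leading_coeff_0_iff le_neq_implies_less neq0_conv)
        from less.hyps[OF this pair2 zero2] show ?thesis .
      qed
      with value2 m0 show ?thesis by simp
    qed
  qed
  from derivation_graph_adjoin[OF G this] show ?thesis by blast
qed

section \<open>Total derivations\<close>

definition derivation :: "('a::comm_ring_1 \<Rightarrow> 'a) \<Rightarrow> bool" where
  "derivation D \<longleftrightarrow> (\<forall>x y. D (x + y) = D x + D y) \<and> (\<forall>x y. D (x * y) = x * D y + y * D x)"

text \<open>A maximal graph exists by Zorn's lemma. Any element, algebraic or transcendental over
  its domain, could still be adjoined, so the domain is the whole field.\<close>

lemma derivation_extends:
  fixes G :: "('a::field_char_0 \<times> 'a) set"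
  assumes G: "derivation_graph G"
  shows "\<exists>D. derivation D \<and> (\<forall>(x, a) \<in> G. D x = a)"
proof -
  define X where "X = {H. derivation_graph H \<and> G \<subseteq> H}"
  have "\<exists>M\<in>X. \<forall>H\<in>X. M \<subseteq> H \<longrightarrow> H = M"
  proof (rule subset_Zorn_nonempty)
    show "X \<noteq> {}" using G by (auto simp: X_def)
    fix \<C> assume \<C>: "\<C> \<noteq> {}" "subset.chain X \<C>"
    have sub: "\<C> \<subseteq> X" and chain: "\<And>H K. H \<in> \<C> \<Longrightarrow> K \<in> \<C> \<Longrightarrow> H \<subseteq> K \<or> K \<subseteq> H"
      using \<C>(2) by (auto simp: subset_chain_def)
    have graph: "derivation_graph H" "G \<subseteq> H" if "H \<in> \<C>" for H
      using that sub by (auto simp: X_def)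
    have "derivation_graph (\<Union>\<C>)"
      unfolding derivation_graph_def
    proof (intro conjI allI impI)
      show "(1, 0) \<in> \<Union>\<C>" using \<C>(1) graph derivation_graph_1 by blast
      show "a = 0" if "(0, a) \<in> \<Union>\<C>" for a
        using that graph derivation_graph_at_0 by blast
      fix x a y b assume "(x, a) \<in> \<Union>\<C>" "(y, b) \<in> \<Union>\<C>"
      then obtain H where H: "H \<in> \<C>" "(x, a) \<in> H" "(y, b) \<in> H"
        using chain by (meson UnionE subsetD)
      show "(x - y, a - b) \<in> \<Union>\<C>" "(x * y, x * b + y * a) \<in> \<Union>\<C>"
        using H graph derivation_graph_diff derivation_graph_mult by blast+
    qed
    moreover have "G \<subseteq> \<Union>\<C>" using \<C>(1) graph by blast
    ultimately show "\<Union>\<C> \<in> X" by (simp add: X_def)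
  qed
  then obtain M where M: "M \<in> X" and max: "\<And>H. H \<in> X \<Longrightarrow> M \<subseteq> H \<Longrightarrow> H = M" by blast
  have M': "derivation_graph M" "G \<subseteq> M" using M by (auto simp: X_def)
  have "\<exists>a. (w, a) \<in> M" for w
  proof -
    have "\<exists>c H. derivation_graph H \<and> M \<subseteq> H \<and> (w, c) \<in> H"
    proof (cases "\<exists>q. q \<noteq> 0 \<and> (\<forall>i. coeff q i \<in> Domain M) \<and> poly q w = 0")
      case True
      then show ?thesis using derivation_graph_adjoin_algebraic[OF M'(1)] by blast
    next
      case False
      then have "\<exists>H. derivation_graph H \<and> M \<subseteq> H \<and> (w, 0) \<in> H"
        by (intro derivation_graph_adjoin_transcendental[OF M'(1)]) blast
      thus ?thesis by blast
    qed
    then obtain c H where H: "derivation_graph H" "M \<subseteq> H" "(w, c) \<in> H" by blast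
    with M'(2) have "H \<in> X" by (auto simp: X_def)
    with max H show ?thesis by blast
  qed
  then obtain D where D: "\<And>w. (w, D w) \<in> M" by metis
  have eq: "D x = a" if "(x, a) \<in> M" for x a
    using derivation_graph_unique[OF M'(1) D that] .
  have "derivation D"
    unfolding derivation_def
    by (intro conjI allI eq derivation_graph_add[OF M'(1)] derivation_graph_mult[OF M'(1)] D)
  thus ?thesis using eq M'(2) by blast
qed

text \<open>Extends the zero derivation on the subring \<open>A\<close>. Read contrapositively, this
  is the criterion for algebraicity over \<open>A\<close>.\<close>

lemma derivation_at_transcendental:
  fixes A :: "'a::field_char_0 set"
  assumes A: "1 \<in> A" "\<And>x y. x \<in> A \<Longrightarrow> y \<in> A \<Longrightarrow> x - y \<in> A" "\<And>x y. x \<in> A \<Longrightarrow> y \<in> A \<Longrightarrow> x * y \<in> A"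
    and w: "\<And>p. (\<forall>i. coeff p i \<in> A) \<Longrightarrow> poly p w = 0 \<Longrightarrow> p = 0"
  shows "\<exists>D. derivation D \<and> (\<forall>x\<in>A. D x = 0) \<and> D w = 1"
proof -
  define G where "G = (\<lambda>x. (x, 0::'a)) ` A"
  have G: "derivation_graph G" "Domain G = A"
    unfolding derivation_graph_def G_def using A by (force, force)
  obtain G' where "derivation_graph G'" "G \<subseteq> G'" "(w, 1) \<in> G'"
    using derivation_graph_adjoin_transcendental[OF G(1), of w 1] w unfolding G(2) by blast
  moreover from this(1) obtain D where "derivation D" "\<forall>(x, a) \<in> G'. D x = a"
    using derivation_extends by blast
  ultimately show ?thesis unfolding G_def by (intro exI[of _ D]) auto
qed

lemma
  assumes "derivation D"
  shows derivation_add: "D (x + y) = D x + D y"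
    and derivation_mult: "D (x * y) = x * D y + y * D x"
    and derivation_0: "D 0 = 0"
    and derivation_minus: "D (- x) = - D x"
    and derivation_diff: "D (x - y) = D x - D y"
    and derivation_sum: "D (sum f I) = (\<Sum>i\<in>I. D (f i))"
proof -
  show add: "D (x + y) = D x + D y" for x y using assms by (simp add: derivation_def)
  show "D (x * y) = x * D y + y * D x" using assms by (simp add: derivation_def)
  show zero: "D 0 = 0" using add[of 0 0] by simp
  show minus: "D (- x) = - D x" for x using add[of x "- x"] zero
      by (simp add: eq_neg_iff_add_eq_0 add.commute)
  show "D (x - y) = D x - D y" using add[of x "- y"] minus by simp
  show "D (sum f I) = (\<Sum>i\<in>I. D (f i))"
    by (induction I rule: infinite_finite_induct) (auto simp: add zero)
qed

section \<open>Plane algebraic curves\<close>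

text \<open>The outer variable is \<open>y\<close> and the coefficients are polynomials in
  \<open>a\<close>; \<open>degree\<close>, \<open>lead_coeff\<close> and \<open>pderiv\<close> of
  such a \<open>p\<close> therefore refer to \<open>y\<close>.\<close>

definition eval2 :: "'a::comm_ring_1 poly poly \<Rightarrow> 'a \<Rightarrow> 'a \<Rightarrow> 'a" where
  "eval2 p a y = poly (poly p [:y:]) a"

lemma eval2_simps [simp]:
  "eval2 0 a y = 0" "eval2 1 a y = 1" "eval2 (p + q) a y = eval2 p a y + eval2 q a y"
  "eval2 (p * q) a y = eval2 p a y * eval2 q a y" "eval2 [:c:] a y = poly c a"
  "eval2 (pCons c p) a y = poly c a + y * eval2 p a y"
  by (simp_all add: eval2_def)

lemma poly_slice: "poly (map_poly (\<lambda>q. poly q a) p) y = eval2 p a y"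
  by (induction p) (simp_all add: map_poly_pCons)

lemma pderiv_slice: "map_poly (\<lambda>q. poly q a) (pderiv p) = pderiv (map_poly (\<lambda>q. poly q a) p)"
  for p :: "'a::idom poly poly"
  by (intro poly_eqI) (simp add: coeff_map_poly coeff_pderiv poly_mult flip: of_nat_Suc)

definition pderiv_coeffs :: "'a::idom poly poly \<Rightarrow> 'a poly poly" where
  "pderiv_coeffs p = map_poly pderiv p"

lemma pderiv_coeffs_pCons: "pderiv_coeffs (pCons c p) = pCons (pderiv c) (pderiv_coeffs p)"
  by (simp add: pderiv_coeffs_def map_poly_pCons)

lemma eval2_pderiv_coeffs: "poly (pderiv (poly p [:y:])) a = eval2 (pderiv_coeffs p) a y"
proof (induction p)
  case (pCons c p)
  then show ?case by (simp add: pderiv_coeffs_pCons pderiv_add pderiv_mult pderiv_pCons pderiv_smult)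
qed (simp add: pderiv_coeffs_def)

lemma DERIV_eval2_left: "((\<lambda>t. eval2 p t y) has_real_derivative eval2 (pderiv_coeffs p) t y) (at t)"
  unfolding eval2_pderiv_coeffs[symmetric] unfolding eval2_def by (rule poly_DERIV)

lemma DERIV_eval2_right: "((\<lambda>y. eval2 p t y) has_real_derivative eval2 (pderiv p) t y) (at y)"
  unfolding poly_slice[symmetric] pderiv_slice by (rule poly_DERIV)

lemma continuous_on_eval2:
  fixes f g :: "'b::topological_space \<Rightarrow> real"
  assumes "continuous_on S f" "continuous_on S g"
  shows "continuous_on S (\<lambda>x. eval2 p (f x) (g x))"
proof (induction p)
  case (pCons c p)
  then show ?case using assms by (auto intro!: continuous_intros)
qed simp

text \<open>On the curve \<open>p = 0\<close> the sign of this polynomial is opposite to that of the slope.\<close>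

definition slope_poly :: "'a::idom poly poly \<Rightarrow> 'a poly poly" where
  "slope_poly p = pderiv_coeffs p * pderiv p"

lemma pos_deriv_less:
  fixes f :: "real \<Rightarrow> real"
  assumes "(f has_real_derivative D) (at x)" "D > 0"
  shows "\<forall>\<^sub>F h in at_right 0. f x < f (x + h)" "\<forall>\<^sub>F h in at_right 0. f (x - h) < f x"
proof -
  obtain d1 where d1: "d1 > 0" "\<And>h. h > 0 \<Longrightarrow> h < d1 \<Longrightarrow> f x < f (x + h)"
    using DERIV_pos_inc_right[OF assms] by blast
  then show "\<forall>\<^sub>F h in at_right 0. f x < f (x + h)"
    unfolding eventually_at_right_field by (intro exI[of _ d1]) auto
  obtain d2 where d2: "d2 > 0" "\<And>h. h > 0 \<Longrightarrow> h < d2 \<Longrightarrow> f (x - h) < f x"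
    using DERIV_pos_inc_left[OF assms] by blast
  then show "\<forall>\<^sub>F h in at_right 0. f (x - h) < f x"
    unfolding eventually_at_right_field by (intro exI[of _ d2]) auto
qed

text \<open>Here \<open>p\<close> is positive just above the point and negative just to its left.
  The positivity survives a small step to the left, so the intermediate value theorem gives a zero
  there that is at least as high; within distance \<open>e\<close> the slope polynomial stays
  positive.\<close>

lemma curve_continue_left_aux:
  fixes p :: "real poly poly"
  assumes zero: "eval2 p t y = 0" and py: "eval2 (pderiv p) t y > 0"
    and pa: "eval2 (pderiv_coeffs p) t y > 0" and c: "c < t"
  shows "\<exists>t' y'. c \<le> t' \<and> t' < t \<and> y \<le> y' \<and> eval2 p t' y' = 0 \<and> eval2 (slope_poly p) t' y' > 0"
proof -
  have slope: "eval2 (slope_poly p) t y > 0" using py pa by (simp add: slope_poly_def)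
  define f where "f = (\<lambda>z. eval2 (slope_poly p) (fst z) (snd z))"
  have "isCont f (t, y)"
    unfolding f_def
    by (intro continuous_on_interior[of UNIV] continuous_on_eval2 continuous_on_fst continuous_on_snd
        continuous_on_id) simp
  hence "\<forall>\<^sub>F z in nhds (t, y). 0 < f z"
    using slope by (intro order_tendstoD) (auto simp: f_def continuous_at isCont_def tendsto_nhds_iff)
  then obtain e where e: "e > 0" "\<And>z. dist z (t, y) < e \<Longrightarrow> 0 < f z"
    unfolding eventually_nhds_metric by blast
  have "\<forall>\<^sub>F h in at_right 0. 0 < h \<and> h < e / 2 \<and> 0 < eval2 p t (y + h)"
  proof (intro eventually_conj)
    show "\<forall>\<^sub>F h in at_right 0. 0 < (h::real)"
      by (rule eventually_at_right_less)
    show "\<forall>\<^sub>F h in at_right 0. 0 < eval2 p t (y + h)"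
      using pos_deriv_less(1)[OF DERIV_eval2_right py] by (simp only: zero)
    show "\<forall>\<^sub>F h in at_right 0. h < e / 2"
      using e by (auto simp: eventually_at_right_field intro: exI[of _ "e/2"])
  qed
  then obtain h where h: "0 < h" "h < e / 2" "0 < eval2 p t (y + h)"
    using eventually_happens'[OF trivial_limit_at_right_real] by blast
  have "\<forall>\<^sub>F k in at_right 0. 0 < k \<and> eval2 p (t - k) y < 0 \<and> k < e / 2 \<and> k < t - c \<and> 0 < eval2 p (t -
      k) (y + h)"
  proof (intro eventually_conj)
    show "\<forall>\<^sub>F k in at_right 0. 0 < (k::real)"
      by (rule eventually_at_right_less)
    show "\<forall>\<^sub>F k in at_right 0. eval2 p (t - k) y < 0"
      using pos_deriv_less(2)[OF DERIV_eval2_left pa] zero by simp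
    show "\<forall>\<^sub>F k in at_right 0. k < e / 2"
      using e by (auto simp: eventually_at_right_field intro: exI[of _ "e/2"])
    show "\<forall>\<^sub>F k in at_right 0. k < t - c"
      using c by (auto simp: eventually_at_right_field intro: exI[of _ "t - c"])
    have "isCont (\<lambda>k. eval2 p (t - k) (y + h)) 0"
      by (intro continuous_on_interior[of UNIV] continuous_on_eval2 continuous_on_diff
          continuous_on_const continuous_on_id) simp
    then have "((\<lambda>k. eval2 p (t - k) (y + h)) \<longlongrightarrow> eval2 p t (y + h)) (at 0)"
      by (simp add: isCont_def)
    then have "((\<lambda>k. eval2 p (t - k) (y + h)) \<longlongrightarrow> eval2 p t (y + h)) (at_right 0)"
      by (rule tendsto_within_subset) simp
    thus "\<forall>\<^sub>F k in at_right 0. 0 < eval2 p (t - k) (y + h)"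
      using h(3) by (rule order_tendstoD)
  qed
  then obtain k where k: "0 < k" "eval2 p (t - k) y < 0" "k < e / 2" "k < t - c"
      "0 < eval2 p (t - k) (y + h)"
    using eventually_happens'[OF trivial_limit_at_right_real] by blast
  have "\<exists>y'\<ge>y. y' \<le> y + h \<and> eval2 p (t - k) y' = 0"
    using k h by (intro IVT') (auto intro!: continuous_on_eval2 continuous_intros)
  then obtain y' where y': "y \<le> y'" "y' \<le> y + h" "eval2 p (t - k) y' = 0" by blast
  have "dist (t - k, y') (t, y) \<le> \<bar>k\<bar> + \<bar>y' - y\<bar>"
    using k by (auto simp: dist_Pair_Pair dist_real_def intro!: order.trans[OF sqrt_sum_squares_le_sum_abs])
  also have "\<dots> < e" using k h y' by simp
  finally have "0 < eval2 (slope_poly p) (t - k) y'" using e(2) by (auto simp: f_def)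
  with k y' show ?thesis by (intro exI[of _ "t - k"] exI[of _ y']) auto
qed

text \<open>A positive slope polynomial means partial derivatives of equal sign. Replacing
  \<open>p\<close> by \<open>- p\<close> makes both positive and changes neither the curve nor the
  slope polynomial.\<close>

lemma curve_continue_left:
  fixes p :: "real poly poly"
  assumes "eval2 p t y = 0" and slope: "eval2 (slope_poly p) t y > 0" and "c < t"
  shows "\<exists>t' y'. c \<le> t' \<and> t' < t \<and> y \<le> y' \<and> eval2 p t' y' = 0 \<and> eval2 (slope_poly p) t' y' > 0"
proof (cases "eval2 (pderiv p) t y > 0")
  case True
  then show ?thesis using assms
    by (intro curve_continue_left_aux) (auto simp: slope_poly_def zero_less_mult_iff)
next
  case False
  have neg: "pderiv_coeffs (- p) = - pderiv_coeffs p"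
      "\<And>q. eval2 (- q) = (\<lambda>t y. - eval2 q t y)" for p :: "real poly poly"
    by (auto simp: pderiv_coeffs_def eval2_def pderiv_minus intro!: poly_eqI ext simp: coeff_map_poly)
  have "slope_poly (- p) = slope_poly p" by (simp add: slope_poly_def neg pderiv_minus)
  then show ?thesis using curve_continue_left_aux[of "- p" t y c] assms False
    by (auto simp: neg pderiv_minus slope_poly_def zero_less_mult_iff)
qed

text \<open>Roots with \<open>\<bar>y\<bar> > 1\<close> obey the Cauchy-type bound \<open>g\<close>,
  the sum of the lower coefficients over the leading one, which is continuous on
  \<open>K\<close>.\<close>

lemma roots_bounded_on_compact:
  fixes p :: "real poly poly"
  assumes K: "compact K" and lead: "\<And>t. t \<in> K \<Longrightarrow> poly (lead_coeff p) t \<noteq> 0"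
  shows "\<exists>C. \<forall>t\<in>K. \<forall>y. eval2 p t y = 0 \<longrightarrow> \<bar>y\<bar> \<le> C"
proof -
  define n where "n = degree p"
  define g where "g = (\<lambda>t. (\<Sum>i<n. \<bar>poly (coeff p i) t\<bar>) / \<bar>poly (lead_coeff p) t\<bar>)"
  have "continuous_on K g"
    unfolding g_def using lead by (intro continuous_intros) auto
  hence "bounded (g ` K)" using K compact_continuous_image compact_imp_bounded by blast
  then obtain C where C: "\<And>t. t \<in> K \<Longrightarrow> \<bar>g t\<bar> \<le> C" by (auto simp: bounded_iff)
  have "\<bar>y\<bar> \<le> max 1 C" if t: "t \<in> K" and zero: "eval2 p t y = 0" for t y
  proof (cases "\<bar>y\<bar> \<le> 1")
    case False
    have slice: "eval2 p t y = (\<Sum>i\<le>n. poly (coeff p i) t * y ^ i)"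
    proof -
      have "degree (map_poly (\<lambda>q. poly q t) p) = n"
        using lead[OF t] unfolding n_def by (rule map_poly_degree_eq)
      thus ?thesis unfolding poly_slice[symmetric] poly_altdef by (simp add: coeff_map_poly)
    qed
    have "n > 0" using zero lead[OF t] by (cases n) (auto simp: slice n_def)
    have "\<bar>poly (coeff p n) t\<bar> * \<bar>y\<bar> ^ n = \<bar>\<Sum>i<n. poly (coeff p i) t * y ^ i\<bar>"
      using zero unfolding slice lessThan_Suc_atMost[symmetric] 
      by (simp add: abs_mult power_abs flip: abs_minus_commute) (metis abs_minus_cancel abs_mult
          add.commute minus_unique power_abs)
    also have "\<dots> \<le> (\<Sum>i<n. \<bar>poly (coeff p i) t\<bar> * \<bar>y\<bar> ^ (n - 1))"
      using False by (intro order.trans[OF sum_abs] sum_mono)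
        (auto simp: abs_mult power_abs intro!: mult_left_mono power_increasing)
    also have "\<dots> = (\<Sum>i<n. \<bar>poly (coeff p i) t\<bar>) * \<bar>y\<bar> ^ (n - 1)"
      by (simp add: sum_distrib_right)
    finally have "\<bar>poly (coeff p n) t\<bar> * \<bar>y\<bar> ^ n \<le> (\<Sum>i<n. \<bar>poly (coeff p i) t\<bar>) * \<bar>y\<bar> ^ (n - 1)" .
    moreover have "\<bar>y\<bar> ^ n = \<bar>y\<bar> * \<bar>y\<bar> ^ (n - 1)" using \<open>n > 0\<close> by (cases n) auto
    ultimately have "(\<bar>poly (coeff p n) t\<bar> * \<bar>y\<bar>) * \<bar>y\<bar> ^ (n - 1) \<le> (\<Sum>i<n. \<bar>poly (coeff p i) t\<bar>) * \<bar>y\<bar>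
        ^ (n - 1)"
      by (simp add: mult.assoc)
    hence "\<bar>poly (coeff p n) t\<bar> * \<bar>y\<bar> \<le> (\<Sum>i<n. \<bar>poly (coeff p i) t\<bar>)"
      by (rule mult_right_le_imp_le) (use False in auto)
    hence "\<bar>y\<bar> \<le> g t"
      using lead[OF t] unfolding g_def n_def by (subst pos_le_divide_eq) (simp_all add: mult.commute)
    with C[OF t] show ?thesis by simp
  qed simp
  thus ?thesis by blast
qed

text \<open>Among the points of the curve that are left of the given one and at least as high, a
  leftmost one must lie over \<open>c\<close>, as otherwise the branch continues to the left. So the
  roots over \<open>c\<close> bound the height.\<close>

lemma decreasing_branches_bounded:
  fixes p :: "real poly poly"
  assumes lead: "\<And>t. t \<ge> c \<Longrightarrow> poly (lead_coeff p) t \<noteq> 0"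
    and slope: "\<And>t y. t \<ge> c \<Longrightarrow> eval2 p t y = 0 \<Longrightarrow> eval2 (slope_poly p) t y \<noteq> 0"
  shows "\<exists>C. \<forall>t\<ge>c. \<forall>y. eval2 p t y = 0 \<longrightarrow> eval2 (slope_poly p) t y > 0 \<longrightarrow> y \<le> C"
proof -
  obtain C where C: "\<And>y. eval2 p c y = 0 \<Longrightarrow> \<bar>y\<bar> \<le> C"
    using roots_bounded_on_compact[of "{c}" p] lead by auto
  have "y0 \<le> C" if t0: "t0 \<ge> c" "eval2 p t0 y0 = 0" "eval2 (slope_poly p) t0 y0 > 0" for t0 y0
  proof -
    \<comment> \<open>The weak inequality makes \<open>Z\<close> closed, and \<open>slope\<close>
      turns it back into a strict one; the root bound makes \<open>Z\<close> compact.\<close>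
    define Z where "Z = ({c..t0} \<times> {y0..}) \<inter> {z. eval2 p (fst z) (snd z) = 0} \<inter>
        {z. eval2 (slope_poly p) (fst z) (snd z) \<ge> 0}"
    obtain B where B: "\<And>t y. t \<in> {c..t0} \<Longrightarrow> eval2 p t y = 0 \<Longrightarrow> \<bar>y\<bar> \<le> B"
      using roots_bounded_on_compact[of "{c..t0}" p] lead by fastforce
    have "Z \<subseteq> {c..t0} \<times> {-B..B}"
      using B by (fastforce simp: Z_def abs_le_iff)
    hence "bounded Z" by (rule bounded_subset[rotated]) (intro bounded_Times bounded_closed_interval)
    moreover have "closed Z"
      unfolding Z_def
      by (intro closed_Int closed_Times closed_Collect_eq closed_Collect_le continuous_on_eval2
          continuous_intros)
    ultimately have "compact (fst ` Z)"
      by (intro compact_continuous_image continuous_intros) (simp add: compact_eq_bounded_closed)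
    moreover have "(t0, y0) \<in> Z" using t0 by (auto simp: Z_def)
    ultimately obtain t where t: "t \<in> fst ` Z" "\<And>s. s \<in> fst ` Z \<Longrightarrow> t \<le> s"
      using compact_attains_inf[of "fst ` Z"] by fastforce
    then obtain y where y: "(t, y) \<in> Z" by auto
    show ?thesis
    proof (cases "t = c")
      case True
      then show ?thesis using y C[of y] by (auto simp: Z_def)
    next
      case False
      then have "c < t" "eval2 (slope_poly p) t y > 0"
        using y slope[of t y] by (auto simp: Z_def)
      then obtain t' y' where "c \<le> t'" "t' < t" "y \<le> y'" "eval2 p t' y' = 0"
          "eval2 (slope_poly p) t' y' > 0"
        using curve_continue_left[of p t y c] y by (auto simp: Z_def)
      then have "(t', y') \<in> Z" using y by (auto simp: Z_def)
      with t(2) \<open>t' < t\<close> show ?thesis by force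
    qed
  qed
  thus ?thesis by blast
qed

text \<open>Bezout's identity over the fraction field of the coefficients, with denominators cleared: an
  element of least degree in the ideal \<open>(p, q)\<close> divides \<open>p\<close> and \<open>q\<close> up to constants.\<close>

lemma minimal_annihilator_bezout:
  fixes p q :: "'r::idom poly" and ev :: "'r poly \<Rightarrow> 'f::idom"
  assumes ev: "\<And>f g. ev (f * g) = ev f * ev g" "ev 1 = 1"
    and p: "ev p = 0" "p \<noteq> 0" and min: "\<And>f. f \<noteq> 0 \<Longrightarrow> ev f = 0 \<Longrightarrow> degree p \<le> degree f"
    and q: "ev q \<noteq> 0"
  shows "\<exists>u v d. u * p + v * q = [:d:] \<and> d \<noteq> 0"
proof (cases "degree p = 0")
  case True
  then obtain d where "p = [:d:]" by (rule degree_eq_zeroE)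
  with p show ?thesis by (intro exI[of _ 1] exI[of _ 0] exI[of _ d]) auto
next
  case deg: False
  define I where "I = {u * p + v * q | u v. True}"
  have p_I: "p \<in> I" and q_I: "q \<in> I"
    unfolding I_def by (force intro: exI[of _ 1] exI[of _ 0])+
  define g where "g = arg_min degree (\<lambda>f. f \<in> I \<and> f \<noteq> 0)"
  have g: "g \<in> I" "g \<noteq> 0" and gmin: "\<And>f. f \<in> I \<Longrightarrow> f \<noteq> 0 \<Longrightarrow> degree g \<le> degree f"
    unfolding g_def using arg_min_nat_lemma[of "\<lambda>f. f \<in> I \<and> f \<noteq> 0" p degree] p_I p by auto
  have divides: "\<exists>k h. smult (lead_coeff g ^ k) f = g * h" if f: "f \<in> I" for f
  proof -
    obtain h r where hr: "pseudo_divmod f g = (h, r)" by force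
    let ?c = "lead_coeff g ^ (Suc (degree f) - degree g)"
    from pseudo_divmod[OF g(2) hr] have *: "smult ?c f = g * h + r" "r = 0 \<or> degree r < degree g" by auto
    obtain u v where uv: "g = u * p + v * q" using g by (auto simp: I_def)
    obtain u' v' where uv': "f = u' * p + v' * q" using f by (auto simp: I_def)
    have "r = smult ?c f - g * h" using * by simp
    also have "\<dots> = (smult ?c u' - u * h) * p + (smult ?c v' - v * h) * q"
      by (subst uv, subst uv') (simp add: algebra_simps smult_add_right)
    finally have "r \<in> I" by (auto simp: I_def)
    with gmin * have "r = 0" by force
    with * show ?thesis by auto
  qed
  have smult: "smult c f = [:c:] * f" for c and f :: "'r poly" by simp
  have pow: "ev [:c ^ k:] \<noteq> 0" if "c \<noteq> 0" for c k
    using min[of "[:c ^ k:]"] deg that by auto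
  obtain k h where kh: "smult (lead_coeff g ^ k) p = g * h" using divides[OF p_I] by blast
  obtain k' h' where kh': "smult (lead_coeff g ^ k') q = g * h'" using divides[OF q_I] by blast
  have "ev g \<noteq> 0"
    using arg_cong[OF kh', of ev] q pow[of "lead_coeff g" k'] g unfolding smult ev by auto
  moreover have "ev g * ev h = 0" using arg_cong[OF kh, of ev] p unfolding smult ev by auto
  ultimately have "ev h = 0" by simp
  have "g * h \<noteq> 0" using kh p g by (metis leading_coeff_0_iff power_eq_0_iff smult_eq_0_iff)
  hence h: "h \<noteq> 0" by auto
  have "degree p = degree g + degree h"
    using arg_cong[OF kh, of degree] g h by (simp add: degree_mult_eq)
  with min[OF h \<open>ev h = 0\<close>] have "degree g = 0" by simp
  then obtain d where d: "g = [:d:]" by (rule degree_eq_zeroE)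
  obtain u v where "g = u * p + v * q" using g by (auto simp: I_def)
  with d g show ?thesis by (intro exI[of _ u] exI[of _ v] exI[of _ d]) auto
qed

section \<open>An ultrapower of the reals\<close>

text \<open>Zorn's lemma gives a maximal family of sets that contains the tails and has the finite
  intersection property. By maximality, a set outside it misses some finite intersection of members,
  which yields all filter axioms and the ultra property.\<close>

lemma free_ultrafilter_exists:
  "\<exists>U :: nat filter. U \<noteq> bot \<and> U \<le> sequentially \<and>
     (\<forall>P. eventually P U \<or> eventually (\<lambda>n. \<not> P n) U)"
proof -
  define fip where "fip = (\<lambda>F :: nat set set. \<forall>S. finite S \<longrightarrow> S \<subseteq> F \<longrightarrow> \<Inter>S \<noteq> {})"
  define tails where "tails = range (\<lambda>k::nat. {k..})"
  have "\<exists>F\<in>{F. tails \<subseteq> F \<and> fip F}. \<forall>G\<in>{F. tails \<subseteq> F \<and> fip F}. F \<subseteq> G \<longrightarrow> G = F"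
  proof (rule subset_Zorn_nonempty)
    have "\<Inter>S \<noteq> {}" if S: "finite S" "S \<subseteq> tails" for S
    proof -
      obtain N where N: "finite N" "S = (\<lambda>k. {k..}) ` N"
        using finite_subset_image[OF S(1) S(2)[unfolded tails_def]] by blast
      obtain m where "\<forall>k\<in>N. k \<le> m" using finite_nat_set_iff_bounded_le N(1) by blast
      hence "m \<in> \<Inter>S" using N by auto
      thus ?thesis by blast
    qed
    hence "tails \<in> {F. tails \<subseteq> F \<and> fip F}" by (simp add: fip_def)
    thus "{F. tails \<subseteq> F \<and> fip F} \<noteq> {}" by blast
    fix \<C> assume \<C>: "\<C> \<noteq> {}" "subset.chain {F. tails \<subseteq> F \<and> fip F} \<C>"
    have "\<Inter>S \<noteq> {}" if S: "finite S" "S \<subseteq> \<Union>\<C>" for S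
    proof -
      obtain F where "F \<in> \<C>" "S \<subseteq> F"
        using finite_subset_Union_chain[OF S \<C>] by blast
      thus ?thesis using \<C>(2) S(1) by (auto simp: subset_chain_def fip_def)
    qed
    moreover obtain F where "F \<in> \<C>" "tails \<subseteq> F" using \<C> by (fastforce simp: subset_chain_def)
    then have "tails \<subseteq> \<Union>\<C>" by blast
    with calculation show "\<Union>\<C> \<in> {F. tails \<subseteq> F \<and> fip F}" by (simp add: fip_def)
  qed
  then obtain F where F0: "F \<in> {F. tails \<subseteq> F \<and> fip F}"
    and max0: "\<forall>G\<in>{F. tails \<subseteq> F \<and> fip F}. F \<subseteq> G \<longrightarrow> G = F" ..
  have F: "tails \<subseteq> F" "fip F" using F0 by simp_all
  have max: "G = F" if "tails \<subseteq> G" "fip G" "F \<subseteq> G" for G using max0 that by simp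
  have fin: "\<Inter>S \<noteq> {}" if "finite S" "S \<subseteq> F" for S using F that by (simp add: fip_def)
  have insert: "\<exists>S. finite S \<and> S \<subseteq> F \<and> \<Inter>S \<inter> A = {}" if "A \<notin> F" for A
  proof -
    have "\<not> fip (insert A F)" using max[of "insert A F"] F that by blast
    then obtain S where S: "finite S" "S \<subseteq> insert A F" "\<Inter>S = {}" unfolding fip_def by auto
    from S(3) have "\<Inter>(S - {A}) \<inter> A = {}" by (auto simp: set_eq_iff)
    with S(1,2) show ?thesis by (intro exI[of _ "S - {A}"]) auto
  qed
  have memI: "A \<in> F" if "finite S" "S \<subseteq> F" "\<Inter>S \<subseteq> A" for S A
  proof (rule ccontr)
    assume "A \<notin> F"
    from insert[OF this] obtain T where T: "finite T" "T \<subseteq> F" "\<Inter>T \<inter> A = {}" by (elim exE conjE)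
    with that(1,2) have "\<Inter>(S \<union> T) \<noteq> {}" by (intro fin) simp_all
    with T(3) that(3) show False by (simp add: Inter_Un_distrib) blast
  qed
  have ultra: "A \<in> F \<or> - A \<in> F" for A
  proof (rule ccontr)
    assume "\<not> ?thesis"
    then have A: "A \<notin> F" "- A \<notin> F" by simp_all
    from insert[OF A(1)] obtain S where S: "finite S" "S \<subseteq> F" "\<Inter>S \<inter> A = {}" by (elim exE conjE)
    from insert[OF A(2)] obtain T where T: "finite T" "T \<subseteq> F" "\<Inter>T \<inter> - A = {}" by (elim exE conjE)
    have "\<Inter>(S \<union> T) \<noteq> {}" using S T by (intro fin) simp_all
    with S(3) T(3) show False by (simp add: Inter_Un_distrib) blast
  qed
  define U where "U = Abs_filter (\<lambda>P. Collect P \<in> F)"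
  have "is_filter (\<lambda>P. Collect P \<in> F)"
  proof
    show "Collect (\<lambda>x. True) \<in> F" using memI[of "{}"] by auto
    show "Collect (\<lambda>x. P x \<and> Q x) \<in> F" if "Collect P \<in> F" "Collect Q \<in> F" for P Q
      using memI[of "{Collect P, Collect Q}" "{x. P x \<and> Q x}"] that by (auto simp: Collect_conj_eq)
    show "Collect Q \<in> F" if "\<forall>x. P x \<longrightarrow> Q x" "Collect P \<in> F" for P Q
      using memI[of "{Collect P}" "Collect Q"] that by auto
  qed
  hence ev: "eventually P U \<longleftrightarrow> Collect P \<in> F" for P
    unfolding U_def by (rule eventually_Abs_filter)
  have "\<not> eventually (\<lambda>_. False) U" using fin[of "{{}}"] by (auto simp: ev)
  hence "U \<noteq> bot" by auto
  moreover have "U \<le> sequentially"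
  proof (rule filter_leI)
    fix P :: "nat \<Rightarrow> bool" assume "eventually P sequentially"
    then obtain k where "{k..} \<subseteq> Collect P" by (auto simp: eventually_sequentially)
    with memI[of "{{k..}}"] F(1) show "eventually P U" by (auto simp: ev tails_def)
  qed
  moreover have "eventually P U \<or> eventually (\<lambda>n. \<not> P n) U" for P
    using ultra[of "Collect P"] by (simp add: ev Collect_neg_eq)
  ultimately show ?thesis by blast
qed

definition free_ultrafilter :: "nat filter" where
  "free_ultrafilter = (SOME U. U \<noteq> bot \<and> U \<le> sequentially \<and>
     (\<forall>P. eventually P U \<or> eventually (\<lambda>n. \<not> P n) U))"

lemma free_ultrafilter: "free_ultrafilter \<noteq> bot" "free_ultrafilter \<le> sequentially"
    "eventually (\<lambda>n. \<not> P n) free_ultrafilter \<longleftrightarrow> \<not> eventually P free_ultrafilter"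
proof -
  have *: "free_ultrafilter \<noteq> bot" "free_ultrafilter \<le> sequentially"
    "\<And>P. eventually P free_ultrafilter \<or> eventually (\<lambda>n. \<not> P n) free_ultrafilter"
    using someI_ex[OF free_ultrafilter_exists] by (simp_all add: free_ultrafilter_def)
  show "free_ultrafilter \<noteq> bot" "free_ultrafilter \<le> sequentially" by fact+
  show "eventually (\<lambda>n. \<not> P n) free_ultrafilter \<longleftrightarrow> \<not> eventually P free_ultrafilter"
    using *(1,3) eventually_conj[of P free_ultrafilter "\<lambda>n. \<not> P n"] by auto
qed

\<comment> \<open>A whole sequence of critical points becomes one point over this field: polynomial
  identities valid at every index pass to the quotient, and since the ultrafilter decides every
  predicate, a nonzero class is invertible.\<close>
quotient_type hyper = "nat \<Rightarrow> real" / "\<lambda>f g. eventually (\<lambda>n. f n = g n) free_ultrafilter"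
  by (intro equivpI reflpI sympI transpI) (auto elim: eventually_elim2 simp: eq_commute)

instantiation hyper :: field
begin

lift_definition zero_hyper :: hyper is "\<lambda>_. 0" .
lift_definition one_hyper :: hyper is "\<lambda>_. 1" .
lift_definition plus_hyper :: "hyper \<Rightarrow> hyper \<Rightarrow> hyper" is "\<lambda>f g n. f n + g n"
  by (auto elim: eventually_elim2)
lift_definition minus_hyper :: "hyper \<Rightarrow> hyper \<Rightarrow> hyper" is "\<lambda>f g n. f n - g n"
  by (auto elim: eventually_elim2)
lift_definition times_hyper :: "hyper \<Rightarrow> hyper \<Rightarrow> hyper" is "\<lambda>f g n. f n * g n"
  by (auto elim: eventually_elim2)
lift_definition divide_hyper :: "hyper \<Rightarrow> hyper \<Rightarrow> hyper" is "\<lambda>f g n. f n / g n"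
  by (auto elim: eventually_elim2)
lift_definition uminus_hyper :: "hyper \<Rightarrow> hyper" is "\<lambda>f n. - f n"
  by (auto elim: eventually_mono)
lift_definition inverse_hyper :: "hyper \<Rightarrow> hyper" is "\<lambda>f n. inverse (f n)"
  by (auto elim: eventually_mono)

instance
proof
  fix a b c :: hyper
  show "a + b + c = a + (b + c)" by transfer (simp add: add.assoc)
  show "a + b = b + a" by transfer (simp add: add.commute)
  show "0 + a = a" by transfer simp
  show "- a + a = 0" by transfer simp
  show "a - b = a + - b" by transfer simp
  show "a * b * c = a * (b * c)" by transfer (simp add: mult.assoc)
  show "a * b = b * a" by transfer (simp add: mult.commute)
  show "1 * a = a" by transfer simp
  show "(a + b) * c = a * c + b * c" by transfer (simp add: algebra_simps)
  show "(0::hyper) \<noteq> 1" by transfer (simp add: free_ultrafilter(1))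
  show "inverse a * a = 1" if "a \<noteq> 0"
    using that by transfer (simp add: free_ultrafilter(3)[symmetric], auto elim: eventually_mono)
  show "a div b = a * inverse b" by transfer (simp add: divide_inverse)
  show "inverse (0::hyper) = 0" by transfer simp
qed

end

instance hyper :: field_char_0
proof
  have of_nat: "of_nat n = abs_hyper (\<lambda>_. of_nat n)" for n
    by (induction n) (simp_all add: zero_hyper.abs_eq one_hyper.abs_eq plus_hyper.abs_eq)
  show "inj (of_nat :: nat \<Rightarrow> hyper)"
    by (rule injI) (simp add: of_nat hyper.abs_eq_iff free_ultrafilter(1) split: if_splits)
qed

section \<open>Polynomials and derivations in the ultrapower\<close>

abbreviation hyp :: "(nat \<Rightarrow> real) \<Rightarrow> hyper" where "hyp \<equiv> abs_hyper"

lemma hyp_eq_iff: "hyp f = hyp g \<longleftrightarrow> eventually (\<lambda>n. f n = g n) free_ultrafilter"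
  by (rule hyper.abs_eq_iff)

lemma hyp_add: "hyp (\<lambda>n. f n + g n) = hyp f + hyp g"
  and hyp_mult: "hyp (\<lambda>n. f n * g n) = hyp f * hyp g"
  and hyp_diff: "hyp (\<lambda>n. f n - g n) = hyp f - hyp g"
  and hyp_0: "hyp (\<lambda>_. 0) = 0"
  and hyp_1: "hyp (\<lambda>_. 1) = 1"
  by (simp_all add: plus_hyper.abs_eq times_hyper.abs_eq minus_hyper.abs_eq zero_hyper_def one_hyper_def)

lemma hyp_sum: "hyp (\<lambda>n. \<Sum>i\<in>I. f i n) = (\<Sum>i\<in>I. hyp (f i))"
  by (induction I rule: infinite_finite_induct) (simp_all add: hyp_0 hyp_add)

lemma hyp_eq_0_iff: "hyp f = 0 \<longleftrightarrow> eventually (\<lambda>n. f n = 0) free_ultrafilter"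
  unfolding hyp_0[symmetric] hyp_eq_iff ..

lemma hyp_neq_0_iff: "hyp f \<noteq> 0 \<longleftrightarrow> eventually (\<lambda>n. f n \<noteq> 0) free_ultrafilter"
  unfolding hyp_eq_0_iff free_ultrafilter(3) ..

lemma hyp_poly_derivation:
  assumes D: "derivation D" and const: "\<And>c. D (hyp (\<lambda>_. c)) = 0"
  shows "D (hyp (\<lambda>n. poly p (f n))) = hyp (\<lambda>n. poly (pderiv p) (f n)) * D (hyp f)"
proof (induction p)
  case 0
  then show ?case by (simp add: hyp_0 derivation_0[OF D])
next
  case (pCons c p)
  then show ?case
    by (simp add: hyp_add hyp_mult derivation_add[OF D] derivation_mult[OF D] const pderiv_pCons
        algebra_simps)
qed

text \<open>This chain rule yields the slope of a plane curve when its equation is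
  differentiated.\<close>

lemma hyp_eval2_derivation:
  assumes D: "derivation D" and const: "\<And>c. D (hyp (\<lambda>_. c)) = 0"
  shows "D (hyp (\<lambda>n. eval2 p (f n) (g n))) =
    hyp (\<lambda>n. eval2 (pderiv_coeffs p) (f n) (g n)) * D (hyp f) +
    hyp (\<lambda>n. eval2 (pderiv p) (f n) (g n)) * D (hyp g)"
proof (induction p)
  case 0
  then show ?case by (simp add: hyp_0 derivation_0[OF D] pderiv_coeffs_def)
next
  case (pCons c p)
  then show ?case
    by (simp add: hyp_add hyp_mult derivation_add[OF D] derivation_mult[OF D]
        hyp_poly_derivation[OF D const] pderiv_pCons pderiv_coeffs_pCons algebra_simps)
qed

lemma poly_nonzero_beyond:
  fixes p :: "real poly"
  assumes "p \<noteq> 0"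
  shows "\<exists>b. \<forall>x\<ge>b. poly p x \<noteq> 0"
proof -
  have "finite {x. poly p x = 0}" using assms by (rule poly_roots_finite)
  then obtain b where "\<forall>x\<in>{x. poly p x = 0}. x \<le> b"
    using bdd_above_finite unfolding bdd_above_def by blast
  thus ?thesis by (intro exI[of _ "b + 1"]) fastforce
qed

text \<open>A divergent sequence leaves the finitely many roots behind, so its class is
  transcendental over the real constants.\<close>

lemma poly_at_infinity_nonzero:
  fixes p :: "real poly"
  assumes "filterlim f at_top sequentially" "p \<noteq> 0"
  shows "hyp (\<lambda>n. poly p (f n)) \<noteq> 0"
proof -
  obtain b where b: "\<And>x. x \<ge> b \<Longrightarrow> poly p x \<noteq> 0"
    using poly_nonzero_beyond[OF assms(2)] by blast
  have "eventually (\<lambda>n. f n \<ge> b) sequentially"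
    using assms(1) by (simp add: filterlim_at_top)
  hence "eventually (\<lambda>n. poly p (f n) \<noteq> 0) sequentially"
    by eventually_elim (rule b)
  thus ?thesis
    unfolding hyp_neq_0_iff using free_ultrafilter(2) by (rule filter_leD[rotated])
qed

text \<open>The derivation argument: \<open>y\<close> is algebraic over \<open>\<real>(a)\<close> because derivations over \<open>\<real>(a)\<close> kill
  it, and the derivation with \<open>D a = 1\<close> computes the slope of the curve through the points \<open>(a n,
  y n)\<close>.\<close>

lemma negative_derivation_bounded:
  fixes a y :: "nat \<Rightarrow> real"
  assumes a: "filterlim a at_top sequentially"
    and deriv: "\<And>D. derivation D \<Longrightarrow> (\<And>c. D (hyp (\<lambda>_. c)) = 0) \<Longrightarrow> D (hyp y) = - hyp s * D (hyp a)"
    and s: "\<And>n. s n > 0"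
  shows "\<exists>C. eventually (\<lambda>n. y n \<le> C) free_ultrafilter"
proof -
  define ev where "ev = (\<lambda>p. hyp (\<lambda>n. eval2 p (a n) (y n)))"
  have ev_mult: "ev (p * q) = ev p * ev q" and ev_1: "ev 1 = 1" for p q
    by (simp_all add: ev_def hyp_mult hyp_1)
  have ev_const: "ev [:c:] \<noteq> 0" if "c \<noteq> 0" for c
    using poly_at_infinity_nonzero[OF a that] by (simp add: ev_def)
  have large: "eventually (\<lambda>n. a n \<ge> b) free_ultrafilter" for b
    using a free_ultrafilter(2) filter_leD unfolding filterlim_at_top by blast
  define constants where "constants = range (\<lambda>c. hyp (\<lambda>_. c))"
  have ev_poly: "\<exists>q. q \<noteq> 0 \<and> ev q = 0"
  proof (rule ccontr)
    assume none: "\<not> ?thesis"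
    \<comment> \<open>This is the ring of real polynomials in \<open>a\<close>. If no relation
      existed, some derivation would kill it and send \<open>hyp y\<close> to 1, whereas
      \<open>deriv\<close> gives 0 once \<open>hyp a\<close> is killed.\<close>
    define A where "A = range (\<lambda>q. hyp (\<lambda>n. poly q (a n)))"
    have A1: "1 \<in> A" unfolding A_def by (rule image_eqI[of _ _ 1]) (simp_all add: hyp_1)
    have Adiff: "x - z \<in> A" if "x \<in> A" "z \<in> A" for x z
      using that unfolding A_def by (auto simp flip: hyp_diff poly_diff)
    have Amult: "x * z \<in> A" if "x \<in> A" "z \<in> A" for x z
      using that unfolding A_def by (auto simp flip: hyp_mult poly_mult)
    have "p = 0" if p: "\<forall>i. coeff p i \<in> A" "poly p (hyp y) = 0" for p
    proof -
      \<comment> \<open>The coefficients, elements of \<open>A\<close>, are lifted to real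
        polynomials; the clause \<open>q = 0 \<longrightarrow> p = 0\<close> carries triviality
        back.\<close>
      have "\<exists>q. ev q = poly p (hyp y) \<and> (q = 0 \<longrightarrow> p = 0)"
        using p(1)
      proof (induction p)
        case 0
        then show ?case by (intro exI[of _ 0]) (simp add: ev_def hyp_0)
      next
        case (pCons c p)
        have "\<forall>i. coeff p i \<in> A" using pCons.prems by (metis coeff_pCons_Suc)
        with pCons.IH obtain q where q: "ev q = poly p (hyp y)" "q = 0 \<longrightarrow> p = 0" by blast
        have "c \<in> A" using pCons.prems by (metis coeff_pCons_0)
        then obtain r where r: "c = hyp (\<lambda>n. poly r (a n))" by (auto simp: A_def)
        show ?case
          using q r by (intro exI[of _ "pCons r q"]) (auto simp: ev_def hyp_add hyp_mult hyp_0)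
      qed
      with none p(2) show ?thesis by metis
    qed
    with A1 Adiff Amult have "\<exists>D. derivation D \<and> (\<forall>x\<in>A. D x = 0) \<and> D (hyp y) = 1"
      by (intro derivation_at_transcendental)
    then obtain D where D: "derivation D" "\<forall>x\<in>A. D x = 0" "D (hyp y) = 1" by (elim exE conjE)
    have "D (hyp (\<lambda>_. c)) = 0" for c
      using bspec[OF D(2), of "hyp (\<lambda>_. c)"] rangeI[of "\<lambda>q. hyp (\<lambda>n. poly q (a n))" "[:c:]"]
          by (simp add: A_def)
    moreover have "D (hyp a) = 0"
      using bspec[OF D(2), of "hyp a"] rangeI[of "\<lambda>q. hyp (\<lambda>n. poly q (a n))" "[:0, 1:]"]
          by (simp add: A_def)
    ultimately show False using deriv[of D] D by simp
  qed
  define p where "p = arg_min degree (\<lambda>q. q \<noteq> 0 \<and> ev q = 0)"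
  have p: "p \<noteq> 0" "ev p = 0" and min: "\<And>q. q \<noteq> 0 \<Longrightarrow> ev q = 0 \<Longrightarrow> degree p \<le> degree q"
    using ev_poly arg_min_nat_lemma[of "\<lambda>q. q \<noteq> 0 \<and> ev q = 0" _ degree] unfolding p_def by auto
  have deg: "degree p \<noteq> 0"
  proof
    assume "degree p = 0"
    then obtain c where "p = [:c:]" by (rule degree_eq_zeroE)
    with p ev_const show False by auto
  qed
  have "pderiv p \<noteq> 0" "degree (pderiv p) < degree p"
    using deg by (auto simp: pderiv_eq_0_iff degree_pderiv)
  hence py: "ev (pderiv p) \<noteq> 0" using min[of "pderiv p"] by auto
  obtain D where D: "derivation D" "\<And>c. D (hyp (\<lambda>_. c)) = 0" "D (hyp a) = 1"
  proof -
    have "q = 0" if q: "\<forall>i. coeff q i \<in> constants" "poly q (hyp a) = 0" for q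
    proof -
      have "\<exists>r. hyp (\<lambda>n. poly r (a n)) = poly q (hyp a) \<and> (r = 0 \<longrightarrow> q = 0)"
        using q(1)
      proof (induction q)
        case 0
        then show ?case by (intro exI[of _ 0]) (simp add: hyp_0)
      next
        case (pCons c q)
        have "\<forall>i. coeff q i \<in> constants" using pCons.prems by (metis coeff_pCons_Suc)
        with pCons.IH obtain r where r: "hyp (\<lambda>n. poly r (a n)) = poly q (hyp a)" "r = 0 \<longrightarrow> q = 0" by blast
        have "c \<in> constants" using pCons.prems by (metis coeff_pCons_0)
        then obtain x where x: "c = hyp (\<lambda>n. x)" by (auto simp: constants_def)
        show ?case
          using r x by (intro exI[of _ "pCons x r"]) (auto simp: hyp_add hyp_mult hyp_0)
      qed
      with q(2) poly_at_infinity_nonzero[OF a] show ?thesis by metis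
    qed
    moreover have "1 \<in> constants" unfolding constants_def
        by (rule image_eqI[of _ _ 1]) (simp_all add: hyp_1)
    moreover have "x - z \<in> constants" if "x \<in> constants" "z \<in> constants" for x z
      using that unfolding constants_def by (auto simp flip: hyp_diff)
    moreover have "x * z \<in> constants" if "x \<in> constants" "z \<in> constants" for x z
      using that unfolding constants_def by (auto simp flip: hyp_mult)
    ultimately have "\<exists>D. derivation D \<and> (\<forall>x\<in>constants. D x = 0) \<and> D (hyp a) = 1"
      by (intro derivation_at_transcendental)
    then obtain D where "derivation D" "\<forall>x\<in>constants. D x = 0" "D (hyp a) = 1"
      by (elim exE conjE)
    thus ?thesis by (intro that[of D]) (simp_all add: constants_def)
  qed
  \<comment> \<open>The relation is differentiated with \<open>D (hyp a) = 1\<close> and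
    \<open>D (hyp y) = - hyp s\<close>.\<close>
  have "ev (pderiv_coeffs p) = ev (pderiv p) * hyp s"
    using hyp_eval2_derivation[OF D(1,2), of p a y] p(2) deriv[OF D(1,2)] D(3)
    by (simp add: ev_def derivation_0[OF D(1)] algebra_simps)
  hence slope: "eventually (\<lambda>n. eval2 (pderiv_coeffs p) (a n) (y n) = eval2 (pderiv p) (a n) (y n) * s
      n) free_ultrafilter"
    unfolding ev_def by (simp flip: hyp_mult add: hyp_eq_iff)
  have zero: "eventually (\<lambda>n. eval2 p (a n) (y n) = 0) free_ultrafilter"
    using p(2) by (simp add: ev_def hyp_eq_0_iff)
  have py': "eventually (\<lambda>n. eval2 (pderiv p) (a n) (y n) \<noteq> 0) free_ultrafilter"
    using py unfolding ev_def hyp_neq_0_iff .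
  have pos: "eventually (\<lambda>n. eval2 (slope_poly p) (a n) (y n) > 0) free_ultrafilter"
    using slope py'
  proof eventually_elim
    case (elim n)
    then have "eval2 (slope_poly p) (a n) (y n) = (eval2 (pderiv p) (a n) (y n))\<^sup>2 * s n"
      by (simp add: slope_poly_def power2_eq_square mult_ac)
    then show ?case using elim s[of n] by simp
  qed
  have "ev (slope_poly p) \<noteq> 0"
    unfolding ev_def hyp_neq_0_iff using pos by (rule eventually_mono) simp
  with ev_mult ev_1 p min have "\<exists>u v d. u * p + v * slope_poly p = [:d:] \<and> d \<noteq> 0"
    by (intro minimal_annihilator_bezout[of ev])
  then obtain u v d where d: "u * p + v * slope_poly p = [:d:]" "d \<noteq> 0" by (elim exE conjE)
  \<comment> \<open>Beyond the last root of this product \<open>p\<close> has no pole, and the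
    Bezout identity excludes common zeros of \<open>p\<close> and
    \<open>slope_poly p\<close>.\<close>
  have "d * lead_coeff p \<noteq> 0" using d p by simp
  then obtain b where b: "\<And>t. t \<ge> b \<Longrightarrow> poly (d * lead_coeff p) t \<noteq> 0"
    using poly_nonzero_beyond by blast
  have "\<exists>C. \<forall>t\<ge>b. \<forall>z. eval2 p t z = 0 \<longrightarrow> eval2 (slope_poly p) t z > 0 \<longrightarrow> z \<le> C"
  proof (rule decreasing_branches_bounded)
    show "poly (lead_coeff p) t \<noteq> 0" if "t \<ge> b" for t using b[OF that] by simp
    show "eval2 (slope_poly p) t z \<noteq> 0" if "t \<ge> b" "eval2 p t z = 0" for t z
    proof
      assume "eval2 (slope_poly p) t z = 0"
      with that(2) have "eval2 (u * p + v * slope_poly p) t z = 0" by simp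
      with b[OF that(1)] show False unfolding d(1) by simp
    qed
  qed
  then obtain C where C: "\<And>t z. t \<ge> b \<Longrightarrow> eval2 p t z = 0 \<Longrightarrow> eval2 (slope_poly p) t z > 0 \<Longrightarrow> z \<le> C"
    by blast
  have "eventually (\<lambda>n. y n \<le> C) free_ultrafilter"
    using large[of b] zero pos by eventually_elim (rule C)
  thus ?thesis by blast
qed

section \<open>Critical points with large damping\<close>

text \<open>\<open>Z\<close> is the set of entries forced to 0: the gain vanishes on it, the
  gradient off it. Apart from definiteness of \<open>P\<close> and \<open>L\<close> everything is a
  polynomial equation, which is what derivations can act on.\<close>

definition critical_triple ::
    "real^'n^'n \<Rightarrow> real^'n^'n \<Rightarrow> real^'n^'n \<Rightarrow> real^'n^'n \<Rightarrow> real^'n^'n \<Rightarrow> ('n \<times> 'n) set \<Rightarrow> real \<Rightarrow>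
     real^'n^'n \<Rightarrow> real^'n^'n \<Rightarrow> real^'n^'n \<Rightarrow> bool" where
  "critical_triple A B Q R D Z \<alpha> K P L \<longleftrightarrow>
     positive_semidefinite P \<and> positive_definite L \<and>
     lyapunov_op (closed_loop A B \<alpha> K) P = - (Q + transpose K ** R ** K) \<and>
     lyapunov_op (transpose (closed_loop A B \<alpha> K)) L = - D \<and>
     (\<forall>i j. K $ i $ j = 0 \<or> (i, j) \<notin> Z) \<and>
     (\<forall>i j. ((transpose B ** P + R ** K) ** L) $ i $ j = 0 \<or> (i, j) \<in> Z)"

lemma trace_transpose_mult_sum: "trace (transpose X ** Y) = (\<Sum>i\<in>UNIV. \<Sum>j\<in>UNIV. X $ i $ j * Y $ i $ j)"
  by (simp add: trace_def matrix_matrix_mult_def transpose_def) (rule sum.swap)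

text \<open>Each free entry contributes the direction of its matrix unit, along which the gain stays
  in \<open>S\<close>.\<close>

lemma locally_optimal_critical:
  fixes A B Q R D :: "real^'n^'n"
  assumes Q: "positive_semidefinite Q" and R: "positive_definite R"
    and D: "positive_definite D" and x0: "random_initial_state M x0 D"
    and K: "K \<in> locally_optimal_gains A B Q R M x0 S \<alpha>" and S: "S = {K. \<forall>(i, j) \<in> Z. K $ i $ j = 0}"
  shows "\<exists>P L. critical_triple A B Q R D Z \<alpha> K P L \<and> cost A B Q R M x0 K \<alpha> = trace (D ** P)"
proof -
  note R' = positive_definite_imp_psd[OF R] and D' = positive_definite_imp_psd[OF D]
  define F where "F = closed_loop A B \<alpha> K"
  have F: "stable F" and KS: "K \<in> S"
    using K unfolding locally_optimal_gains_def local_minimizers_def F_def by auto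
  obtain P where P: "positive_semidefinite P" "lyapunov_op F P = - (Q + transpose K ** R ** K)"
    using lyapunov_solution_exists[OF F psd_add[OF Q psd_congruence[OF R']]] by blast
  have FT: "stable (transpose F)" using F by (simp add: stable_transpose)
  obtain L where L: "positive_semidefinite L" "lyapunov_op (transpose F) L = - D"
    using lyapunov_solution_exists[OF FT D'] by blast
  have Lpd: "positive_definite L"
    using lyapunov_solution_pd[OF L D] by (simp add: lyapunov_matrix_def)
  have G: "((transpose B ** P + R ** K) ** L) $ i $ j = 0" if ij: "(i, j) \<notin> Z" for i j
  proof -
    define E :: "real^'n^'n" where "E = axis i (axis j 1)"
    have E_nth: "E $ k $ l = (if k = i \<and> l = j then 1 else 0)" for k l
      by (simp add: E_def axis_def)
    have "K + t *\<^sub>R E \<in> S" for t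
      using KS ij unfolding S by (auto simp: E_nth)
    from first_order_condition[OF Q R' D' x0 K this F_def psd_transpose[OF P(1)] P(2) L(2)]
    have "trace (transpose E ** ((transpose B ** P + R ** K) ** L)) = 0"
      by (simp add: matrix_mul_assoc)
    moreover have "(\<Sum>k\<in>UNIV. \<Sum>l\<in>UNIV. (if k = i \<and> l = j then 1 else 0) * f k l) = f i j"
      for f :: "'n \<Rightarrow> 'n \<Rightarrow> real"
    proof -
      have "(if k = i \<and> l = j then 1 else 0) * f k l = (if l = j then (if k = i then f k l else 0) else
          0)" for k l
        by simp
      then show ?thesis by (simp only: sum.delta finite) simp
    qed
    ultimately show ?thesis unfolding trace_transpose_mult_sum E_nth by simp
  qed
  have "cost A B Q R M x0 K \<alpha> = trace (D ** P)"
    using cost_eq_trace[OF _ x0 psd_transpose[OF P(1)] _ Q R', of A B \<alpha> K] F P(2) unfolding F_def by simp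
  moreover have "K $ i $ j = 0 \<or> (i, j) \<notin> Z" for i j using KS unfolding S by auto
  ultimately show ?thesis
    using P L(2) Lpd G unfolding critical_triple_def F_def by blast
qed

text \<open>The positive cost rules out \<open>P = 0\<close>, and \<open>L\<close> dominates a
  positive multiple of the identity.\<close>

lemma critical_slope_positive:
  assumes crit: "critical_triple A B Q R D Z \<alpha> K P L" and pos: "trace (D ** P) > 0"
  shows "trace (P ** L) > 0"
proof -
  have P: "positive_semidefinite P" and L: "positive_definite L"
    using crit by (auto simp: critical_triple_def)
  obtain c where c: "c > 0" "positive_semidefinite (L - mat c)"
    using positive_definite_lower_bound[OF L] by blast
  have "trace P \<noteq> 0"
  proof
    assume "trace P = 0"
    then have "P = 0" using psd_entry_le_trace[OF P] by (simp add: vec_eq_iff)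
    with pos show False by (simp add: trace_def)
  qed
  then have "0 < c * trace P" using c(1) psd_trace_nonneg[OF P] by simp
  also have "\<dots> \<le> trace (P ** L)" by (rule trace_mult_psd_lower_bound[OF c(2) P])
  finally show ?thesis .
qed

text \<open>Pairing the differentiated equation for \<open>P\<close> with the adjoint
  \<open>L\<close> eliminates \<open>dP\<close>. The differentials are formal, so any derivation of
  the ultrapower can supply them.\<close>

lemma cost_derivative:
  fixes P L R B K F D dP dF dK :: "'a::comm_ring_1^'n^'n"
  assumes sym: "transpose P = P" "transpose L = L" "transpose R = R"
    and L: "F ** L + L ** transpose F = - D"
    and dP: "transpose dF ** P + transpose F ** dP + (dP ** F + P ** dF) +
      (transpose dK ** R ** K + transpose K ** R ** dK) = 0"
    and dF: "dF = B ** dK - mat a"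
  shows "trace (D ** dP) = 2 * trace (transpose dK ** ((transpose B ** P + R ** K) ** L)) - 2 * trace
      (P ** L) * a"
proof -
  let ?X = "transpose (B ** dK) ** P + P ** (B ** dK) + transpose dK ** R ** K + transpose K ** R ** dK"
  have "transpose F ** dP + dP ** F = mat a ** P + mat a ** P - ?X"
    using dP unfolding dF
    by (simp add: transpose_diff matrix_diff_ldistrib matrix_diff_rdistrib matrix_mat_right
        algebra_simps add_eq_0_iff2)
  moreover have "trace (L ** (mat a ** P)) = a * trace (P ** L)"
  proof -
    have "L ** (mat a ** P) = mat a ** (L ** P)" by (simp add: matrix_mul_assoc matrix_mat_right)
    then show ?thesis by (simp only: trace_mat_mult trace_mul_sym[of L P])
  qed
  ultimately have "trace (L ** (transpose F ** dP + dP ** F)) =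
      (a * trace (P ** L) + a * trace (P ** L)) - trace (L ** ?X)"
    by (simp only: matrix_diff_ldistrib[of L] matrix_add_ldistrib[of L "mat a ** P"
        "mat a ** P"] trace_sub trace_add)
  moreover have "trace (D ** dP) = - trace (L ** (transpose F ** dP + dP ** F))"
  proof -
    have "trace (- D ** dP) = - trace (D ** dP)"
      by (simp add: matrix_minus_left trace_def sum_negf)
    then show ?thesis using trace_lyapunov_adjoint[of F L dP] unfolding L by simp
  qed
  moreover have "trace (L ** ?X) = 2 * trace (transpose dK ** ((transpose B ** P + R ** K) ** L))"
    using trace_gradient[OF sym, of B dK K] by (simp only: matrix_mul_assoc)
  ultimately show ?thesis by (simp add: algebra_simps)
qed

definition hyp_matrix :: "(nat \<Rightarrow> real^'n^'m) \<Rightarrow> hyper^'n^'m" where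
  "hyp_matrix X = (\<chi> i j. hyp (\<lambda>n. X n $ i $ j))"

lemma hyp_matrix_simps:
  "hyp_matrix (\<lambda>n. X n + Y n) = hyp_matrix X + hyp_matrix Y"
  "hyp_matrix (\<lambda>n. X n - Y n) = hyp_matrix X - hyp_matrix Y"
  "hyp_matrix (\<lambda>n. - X n) = - hyp_matrix X"
  "hyp_matrix (\<lambda>n. X n ** Z n) = hyp_matrix X ** hyp_matrix Z"
  "hyp_matrix (\<lambda>n. transpose (X n)) = transpose (hyp_matrix X)"
  "hyp_matrix (\<lambda>n. mat (a n)) = mat (hyp a)"
  using hyp_diff[of "\<lambda>_. 0"]
  by (auto simp: hyp_matrix_def vec_eq_iff hyp_add hyp_diff matrix_matrix_mult_def hyp_sum hyp_mult
      transpose_def mat_def hyp_0)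

lemma hyp_trace: "hyp (\<lambda>n. trace (X n)) = trace (hyp_matrix X)"
  by (simp add: trace_def hyp_sum hyp_matrix_def)

lemma derivation_matrix:
  fixes X Y :: "'a::comm_ring_1^'n^'m" and W :: "'a^'p^'n"
  assumes "derivation d"
  shows "map_matrix d (X + Y) = map_matrix d X + map_matrix d Y"
    "map_matrix d (X - Y) = map_matrix d X - map_matrix d Y"
    "map_matrix d (- X) = - map_matrix d X"
    "map_matrix d (X ** W) = map_matrix d X ** W + X ** map_matrix d W"
    "map_matrix d (transpose X) = transpose (map_matrix d X)"
    "map_matrix d (mat a :: 'a^'n^'n) = mat (d a)"
  by (simp_all add: vec_eq_iff derivation_add[OF assms] derivation_diff[OF assms] derivation_minus[OF assms]
      matrix_matrix_mult_def derivation_sum[OF assms] derivation_mult[OF assms] sum.distrib mult.commute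
      transpose_def mat_def derivation_0[OF assms])

lemma critical_costs_bounded:
  fixes A B Q R D :: "real^'n^'n"
  assumes R: "transpose R = R" and \<alpha>: "filterlim \<alpha> at_top sequentially"
    and crit: "\<And>n. critical_triple A B Q R D Z (\<alpha> n) (K n) (P n) (L n)"
    and pos: "\<And>n. trace (D ** P n) > 0"
  shows "\<exists>C. eventually (\<lambda>n. trace (D ** P n) \<le> C) free_ultrafilter"
proof (rule negative_derivation_bounded[OF \<alpha>])
  show "2 * trace (P n ** L n) > 0" for n
    using critical_slope_positive[OF crit pos] by simp
  fix d assume d: "derivation d" and const: "\<And>c. d (hyp (\<lambda>_. c)) = 0"
  note dm = derivation_matrix[OF d]
  have dconst: "map_matrix d (hyp_matrix (\<lambda>_. X)) = 0" for X :: "real^'n^'n"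
    by (simp add: hyp_matrix_def vec_eq_iff const)
  let ?F = "\<lambda>n. closed_loop A B (\<alpha> n) (K n)"
  let ?A = "hyp_matrix (\<lambda>_. A)" and ?B = "hyp_matrix (\<lambda>_. B)" and ?R = "hyp_matrix (\<lambda>_. R)"
    and ?Q = "hyp_matrix (\<lambda>_. Q)" and ?D = "hyp_matrix (\<lambda>_. D)"
    and ?K = "hyp_matrix K" and ?P = "hyp_matrix P" and ?L = "hyp_matrix L"
  define F where "F = ?A - mat (hyp \<alpha>) + ?B ** ?K"
  have F: "hyp_matrix ?F = F" by (simp add: F_def closed_loop_def hyp_matrix_simps)
  have symP: "transpose (P n) = P n" and symL: "transpose (L n) = L n" for n
    using crit[of n] by (auto simp: critical_triple_def positive_semidefinite_def positive_definite_def)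
  have sym: "transpose ?P = ?P" "transpose ?L = ?L" "transpose ?R = ?R"
    unfolding hyp_matrix_simps(5)[symmetric] by (simp_all add: symP symL R)
  have zero: "hyp_matrix (\<lambda>_. 0) = (0 :: hyper^'n^'n)" by (simp add: hyp_matrix_def vec_eq_iff hyp_0)
  have "transpose (?F n) ** P n + P n ** ?F n + (Q + transpose (K n) ** R ** K n) = 0" for n
    using crit[of n] by (simp add: critical_triple_def lyapunov_op_def)
  then have "hyp_matrix (\<lambda>n. transpose (?F n) ** P n + P n ** ?F n + (Q + transpose (K n) ** R ** K n)) = 0"
    by (simp only: zero)
  then have eqP: "transpose F ** ?P + ?P ** F + (?Q + transpose ?K ** ?R ** ?K) = 0"
    by (simp only: hyp_matrix_simps F)
  have "?F n ** L n + L n ** transpose (?F n) = - D" for n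
    using crit[of n] by (simp add: critical_triple_def lyapunov_op_def)
  then have "hyp_matrix (\<lambda>n. ?F n ** L n + L n ** transpose (?F n)) = hyp_matrix (\<lambda>_. - D)" by simp
  then have eqL: "F ** ?L + ?L ** transpose F = - ?D"
    by (simp only: hyp_matrix_simps F)
  let ?dK = "map_matrix d ?K" and ?dP = "map_matrix d ?P" and ?dF = "map_matrix d F"
  have dF: "?dF = ?B ** ?dK - mat (d (hyp \<alpha>))"
    by (simp add: F_def dm dconst)
  have "map_matrix d (transpose F ** ?P + ?P ** F + (?Q + transpose ?K ** ?R ** ?K)) = 0"
    unfolding eqP by (simp add: vec_eq_iff derivation_0[OF d])
  then have dP: "transpose ?dF ** ?P + transpose F ** ?dP + (?dP ** F + ?P ** ?dF) +
      (transpose ?dK ** ?R ** ?K + transpose ?K ** ?R ** ?dK) = 0"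
    by (simp add: dm dconst)
  \<comment> \<open>On \<open>Z\<close> the gain is identically 0 and so is its derivative; off
    \<open>Z\<close> the gradient is 0.\<close>
  have G0: "trace (transpose ?dK ** ((transpose ?B ** ?P + ?R ** ?K) ** ?L)) = 0"
    unfolding trace_transpose_mult_sum
  proof (intro sum.neutral ballI)
    fix i j
    have G: "(transpose ?B ** ?P + ?R ** ?K) ** ?L =
        hyp_matrix (\<lambda>n. (transpose B ** P n + R ** K n) ** L n)"
      by (simp only: hyp_matrix_simps)
    show "?dK $ i $ j * ((transpose ?B ** ?P + ?R ** ?K) ** ?L) $ i $ j = 0"
    proof (cases "(i, j) \<in> Z")
      case True
      then have "K n $ i $ j = 0" for n using crit[of n] by (auto simp: critical_triple_def)
      then have "?dK $ i $ j = 0" by (simp add: hyp_matrix_def hyp_0 derivation_0[OF d])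
      then show ?thesis by simp
    next
      case False
      then have "((transpose B ** P n + R ** K n) ** L n) $ i $ j = 0" for n
        using crit[of n] by (auto simp: critical_triple_def)
      then show ?thesis unfolding G by (simp add: hyp_matrix_def hyp_0)
    qed
  qed
  have "d (hyp (\<lambda>n. trace (D ** P n))) = trace (map_matrix d (?D ** ?P))"
    unfolding hyp_trace hyp_matrix_simps by (simp add: trace_def derivation_sum[OF d])
  also have "\<dots> = trace (?D ** ?dP)" by (simp add: dm dconst)
  also have "\<dots> = - (2 * trace (?P ** ?L)) * d (hyp \<alpha>)"
    using cost_derivative[OF sym eqL dP dF] by (simp add: G0)
  also have "2 * trace (?P ** ?L) = hyp (\<lambda>n. 2 * trace (P n ** L n))"
  proof -
    have "hyp (\<lambda>n. 2 * trace (P n ** L n)) = hyp (\<lambda>_. 2) * trace (?P ** ?L)"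
      by (simp add: hyp_mult hyp_trace hyp_matrix_simps)
    moreover have "hyp (\<lambda>_. 2) = 2" using hyp_add[of "\<lambda>_. 1" "\<lambda>_. 1"] by (simp add: hyp_1)
    ultimately show ?thesis by simp
  qed
  finally show "d (hyp (\<lambda>n. trace (D ** P n))) = - hyp (\<lambda>n. 2 * trace (P n ** L n)) * d (hyp \<alpha>)" .
qed

section \<open>The entrywise sum norm, which is submultiplicative and dominates trace and operator
  norm\<close>

definition entry_norm :: "real^'n^'m \<Rightarrow> real" where
  "entry_norm X = (\<Sum>i\<in>UNIV. \<Sum>j\<in>UNIV. \<bar>X $ i $ j\<bar>)"

lemma entry_norm_nonneg: "0 \<le> entry_norm X"
  by (simp add: entry_norm_def sum_nonneg)

lemma entry_norm_add: "entry_norm (X + Y) \<le> entry_norm X + entry_norm Y"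
  unfolding entry_norm_def sum.distrib[symmetric] by (intro sum_mono) simp

lemma entry_norm_transpose: "entry_norm (transpose X) = entry_norm X"
  by (simp add: entry_norm_def transpose_def) (rule sum.swap)

lemma entry_norm_mult: "entry_norm (X ** Y) \<le> entry_norm X * entry_norm (Y :: real^'p^'n)"
proof -
  have "entry_norm (X ** Y) \<le> (\<Sum>i\<in>UNIV. \<Sum>j\<in>UNIV. \<Sum>k\<in>UNIV. \<bar>X $ i $ k\<bar> * \<bar>Y $ k $ j\<bar>)"
    unfolding entry_norm_def matrix_matrix_mult_def
    by (intro sum_mono) (simp add: order.trans[OF sum_abs] abs_mult)
  also have "\<dots> = (\<Sum>i\<in>UNIV. \<Sum>k\<in>UNIV. \<bar>X $ i $ k\<bar> * (\<Sum>j\<in>UNIV. \<bar>Y $ k $ j\<bar>))"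
    by (intro sum.cong refl, subst sum.swap) (simp add: sum_distrib_left)
  also have "\<dots> \<le> (\<Sum>i\<in>UNIV. \<Sum>k\<in>UNIV. \<bar>X $ i $ k\<bar> * entry_norm Y)"
    unfolding entry_norm_def by (intro sum_mono mult_left_mono member_le_sum) (auto intro: sum_nonneg)
  also have "\<dots> = entry_norm X * entry_norm Y"
    by (simp add: entry_norm_def sum_distrib_right)
  finally show ?thesis .
qed

lemma abs_trace_le_entry_norm: "\<bar>trace X\<bar> \<le> entry_norm X"
proof -
  have "\<bar>trace X\<bar> \<le> (\<Sum>i\<in>UNIV. \<bar>X $ i $ i\<bar>)" unfolding trace_def by (rule sum_abs)
  also have "\<dots> \<le> entry_norm X"
    unfolding entry_norm_def by (intro sum_mono member_le_sum) auto
  finally show ?thesis .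
qed

lemma abs_trace_mult_le: "\<bar>trace (X ** Y)\<bar> \<le> entry_norm X * entry_norm Y"
  using abs_trace_le_entry_norm entry_norm_mult order.trans by blast

lemma entry_norm_psd:
  fixes P :: "real^'n^'n"
  assumes "positive_semidefinite P"
  shows "entry_norm P \<le> (real CARD('n))\<^sup>2 * trace P"
proof -
  have "entry_norm P \<le> (\<Sum>i\<in>(UNIV::'n set). \<Sum>j\<in>(UNIV::'n set). trace P)"
    unfolding entry_norm_def by (intro sum_mono psd_entry_le_trace assms)
  then show ?thesis by (simp add: power2_eq_square)
qed

lemma entry_norm_squared_le:
  fixes K :: "real^'n^'n"
  shows "(entry_norm K)\<^sup>2 \<le> (real CARD('n))\<^sup>2 * trace (transpose K ** K)"
proof -
  have "(entry_norm K)\<^sup>2 \<le> (\<Sum>i\<in>UNIV. (\<Sum>j\<in>UNIV. \<bar>K $ i $ j\<bar>)\<^sup>2) * CARD('n)"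
    unfolding entry_norm_def by (rule sum_squared_le_sum_of_squares)
  also have "\<dots> \<le> (\<Sum>i\<in>UNIV. (\<Sum>j\<in>UNIV. \<bar>K $ i $ j\<bar>\<^sup>2) * CARD('n)) * CARD('n)"
    by (intro mult_right_mono sum_mono sum_squared_le_sum_of_squares) simp
  also have "\<dots> = (real CARD('n))\<^sup>2 * trace (transpose K ** K)"
    unfolding trace_transpose_mult_sum
    by (simp add: power2_eq_square mult.assoc flip: sum_distrib_right)
  finally show ?thesis .
qed

lemma onorm_le_entry_norm: "onorm ((*v) K) \<le> entry_norm K"
  unfolding entry_norm_def by (rule onorm_le_matrix_component_sum)

lemma trace_congruence_lower_bound:
  fixes K :: "real^'n^'n"
  assumes "positive_semidefinite (R - mat r)"
  shows "r * trace (transpose K ** K) \<le> trace (transpose K ** R ** K)"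
proof -
  have "0 \<le> trace (transpose K ** (R - mat r) ** K)"
    by (intro psd_trace_nonneg psd_congruence assms)
  moreover have "transpose K ** mat r ** K = mat r ** (transpose K ** K)"
    by (simp add: matrix_mat_right matrix_mul_assoc)
  ultimately show ?thesis
    by (simp add: matrix_diff_ldistrib matrix_diff_rdistrib trace_sub trace_mat_mult)
qed

context
  fixes A B Q R D K P L :: "real^'n^'n" and Z and \<alpha> :: real
  assumes crit: "critical_triple A B Q R D Z \<alpha> K P L"
begin

text \<open>The trace of the equation for \<open>P\<close>, with the damping term isolated.\<close>

lemma critical_P_identity:
  "2 * \<alpha> * trace P = trace Q + trace (transpose K ** R ** K) + 2 * trace (P ** A) + 2 * trace (P ** (B
      ** K))"
proof -
  let ?F = "closed_loop A B \<alpha> K"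
  have sym: "transpose P = P" and eq: "transpose ?F ** P + P ** ?F = - (Q + transpose K ** R ** K)"
    using crit by (auto simp: critical_triple_def lyapunov_op_def positive_semidefinite_def)
  have "trace (transpose ?F ** P) = trace (P ** ?F)"
    using trace_transpose[of "P ** ?F"] by (simp add: matrix_transpose_mul sym)
  then have "2 * trace (P ** ?F) = trace (- (Q + transpose K ** R ** K))"
    unfolding eq[symmetric] by (simp add: trace_add)
  also have "\<dots> = - (trace Q + trace (transpose K ** R ** K))"
    by (simp add: trace_def sum_negf sum.distrib sum_subtractf)
  finally show ?thesis
    by (simp add: closed_loop_def matrix_add_ldistrib matrix_diff_ldistrib matrix_mat_right
        trace_add trace_sub trace_mat_mult)
qed

text \<open>The equation for \<open>L\<close> is paired with \<open>X\<close>: the choice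
  \<open>mat 1\<close> bounds \<open>L\<close>, and the choice \<open>transpose K ** R ** K\<close>
  bounds \<open>K\<close> quadratically.\<close>

lemma critical_L_identity:
  assumes X: "transpose X = X"
  shows "2 * \<alpha> * trace (X ** L) = trace (X ** D) + 2 * trace (X ** (A + B ** K) ** L)"
proof -
  let ?F = "closed_loop A B \<alpha> K"
  have sym: "transpose L = L" and eq: "?F ** L + L ** transpose ?F = - D"
    using crit by (auto simp: critical_triple_def lyapunov_op_def positive_definite_def)
  have "trace (X ** (L ** transpose ?F)) = trace (transpose (?F ** L ** X))"
    by (simp add: matrix_transpose_mul sym X)
  also have "\<dots> = trace (X ** (?F ** L))"
    unfolding trace_transpose by (rule trace_mul_sym)
  finally have "2 * trace (X ** (?F ** L)) = trace (X ** (- D))"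
    unfolding eq[symmetric] by (simp add: matrix_add_ldistrib trace_add)
  also have "\<dots> = - trace (X ** D)" by (simp add: matrix_minus_right trace_def sum_negf)
  also have "X ** (?F ** L) = X ** (A + B ** K) ** L - mat \<alpha> ** (X ** L)"
    by (simp add: closed_loop_def matrix_add_ldistrib matrix_diff_ldistrib matrix_add_rdistrib
        matrix_diff_rdistrib matrix_mul_assoc matrix_mat_right)
  finally show ?thesis by (simp add: trace_sub trace_mat_mult)
qed

text \<open>Gain and gradient have complementary supports, so their pairing vanishes.\<close>

lemma critical_K_identity: "trace (transpose K ** R ** K ** L) = - trace (transpose K ** transpose B **
    P ** L)"
proof -
  have "K $ i $ j * ((transpose B ** P + R ** K) ** L) $ i $ j = 0" for i j
    using crit by (auto simp: critical_triple_def)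
  then have "trace (transpose K ** ((transpose B ** P + R ** K) ** L)) = 0"
    unfolding trace_transpose_mult_sum by (intro sum.neutral ballI)
  then show ?thesis
    by (simp add: matrix_add_ldistrib matrix_add_rdistrib trace_add matrix_mul_assoc)
qed

end

text \<open>A bound on the cost first gives \<open>K = O(\<surd>\<alpha>)\<close>, then \<open>P = O((1 + K\<^sup>2) / \<alpha>)\<close> and \<open>L = O(1 / \<alpha>)\<close>.
  The stationarity condition in the direction \<open>K\<close> improves this to \<open>K = O((1 + K\<^sup>2) / \<alpha>)\<close>, that
  is, first to \<open>K = O(1)\<close> and then to \<open>K = O(1 / \<alpha>)\<close>.\<close>

lemma critical_asymptotics:
  fixes A B Q R D :: "real^'n^'n"
  assumes Q: "positive_semidefinite Q" and R: "positive_definite R" and D: "positive_definite D"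
      and C: "0 \<le> C"
  shows "\<exists>\<kappa> \<alpha>0. \<forall>\<alpha>\<ge>\<alpha>0. \<forall>K P L. critical_triple A B Q R D Z \<alpha> K P L \<longrightarrow> trace (D ** P) \<le> C \<longrightarrow>
    \<alpha> > 0 \<and> entry_norm K \<le> \<kappa> / \<alpha> \<and> trace (D ** P) \<le> \<kappa> / \<alpha>"
proof -
  note D' = positive_definite_imp_psd[OF D] and R' = positive_definite_imp_psd[OF R]
  obtain d where d: "d > 0" "positive_semidefinite (D - mat d)"
    using positive_definite_lower_bound[OF D] by blast
  obtain r where r: "r > 0" "positive_semidefinite (R - mat r)"
    using positive_definite_lower_bound[OF R] by blast
  define N where "N = (real CARD('n))\<^sup>2"
  define a b q \<rho> \<delta> where "a = entry_norm A" and "b = entry_norm B" and "q = entry_norm Q"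
    and "\<rho> = entry_norm R" and "\<delta> = entry_norm D"
  have nn: "0 \<le> a" "0 \<le> b" "0 \<le> q" "0 \<le> \<rho>" "0 \<le> \<delta>"
    by (simp_all add: a_def b_def q_def \<rho>_def \<delta>_def entry_norm_nonneg)
  have N: "N > 0" by (simp add: N_def)
  \<comment> \<open>\<open>R\<close> dominates \<open>r\<close> times the identity and
    Cauchy-Schwarz costs the factor \<open>N\<close>, so \<open>m * k\<^sup>2\<close> bounds the
    control term from below.\<close>
  define m where "m = r / N"
  have m: "m > 0" using r N by (simp add: m_def)
  define p0 where "p0 = C / d"
  have p0: "p0 \<ge> 0" using C d by (simp add: p0_def)
  define c1 where "c1 = p0 * (2 + 2 * N * a + 2 * N * b) / m"
  have c1: "c1 \<ge> 0" using p0 N nn m by (simp add: c1_def)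
  define c2 where "c2 = 2 * c1 + c1\<^sup>2"
  have c2: "c2 \<ge> 0" using c1 by (simp add: c2_def)
  \<comment> \<open>\<eta> will bound \<open>N * (a + b * k) / \<alpha>\<close>. The value 1/2
    allows absorption in the trace identities for \<open>P\<close> and \<open>L\<close>; the other
    term makes the error in \<open>quad\<close> cost at most half of the main term.\<close>
  define \<eta> where "\<eta> = min (1 / 2) (d * m / (4 * (\<rho> * \<delta> + 1)))"
  have \<rho>\<delta>: "\<rho> * \<delta> + 1 > 0" using nn by (simp add: add_nonneg_pos)
  have \<eta>: "\<eta> > 0" using d m \<rho>\<delta> by (simp add: \<eta>_def)
  have \<eta>1: "\<eta> \<le> 1 / 2" unfolding \<eta>_def by (rule min.cobounded1)
  have \<eta>2: "4 * \<rho> * \<delta> * \<eta> \<le> d * m"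
  proof -
    have "\<eta> \<le> d * m / (4 * (\<rho> * \<delta> + 1))" unfolding \<eta>_def by (rule min.cobounded2)
    then have "\<eta> * (4 * (\<rho> * \<delta> + 1)) \<le> d * m" using \<rho>\<delta> by (simp add: pos_le_divide_eq)
    moreover have "4 * \<rho> * \<delta> * \<eta> \<le> \<eta> * (4 * (\<rho> * \<delta> + 1))" using \<eta> by (simp add: algebra_simps)
    ultimately show ?thesis by linarith
  qed
  define c3 where "c3 = 4 * b * N\<^sup>2 * \<delta> / (d * m)"
  have c3: "c3 \<ge> 0" using nn d m by (simp add: c3_def)
  define c4 where "c4 = c3 * (q + \<rho> * c2)"
  have c4: "c4 \<ge> 0" using c3 nn c2 by (simp add: c4_def)
  define c5 where "c5 = q + \<rho> * c4\<^sup>2"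
  define \<kappa> where "\<kappa> = max (c3 * c5) (\<delta> * N * c5)"
  \<comment> \<open>With \<open>k \<le> sqrt (c2 * \<alpha>)\<close> the quantity
    \<open>N * (a + b * k)\<close> grows like \<open>sqrt \<alpha>\<close>, hence is at most
    \<open>\<eta> * \<alpha>\<close> from here on.\<close>
  define \<alpha>0 where "\<alpha>0 = max 1 (((N * a + N * b * sqrt c2) / \<eta>)\<^sup>2)"
  have "\<alpha> > 0 \<and> entry_norm K \<le> \<kappa> / \<alpha> \<and> trace (D ** P) \<le> \<kappa> / \<alpha>"
    if \<alpha>: "\<alpha> \<ge> \<alpha>0" and crit: "critical_triple A B Q R D Z \<alpha> K P L"
        and cost: "trace (D ** P) \<le> C" for \<alpha> K P L
  proof -
    have P: "positive_semidefinite P" and Lpd: "positive_definite L"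
      using crit by (auto simp: critical_triple_def)
    note L = positive_definite_imp_psd[OF Lpd]
    define k p l t where "k = entry_norm K" and "p = trace P" and "l = trace L"
      and "t = trace (transpose K ** R ** K)"
    have \<alpha>1: "\<alpha> \<ge> 1" using \<alpha> by (simp add: \<alpha>0_def)
    have k: "k \<ge> 0" by (simp add: k_def entry_norm_nonneg)
    have p: "p \<ge> 0" and l: "l \<ge> 0" by (simp_all add: p_def l_def psd_trace_nonneg P L)
    have nP: "entry_norm P \<le> N * p" and nL: "entry_norm L \<le> N * l"
      unfolding N_def p_def l_def by (rule entry_norm_psd[OF P], rule entry_norm_psd[OF L])
    have nBK: "entry_norm (B ** K) \<le> b * k" unfolding b_def k_def by (rule entry_norm_mult)
    have nABK: "entry_norm (A + B ** K) \<le> a + b * k"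
      using entry_norm_add[of A "B ** K"] nBK by (simp add: a_def)
    have nKRK: "entry_norm (transpose K ** R ** K) \<le> \<rho> * k\<^sup>2"
    proof -
      have "entry_norm (transpose K ** R ** K) \<le> entry_norm (transpose K ** R) * k"
        unfolding k_def by (rule entry_norm_mult)
      also have "\<dots> \<le> (k * \<rho>) * k"
        using entry_norm_mult[of "transpose K" R] k
        by (intro mult_right_mono) (simp_all add: entry_norm_transpose k_def \<rho>_def)
      finally show ?thesis by (simp add: power2_eq_square mult_ac)
    qed
    have t_upper: "t \<le> \<rho> * k\<^sup>2"
      using abs_trace_le_entry_norm[of "transpose K ** R ** K"] nKRK unfolding t_def by linarith
    have t_lower: "m * k\<^sup>2 \<le> t"
    proof -
      have "m * k\<^sup>2 \<le> m * (N * trace (transpose K ** K))"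
        using entry_norm_squared_le[of K] m unfolding k_def N_def by (intro mult_left_mono) auto
      also have "\<dots> = r * trace (transpose K ** K)" using N by (simp add: m_def)
      also have "\<dots> \<le> t" unfolding t_def by (rule trace_congruence_lower_bound[OF r(2)])
      finally show ?thesis .
    qed
    have PA: "\<bar>trace (P ** A)\<bar> \<le> N * p * a"
      using abs_trace_mult_le[of P A] mult_right_mono[OF nP nn(1)] by (simp add: a_def)
    have PBK: "\<bar>trace (P ** (B ** K))\<bar> \<le> N * p * (b * k)"
      using abs_trace_mult_le[of P "B ** K"] mult_mono[OF nP nBK] N p entry_norm_nonneg[of "B ** K"]
      by simp
    have p_le: "p \<le> p0"
    proof -
      have "d * p \<le> trace (P ** D)" unfolding p_def by (rule trace_mult_psd_lower_bound[OF d(2) P])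
      then show ?thesis using cost d(1)
          by (simp add: p0_def pos_le_divide_eq trace_mul_sym[of P D] mult.commute)
    qed
    have idP: "2 * \<alpha> * p = trace Q + t + 2 * trace (P ** A) + 2 * trace (P ** (B ** K))"
      unfolding p_def t_def by (rule critical_P_identity[OF crit])
    \<comment> \<open>As \<open>p\<close> is at most \<open>p0\<close>, the identity for
      \<open>P\<close> bounds \<open>k\<^sup>2\<close> by \<open>c1 * (\<alpha> + k)\<close>; the
      term linear in \<open>k\<close> is absorbed by completing a square.\<close>
    have k_sq: "k\<^sup>2 \<le> c2 * \<alpha>"
    proof -
      have "m * k\<^sup>2 \<le> 2 * \<alpha> * p + 2 * (N * p * a) + 2 * (N * p * (b * k))"
        using t_lower idP PA PBK psd_trace_nonneg[OF Q] by linarith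
      also have "\<dots> = p * (2 * \<alpha> + 2 * N * a + 2 * N * b * k)" by (simp add: algebra_simps)
      also have "\<dots> \<le> p0 * ((2 + 2 * N * a + 2 * N * b) * (\<alpha> + k))"
      proof (intro mult_mono p_le p0)
        have "2 * N * a * 1 \<le> 2 * N * a * (\<alpha> + k)" "2 * N * b * k \<le> 2 * N * b * (\<alpha> + k)"
            "2 * \<alpha> \<le> 2 * (\<alpha> + k)"
          using N nn k \<alpha>1 by (intro mult_left_mono; simp)+
        then show "2 * \<alpha> + 2 * N * a + 2 * N * b * k \<le> (2 + 2 * N * a + 2 * N * b) * (\<alpha> + k)"
          by (simp add: distrib_right)
        show "0 \<le> 2 * \<alpha> + 2 * N * a + 2 * N * b * k" using N nn k \<alpha>1 by simp
      qed
      finally have "k\<^sup>2 \<le> c1 * (\<alpha> + k)" using m by (simp add: c1_def field_simps)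
      moreover have "2 * (c1 * k) \<le> c1\<^sup>2 + k\<^sup>2" using sum_squares_bound[of c1 k] by simp
      ultimately have "k\<^sup>2 \<le> 2 * c1 * \<alpha> + c1\<^sup>2" by (simp add: algebra_simps)
      also have "\<dots> \<le> c2 * \<alpha>"
        using mult_left_mono[OF \<alpha>1, of "c1\<^sup>2"] by (simp add: c2_def algebra_simps)
      finally show ?thesis .
    qed
    have small: "N * (a + b * k) \<le> \<eta> * \<alpha>"
    proof -
      have "k \<le> sqrt c2 * sqrt \<alpha>" using k_sq by (simp add: real_le_rsqrt flip: real_sqrt_mult)
      moreover have "1 \<le> sqrt \<alpha>" using \<alpha>1 by simp
      ultimately have "(N * a) * 1 \<le> (N * a) * sqrt \<alpha>" "(N * b) * k \<le> (N * b) * (sqrt c2 * sqrt \<alpha>)"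
        using N nn by (intro mult_left_mono; simp)+
      then have "N * (a + b * k) \<le> (N * a + N * b * sqrt c2) * sqrt \<alpha>"
        by (simp add: algebra_simps)
      also have "\<dots> \<le> (\<eta> * sqrt \<alpha>) * sqrt \<alpha>"
      proof (rule mult_right_mono)
        have "(N * a + N * b * sqrt c2) / \<eta> \<le> sqrt \<alpha>"
          using \<alpha> by (intro real_le_rsqrt) (simp add: \<alpha>0_def)
        then show "N * a + N * b * sqrt c2 \<le> \<eta> * sqrt \<alpha>" using \<eta>
            by (simp add: pos_divide_le_eq mult.commute)
        show "0 \<le> sqrt \<alpha>" using \<alpha>1 by simp
      qed
      finally show ?thesis using \<alpha>1 by (simp add: mult.assoc)
    qed
    have \<alpha>p: "\<alpha> * p \<le> q + \<rho> * k\<^sup>2"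
    proof -
      have "2 * (N * p * a) + 2 * (N * p * (b * k)) = 2 * p * (N * (a + b * k))"
          by (simp add: algebra_simps)
      also have "\<dots> \<le> 2 * p * (\<eta> * \<alpha>)" using small p by (intro mult_left_mono) auto
      also have "\<dots> \<le> 2 * p * (1 / 2 * \<alpha>)" using \<eta>1 p \<alpha>1 by (intro mult_left_mono mult_right_mono) auto
      finally have "2 * (N * p * a) + 2 * (N * p * (b * k)) \<le> \<alpha> * p" by (simp add: mult.commute)
      moreover have "trace Q \<le> q" using abs_trace_le_entry_norm[of Q] by (simp add: q_def)
      ultimately show ?thesis using idP PA PBK t_upper by linarith
    qed
    have \<alpha>l: "\<alpha> * l \<le> \<delta>"
    proof -
      have "2 * \<alpha> * l = trace D + 2 * trace ((A + B ** K) ** L)"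
        using critical_L_identity[OF crit, of "mat 1"] by (simp add: l_def)
      also have "\<dots> \<le> \<delta> + 2 * ((a + b * k) * (N * l))"
        using abs_trace_le_entry_norm[of D] abs_trace_mult_le[of "A + B ** K" L]
          mult_mono[OF nABK nL] nn k entry_norm_nonneg[of L] by (simp add: \<delta>_def)
      also have "(a + b * k) * (N * l) = (N * (a + b * k)) * l" by simp
      also have "\<delta> + 2 * \<dots> \<le> \<delta> + 2 * ((\<eta> * \<alpha>) * l)"
        using small l by (intro add_left_mono mult_left_mono mult_right_mono) auto
      also have "\<dots> \<le> \<delta> + 2 * ((1 / 2 * \<alpha>) * l)"
        using \<eta>1 l \<alpha>1 by (intro add_left_mono mult_left_mono mult_right_mono) auto
      finally show ?thesis by simp
    qed
    have quad: "d * m * k\<^sup>2 \<le> 4 * \<alpha> * trace (transpose K ** R ** K ** L)"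
    proof -
      let ?X = "transpose K ** R ** K"
      have X: "positive_semidefinite ?X" by (rule psd_congruence[OF R'])
      have "\<bar>trace (?X ** (A + B ** K) ** L)\<bar> \<le> (\<rho> * k\<^sup>2) * ((a + b * k) * (N * l))"
      proof -
        have "entry_norm ((A + B ** K) ** L) \<le> (a + b * k) * (N * l)"
          using entry_norm_mult[of "A + B ** K" L] mult_mono[OF nABK nL] nn k entry_norm_nonneg[of L]
              by simp
        from mult_mono[OF nKRK this] show ?thesis
          using abs_trace_mult_le[of ?X "(A + B ** K) ** L"] nn entry_norm_nonneg[of "(A + B ** K) ** L"]
          by (simp add: matrix_mul_assoc)
      qed
      also have "\<dots> = (\<rho> * k\<^sup>2) * (l * (N * (a + b * k)))" by simp
      also have "\<dots> \<le> (\<rho> * k\<^sup>2) * (l * (\<eta> * \<alpha>))"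
        using small l nn by (intro mult_left_mono) auto
      also have "\<dots> = (\<rho> * k\<^sup>2 * \<eta>) * (\<alpha> * l)" by simp
      also have "\<dots> \<le> (\<rho> * k\<^sup>2 * \<eta>) * \<delta>" using \<alpha>l nn \<eta> by (intro mult_left_mono) auto
      finally have "4 * \<bar>trace (?X ** (A + B ** K) ** L)\<bar> \<le> (4 * \<rho> * \<delta> * \<eta>) * k\<^sup>2" by (simp add: mult_ac)
      also have "\<dots> \<le> d * m * k\<^sup>2" using \<eta>2 by (intro mult_right_mono) auto
      finally have err: "4 * \<bar>trace (?X ** (A + B ** K) ** L)\<bar> \<le> d * m * k\<^sup>2" .
      have "d * (m * k\<^sup>2) \<le> d * t" using t_lower d(1) by (intro mult_left_mono) auto
      also have "\<dots> \<le> trace (?X ** D)" unfolding t_def by (rule trace_mult_psd_lower_bound[OF d(2) X])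
      finally show ?thesis
        using critical_L_identity[OF crit psd_transpose[OF X]] err by (simp add: mult.assoc)
    qed
    \<comment> \<open>\<open>quad\<close> bounds a multiple of \<open>k\<^sup>2\<close> by a trace
      that stationarity bounds by a multiple of \<open>k * p\<close>; a factor \<open>k\<close> is
      cancelled, and \<open>p\<close> is estimated by \<alpha>p.\<close>
    have K_le: "k \<le> c3 * ((q + \<rho> * k\<^sup>2) / \<alpha>)"
    proof (cases "k = 0")
      case True
      then show ?thesis using c3 nn \<alpha>1 by simp
    next
      case False
      have "4 * \<alpha> * trace (transpose K ** R ** K ** L) \<le> 4 * \<alpha> * ((k * b) * ((N * p) * (N * l)))"
      proof (rule mult_left_mono)
        have "entry_norm (P ** L) \<le> (N * p) * (N * l)"
          using entry_norm_mult[of P L] mult_mono[OF nP nL] N p entry_norm_nonneg[of L] by simp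
        moreover have "entry_norm (transpose K ** transpose B) \<le> k * b"
          using entry_norm_mult[of "transpose K" "transpose B"]
              by (simp add: entry_norm_transpose k_def b_def)
        ultimately have "\<bar>trace (transpose K ** transpose B ** (P ** L))\<bar> \<le> (k * b) * ((N * p) * (N * l))"
          using abs_trace_mult_le[of "transpose K ** transpose B"
              "P ** L"] k nn entry_norm_nonneg[of "P ** L"]
          by (meson mult_mono mult_nonneg_nonneg order.trans)
        then show "trace (transpose K ** R ** K ** L) \<le> (k * b) * ((N * p) * (N * l))"
          unfolding critical_K_identity[OF crit] by (simp add: matrix_mul_assoc)
      qed (use \<alpha>1 in simp)
      also have "\<dots> = 4 * k * b * N\<^sup>2 * p * (\<alpha> * l)" by (simp add: power2_eq_square)
      also have "\<dots> \<le> 4 * k * b * N\<^sup>2 * p * \<delta>" using \<alpha>l k nn p by (intro mult_left_mono) auto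
      also have "\<dots> = k * (4 * b * N\<^sup>2 * \<delta> * p)" by simp
      finally have "k * (d * m * k) \<le> k * (4 * b * N\<^sup>2 * \<delta> * p)"
        using quad by (simp add: power2_eq_square mult_ac)
      then have "d * m * k \<le> 4 * b * N\<^sup>2 * \<delta> * p" using False k by simp
      then have "k \<le> c3 * p" using d m by (simp add: c3_def field_simps)
      also have "\<dots> \<le> c3 * ((q + \<rho> * k\<^sup>2) / \<alpha>)"
        using \<alpha>p c3 \<alpha>1 by (intro mult_left_mono) (simp_all add: pos_le_divide_eq mult.commute)
      finally show ?thesis .
    qed
    have "k \<le> c4"
    proof -
      have "q + \<rho> * k\<^sup>2 \<le> q * \<alpha> + \<rho> * (c2 * \<alpha>)"
        using k_sq nn \<alpha>1 by (intro add_mono mult_left_mono) (auto simp: mult_le_cancel_left1)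
      then have "(q + \<rho> * k\<^sup>2) / \<alpha> \<le> q + \<rho> * c2" using \<alpha>1 by (simp add: pos_divide_le_eq algebra_simps)
      then have "c3 * ((q + \<rho> * k\<^sup>2) / \<alpha>) \<le> c4" unfolding c4_def using c3 by (rule mult_left_mono)
      with K_le show ?thesis by linarith
    qed
    then have c5: "q + \<rho> * k\<^sup>2 \<le> c5"
      unfolding c5_def using nn k by (intro add_left_mono mult_left_mono power_mono) auto
    have "c3 * ((q + \<rho> * k\<^sup>2) / \<alpha>) \<le> c3 * (c5 / \<alpha>)"
      using c5 c3 \<alpha>1 by (intro mult_left_mono divide_right_mono) auto
    also have "\<dots> \<le> \<kappa> / \<alpha>" using \<alpha>1 by (simp add: \<kappa>_def divide_right_mono)
    finally have "entry_norm K \<le> \<kappa> / \<alpha>" using K_le by (simp add: k_def)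
    moreover have "trace (D ** P) \<le> \<kappa> / \<alpha>"
    proof -
      have "trace (D ** P) \<le> \<delta> * (N * p)"
        using abs_trace_mult_le[of D P] mult_left_mono[OF nP nn(5)] by (simp add: \<delta>_def)
      also have "\<dots> \<le> \<delta> * (N * (c5 / \<alpha>))"
      proof -
        have "p \<le> c5 / \<alpha>" using \<alpha>p c5 \<alpha>1 by (simp add: pos_le_divide_eq mult.commute)
        then show ?thesis using nn N by (intro mult_left_mono) auto
      qed
      also have "\<dots> \<le> \<kappa> / \<alpha>" using \<alpha>1 by (simp add: \<kappa>_def divide_right_mono mult.assoc)
      finally show ?thesis .
    qed
    ultimately show ?thesis using \<alpha>1 by simp
  qed
  then show ?thesis by blast
qed

theorem theorem3:
  fixes A B Q R D0 :: "real^('n::{finite,linorder})^('n::{finite,linorder})"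
    and S :: "(real^('n::{finite,linorder})^('n::{finite,linorder})) set"
    and M :: "'w measure"
    and x0 :: "'w \<Rightarrow> real^('n::{finite,linorder})"
  assumes "positive_semidefinite Q"
    and "positive_definite R"
    and "positive_definite D0"
    and "random_initial_state M x0 D0"
    and "entry_subspace S"
    and "block_diagonal_square (indicator_matrix S)"
    and "has_sparsity_pattern R (indicator_matrix S)"
  shows "(\<forall>\<epsilon>>0. \<exists>\<alpha>0. \<forall>\<alpha>\<ge>\<alpha>0. \<forall>K \<in> locally_optimal_gains A B Q R M x0 S \<alpha>.
            onorm ((*v) K) < \<epsilon>) \<and>
         (\<forall>\<epsilon>>0. \<exists>\<alpha>0. \<forall>\<alpha>\<ge>\<alpha>0. \<forall>K \<in> locally_optimal_gains A B Q R M x0 S \<alpha>.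
            cost A B Q R M x0 K \<alpha> < \<epsilon>)"
proof -
  note Q = assms(1) and R = assms(2) and D = assms(3) and x0 = assms(4)
  obtain Z where S: "S = {K. \<forall>(i, j) \<in> Z. K $ i $ j = 0}"
    using assms(5) unfolding entry_subspace_def by blast
  let ?J = "\<lambda>K \<alpha>. cost A B Q R M x0 K \<alpha>" and ?Opt = "\<lambda>\<alpha>. locally_optimal_gains A B Q R M x0 S \<alpha>"
  have crit: "\<exists>P L. critical_triple A B Q R D0 Z \<alpha> K P L \<and> ?J K \<alpha> = trace (D0 ** P)" if "K \<in> ?Opt \<alpha>" for \<alpha> K
    by (rule locally_optimal_critical[OF Q R D x0 that S])
  have "\<exists>C \<alpha>1. \<forall>\<alpha>\<ge>\<alpha>1. \<forall>K\<in>?Opt \<alpha>. ?J K \<alpha> \<le> C"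
  proof (rule ccontr)
    assume "\<not> ?thesis"
    \<comment> \<open>Damping and cost exceed \<open>n\<close> simultaneously. The ultrafilter is
      finer than \<open>sequentially\<close>, so no constant bounds these costs along it.\<close>
    then have "\<forall>n. \<exists>\<alpha> K. \<alpha> \<ge> real n \<and> K \<in> ?Opt \<alpha> \<and> ?J K \<alpha> > real n"
      by (meson not_le)
    then obtain \<alpha> K where aK: "\<And>n. \<alpha> n \<ge> real n" "\<And>n. K n \<in> ?Opt (\<alpha> n)" "\<And>n. ?J (K n) (\<alpha> n) > real n"
      by metis
    from crit[OF aK(2)] obtain P L where PL: "\<And>n. critical_triple A B Q R D0 Z (\<alpha> n) (K n) (P n) (L n)"
        "\<And>n. ?J (K n) (\<alpha> n) = trace (D0 ** P n)"
      by metis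
    have large: "trace (D0 ** P n) > real n" for n using aK(3)[of n] PL(2)[of n] by simp
    have "\<exists>C. eventually (\<lambda>n. trace (D0 ** P n) \<le> C) free_ultrafilter"
    proof (rule critical_costs_bounded[OF _ _ PL(1)])
      show "transpose R = R" using R by (simp add: positive_definite_def)
      show "filterlim \<alpha> at_top sequentially"
        using filterlim_real_sequentially by (rule filterlim_at_top_mono) (simp add: aK(1))
      show "trace (D0 ** P n) > 0" for n using large[of n] by linarith
    qed
    then obtain C where C: "eventually (\<lambda>n. trace (D0 ** P n) \<le> C) free_ultrafilter" by blast
    have "eventually (\<lambda>n. C \<le> real n) sequentially"
      using filterlim_real_sequentially unfolding filterlim_at_top by blast
    then have "eventually (\<lambda>n. C \<le> real n) free_ultrafilter"
      using free_ultrafilter(2) filter_leD by blast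
    with C have "eventually (\<lambda>n. False) free_ultrafilter"
    proof eventually_elim
      case (elim n)
      with large[of n] show ?case by simp
    qed
    with free_ultrafilter(1) show False by (simp add: eventually_False)
  qed
  then obtain C \<alpha>1 where C: "\<And>\<alpha> K. \<alpha> \<ge> \<alpha>1 \<Longrightarrow> K \<in> ?Opt \<alpha> \<Longrightarrow> ?J K \<alpha> \<le> C" by blast
  obtain \<kappa> \<alpha>2 where \<kappa>: "\<forall>\<alpha>\<ge>\<alpha>2. \<forall>K P L. critical_triple A B Q R D0 Z \<alpha> K P L \<longrightarrow>
      trace (D0 ** P) \<le> max C 0 \<longrightarrow> \<alpha> > 0 \<and> entry_norm K \<le> \<kappa> / \<alpha> \<and> trace (D0 ** P) \<le> \<kappa> / \<alpha>"
    using critical_asymptotics[OF Q R D max.cobounded2[of 0 C], of A B Z] by blast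
  \<comment> \<open>The summand 1 in the threshold makes
    \<open>\<bar>\<kappa>\<bar> / \<epsilon> < \<alpha>\<close> strict, so that
    \<open>\<kappa> / \<alpha>\<close> falls below \<epsilon>.\<close>
  have small: "onorm ((*v) K) < \<epsilon> \<and> ?J K \<alpha> < \<epsilon>"
    if \<epsilon>: "\<epsilon> > 0" and \<alpha>: "\<alpha> \<ge> max (max \<alpha>1 \<alpha>2) (\<bar>\<kappa>\<bar> / \<epsilon> + 1)" and K: "K \<in> ?Opt \<alpha>" for \<epsilon> \<alpha> K
  proof -
    obtain P L where PL: "critical_triple A B Q R D0 Z \<alpha> K P L" "?J K \<alpha> = trace (D0 ** P)"
      using crit[OF K] by blast
    have "trace (D0 ** P) \<le> max C 0" using C[OF _ K] \<alpha> PL(2) by simp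
    with \<kappa> PL(1) \<alpha> have *: "\<alpha> > 0" "entry_norm K \<le> \<kappa> / \<alpha>" "trace (D0 ** P) \<le> \<kappa> / \<alpha>" by auto
    have "\<bar>\<kappa>\<bar> / \<epsilon> < \<alpha>" using \<alpha> by simp
    then have "\<kappa> < \<epsilon> * \<alpha>" using \<epsilon> by (simp add: pos_divide_less_eq mult.commute)
    then have "\<kappa> / \<alpha> < \<epsilon>" using *(1) by (simp add: pos_divide_less_eq)
    with * PL(2) onorm_le_entry_norm[of K] show ?thesis by linarith
  qed
  show ?thesis using small by blast
qed

end
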